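(* In both the DC case and the AC case: given any $\rho\in\mathbb{R}$, there exists a $(\varphi,T)$-ergodic Borel probability measure on $\mathcal{X}$ supported on a set of rotationally ordered configurations with rotation number $\rho$.
   Context: Setting. $V:\mathbb{R}^2\to\mathbb{R}$ is $C^2$, satisfies $V(u+1,v+1)=V(u,v)$ and the twist condition $V_{12}(u,v)\le-\delta<0$ for some fixed $\delta$ (subscripts denote partial derivatives). $F$ is either constant (the DC case) or a $1$-periodic function of $t$ (the AC case); in the AC case $V$ and $F$ are in addition real analytic. The system is $$\frac{d}{dt}u_j(t)=-V_2(u_{j-1}(t),u_j(t))-V_1(u_j(t),u_{j+1}(t))+F(t),\qquad j\in\mathbb{Z}.$$ State space. $K_n=\{u\in\mathbb{R}^{\mathbb{Z}}:\sup_i|u_{i+1}-u_i|\le n\}$, $X=\bigcup_{n\ge1}K_n$, with the induced product topology. $\mathcal{X}=X/R$ and $\mathcal{K}_n=K_n/R$ are the quotients obtained by identifying $u$ with $Ru=u+1$. $T$ is the shift $(Tu)_i=u_{i-1}$. For $u\in X$, $\varphi^t(u)=u(t)$ denotes the solution with $u(0)=u$; it exists for all $t\ge0$, leaves each $\mathcal{K}_n$ forward invariant, is continuous on $\mathcal{K}_n$, and commutes with $R$ and $T$. Invariance and ergodicity. A Borel probability measure is $(\varphi,T)$-invariant if it is invariant under $T$ and under all $\varphi^t$, $t\ge0$ (DC case), respectively under $T$ and $\varphi^1$ (AC case). A set $A$ is $(\varphi,T)$-invariant if $T(A)=A$ and $\varphi^t(A)\subseteq A$ for all $t\ge0$ (DC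 case), respectively $T(A)=A$ and $\varphi^1(A)\subseteq A$ (AC case). A $(\varphi,T)$-invariant probability measure $\mu$ is $(\varphi,T)$-ergodic if $\mu(A)\in\{0,1\}$ for every Borel $(\varphi,T)$-invariant set $A$. Rotationally ordered configurations. $\mathbb{R}^{\mathbb{Z}}$ carries the partial order $w\ge v$ iff $w_j\ge v_j$ for all $j$. For $p,q\in\mathbb{Z}$ let $(T_{p,q}u)_i=u_{i+p}+q$. A configuration $u\in\mathbb{R}^{\mathbb{Z}}$ is rotationally ordered if for all $p,q\in\mathbb{Z}$ either $T_{p,q}u\le u$ or $T_{p,q}u\ge u$. The rotation number of $u$ is $\rho(u)=\lim_{|j-i|\to\infty}\frac{u_j-u_i}{j-i}$, when the limit exists (it exists for every rotationally ordered configuration). Both notions are invariant under $R$, so they make sense on $\mathcal{X}$. *)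

theory Defs
  imports "HOL-Probability.Probability"
begin

section \<open>Regularity of the potential and of the driving force\<close>

definition partial1 :: "(real \<Rightarrow> real \<Rightarrow> real) \<Rightarrow> real \<Rightarrow> real \<Rightarrow> real" where
  "partial1 f u v = deriv (\<lambda>x. f x v) u"

definition partial2 :: "(real \<Rightarrow> real \<Rightarrow> real) \<Rightarrow> real \<Rightarrow> real \<Rightarrow> real" where
  "partial2 f u v = deriv (\<lambda>y. f u y) v"

definition C1_plane :: "(real \<Rightarrow> real \<Rightarrow> real) \<Rightarrow> bool" where
  "C1_plane f \<longleftrightarrow>
     (\<forall>u v. (\<lambda>x. f x v) field_differentiable (at u)) \<and>
     (\<forall>u v. (\<lambda>y. f u y) field_differentiable (at v)) \<and>
     continuous_on UNIV (\<lambda>(u, v). partial1 f u v) \<and>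
     continuous_on UNIV (\<lambda>(u, v). partial2 f u v)"

definition C2_plane :: "(real \<Rightarrow> real \<Rightarrow> real) \<Rightarrow> bool" where
  "C2_plane f \<longleftrightarrow> C1_plane f \<and> C1_plane (partial1 f) \<and> C1_plane (partial2 f)"

definition real_analytic :: "(real \<Rightarrow> real) \<Rightarrow> bool" where
  "real_analytic f \<longleftrightarrow>
     (\<forall>t0. \<exists>r>0. \<exists>a. \<forall>t. \<bar>t - t0\<bar> < r \<longrightarrow> (\<lambda>n. a n * (t - t0) ^ n) sums f t)"

definition real_analytic_plane :: "(real \<Rightarrow> real \<Rightarrow> real) \<Rightarrow> bool" where
  "real_analytic_plane f \<longleftrightarrow>
     (\<forall>u0 v0. \<exists>r>0. \<exists>a :: nat \<Rightarrow> nat \<Rightarrow> real.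
        \<forall>u v. \<bar>u - u0\<bar> < r \<and> \<bar>v - v0\<bar> < r \<longrightarrow>
          ((\<lambda>(m, n). a m n * (u - u0) ^ m * (v - v0) ^ n) has_sum f u v) UNIV)"

datatype drive = DC | AC

fun admissible_drive :: "drive \<Rightarrow> (real \<Rightarrow> real \<Rightarrow> real) \<Rightarrow> (real \<Rightarrow> real) \<Rightarrow> bool" where
  "admissible_drive DC V F \<longleftrightarrow> (\<exists>c. \<forall>t. F t = c)"
| "admissible_drive AC V F \<longleftrightarrow>
     (\<forall>t. F (t + 1) = F t) \<and> real_analytic F \<and> real_analytic_plane V"

text \<open>The times \<open>t\<close> for which invariance under the time-\<open>t\<close> map is required.\<close>

fun flow_times :: "drive \<Rightarrow> real set" where
  "flow_times DC = {0..}"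
| "flow_times AC = {1}"


section \<open>Configurations and the flow\<close>

type_synonym config = "int \<Rightarrow> real"

text \<open>
  The library topology on \<^typ>\<open>int \<Rightarrow> real\<close> is the product topology, and its order is the
  pointwise order.
\<close>

definition K_conf :: "nat \<Rightarrow> config set" where
  "K_conf n = {u. \<forall>i. \<bar>u (i + 1) - u i\<bar> \<le> real n}"

definition X_conf :: "config set" where
  "X_conf = (\<Union>n\<in>{1..}. K_conf n)"

definition T_shift :: "config \<Rightarrow> config" where
  "T_shift u = (\<lambda>i. u (i - 1))"

text \<open>
  On each \<^term>\<open>K_conf n\<close> the vector field is bounded and uniformly Lipschitz, so solutions that
  remain in some \<^term>\<open>K_conf n\<close> on every compact time interval are unique. Requiring only
  \<open>x t \<in> X_conf\<close> for each \<open>t\<close> separately would not rule out spurious solutions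
  of the infinite system.
\<close>

definition is_solution ::
    "(real \<Rightarrow> real \<Rightarrow> real) \<Rightarrow> (real \<Rightarrow> real) \<Rightarrow> config \<Rightarrow> (real \<Rightarrow> config) \<Rightarrow> bool" where
  "is_solution V F u x \<longleftrightarrow>
     x 0 = u \<and>
     (\<forall>\<tau>\<ge>0. \<exists>n. \<forall>t\<in>{0..\<tau>}. x t \<in> K_conf n) \<and>
     (\<forall>t\<ge>0. \<forall>j. ((\<lambda>s. x s j) has_real_derivative
         (- partial2 V (x t (j - 1)) (x t j) - partial1 V (x t j) (x t (j + 1)) + F t))
         (at t within {0..}))"

definition flow :: "(real \<Rightarrow> real \<Rightarrow> real) \<Rightarrow> (real \<Rightarrow> real) \<Rightarrow> real \<Rightarrow> config \<Rightarrow> config" where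
  "flow V F t u = (THE w. \<exists>x. is_solution V F u x \<and> w = x t)"


section \<open>The quotient by the integer translations\<close>

definition R_rel :: "(config \<times> config) set" where
  "R_rel = {(u, v). u \<in> X_conf \<and> v \<in> X_conf \<and> (\<exists>k :: int. \<forall>i. v i = u i + of_int k)}"

definition X_quot :: "config set set" where
  "X_quot = X_conf // R_rel"

definition R_class :: "config \<Rightarrow> config set" where
  "R_class u = R_rel `` {u}"

definition X_quot_topology :: "config set topology" where
  "X_quot_topology = topology (\<lambda>U. U \<subseteq> X_quot \<and>
     openin (top_of_set X_conf) {u \<in> X_conf. R_class u \<in> U})"

definition X_quot_borel :: "config set measure" where
  "X_quot_borel = sigma X_quot {U. openin X_quot_topology U}"

text \<open>
  The map of classes induced by \<open>f\<close>; for \<open>f\<close> commuting with the translation by 1 all the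
  sets in the union coincide.
\<close>

definition quot_map :: "(config \<Rightarrow> config) \<Rightarrow> config set \<Rightarrow> config set" where
  "quot_map f c = (\<Union>u\<in>c. R_class (f u))"

lemma equiv_R_rel: "equiv X_conf R_rel"
proof (rule equivI)
  show "R_rel \<subseteq> X_conf \<times> X_conf"
    by (auto simp: R_rel_def)
  show "refl_on X_conf R_rel"
    by (auto simp: refl_on_def R_rel_def intro: exI[of _ 0])
  show "sym R_rel"
  proof (rule symI)
    fix u v assume "(u, v) \<in> R_rel"
    then obtain k :: int where "u \<in> X_conf" "v \<in> X_conf" "\<forall>i. v i = u i + of_int k"
      by (auto simp: R_rel_def)
    then show "(v, u) \<in> R_rel"
      by (auto simp: R_rel_def intro: exI[of _ "- k"])
  qed
  show "trans R_rel"
  proof (rule transI)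
    fix u v w assume "(u, v) \<in> R_rel" "(v, w) \<in> R_rel"
    then obtain k l :: int where "u \<in> X_conf" "w \<in> X_conf"
        "\<forall>i. v i = u i + of_int k" "\<forall>i. w i = v i + of_int l"
      by (auto simp: R_rel_def)
    then show "(u, w) \<in> R_rel"
      by (auto simp: R_rel_def intro: exI[of _ "k + l"])
  qed
qed

lemma openin_X_quot_topology:
  "openin X_quot_topology U \<longleftrightarrow>
     U \<subseteq> X_quot \<and> openin (top_of_set X_conf) {u \<in> X_conf. R_class u \<in> U}"
proof -
  have "istopology (\<lambda>U. U \<subseteq> X_quot \<and> openin (top_of_set X_conf) {u \<in> X_conf. R_class u \<in> U})"
    unfolding istopology_def
  proof (intro conjI allI impI; (elim conjE)?)
    fix A B
    assume "openin (top_of_set X_conf) {u \<in> X_conf. R_class u \<in> A}"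
           "openin (top_of_set X_conf) {u \<in> X_conf. R_class u \<in> B}"
    then have "openin (top_of_set X_conf)
        ({u \<in> X_conf. R_class u \<in> A} \<inter> {u \<in> X_conf. R_class u \<in> B})"
      by (rule openin_Int)
    then show "openin (top_of_set X_conf) {u \<in> X_conf. R_class u \<in> A \<inter> B}"
      by (rule back_subst[where P = "openin _"]) auto
  next
    fix \<U>
    assume *: "\<forall>U\<in>\<U>. U \<subseteq> X_quot \<and> openin (top_of_set X_conf) {u \<in> X_conf. R_class u \<in> U}"
    then show "\<Union>\<U> \<subseteq> X_quot"
      by blast
    have "openin (top_of_set X_conf) (\<Union>U\<in>\<U>. {u \<in> X_conf. R_class u \<in> U})"
      using * by (intro openin_Union) auto
    then show "openin (top_of_set X_conf) {u \<in> X_conf. R_class u \<in> \<Union>\<U>}"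
      by (rule back_subst[where P = "openin _"]) auto
  qed auto
  then show ?thesis
    unfolding X_quot_topology_def by (simp add: topology_inverse')
qed

lemma quotient_map_R_class: "quotient_map (top_of_set X_conf) X_quot_topology R_class"
proof -
  have cls: "R_class u \<in> X_quot" if "u \<in> X_conf" for u
    using that by (auto simp: R_class_def X_quot_def intro: quotientI)
  have "{u \<in> X_conf. R_class u \<in> X_quot} = X_conf"
    using cls by blast
  then have "openin X_quot_topology X_quot"
    by (simp add: openin_X_quot_topology)
  then have ts: "topspace X_quot_topology = X_quot"
    by (meson openin_X_quot_topology openin_subset openin_topspace subset_antisym)
  have im: "R_class ` X_conf = X_quot"
    by (auto simp: R_class_def X_quot_def quotient_def)
  show ?thesis
    unfolding quotient_map_def by (simp add: ts im openin_X_quot_topology)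
qed


section \<open>Invariant and ergodic measures\<close>

definition phase_maps ::
    "drive \<Rightarrow> (real \<Rightarrow> real \<Rightarrow> real) \<Rightarrow> (real \<Rightarrow> real) \<Rightarrow> (config set \<Rightarrow> config set) set" where
  "phase_maps d V F = (\<lambda>t. quot_map (flow V F t)) ` flow_times d"

definition measure_invariant :: "'a measure \<Rightarrow> ('a \<Rightarrow> 'a) \<Rightarrow> bool" where
  "measure_invariant \<mu> f \<longleftrightarrow> f \<in> measurable \<mu> \<mu> \<and> distr \<mu> \<mu> f = \<mu>"

definition flow_shift_invariant_measure ::
    "drive \<Rightarrow> (real \<Rightarrow> real \<Rightarrow> real) \<Rightarrow> (real \<Rightarrow> real) \<Rightarrow> config set measure \<Rightarrow> bool" where
  "flow_shift_invariant_measure d V F \<mu> \<longleftrightarrow>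
     measure_invariant \<mu> (quot_map T_shift) \<and> (\<forall>f\<in>phase_maps d V F. measure_invariant \<mu> f)"

definition flow_shift_invariant_set ::
    "drive \<Rightarrow> (real \<Rightarrow> real \<Rightarrow> real) \<Rightarrow> (real \<Rightarrow> real) \<Rightarrow> config set set \<Rightarrow> bool" where
  "flow_shift_invariant_set d V F A \<longleftrightarrow>
     quot_map T_shift ` A = A \<and> (\<forall>f\<in>phase_maps d V F. f ` A \<subseteq> A)"

definition flow_shift_ergodic ::
    "drive \<Rightarrow> (real \<Rightarrow> real \<Rightarrow> real) \<Rightarrow> (real \<Rightarrow> real) \<Rightarrow> config set measure \<Rightarrow> bool" where
  "flow_shift_ergodic d V F \<mu> \<longleftrightarrow>
     sets \<mu> = sets X_quot_borel \<and> prob_space \<mu> \<and>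
     flow_shift_invariant_measure d V F \<mu> \<and>
     (\<forall>A\<in>sets \<mu>. flow_shift_invariant_set d V F A \<longrightarrow> measure \<mu> A \<in> {0, 1})"


section \<open>Rotationally ordered configurations\<close>

definition T_trans :: "int \<Rightarrow> int \<Rightarrow> config \<Rightarrow> config" where
  "T_trans p q u = (\<lambda>i. u (i + p) + of_int q)"

definition rotationally_ordered :: "config \<Rightarrow> bool" where
  "rotationally_ordered u \<longleftrightarrow> (\<forall>p q. T_trans p q u \<le> u \<or> u \<le> T_trans p q u)"

definition has_rotation_number :: "config \<Rightarrow> real \<Rightarrow> bool" where
  "has_rotation_number u \<rho> \<longleftrightarrow>
     ((\<lambda>(i, j). (u j - u i) / of_int (j - i)) \<longlongrightarrow> \<rho>)
       (filtercomap (\<lambda>(i, j). \<bar>j - i\<bar>) at_top)"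

end

theory Submission
  imports Defs "HOL-Analysis.Kronecker_Approximation_Theorem"
begin

text \<open>
  A nondecreasing \<open>h\<close> with \<open>h (x + 1) = h x + 1\<close> yields the rotationally ordered configurations
  \<open>u\<^sub>j = h (\<rho> j + x)\<close>, and the flow maps this family to the family of another such function
  \<open>\<Phi>\<^sup>t h\<close>. Since \<open>\<Phi>\<close> is order preserving and commutes with translations of \<open>x\<close>, its orbits stay at
  bounded distance from translations at a constant speed \<open>c\<close>, and monotone limits in the moving
  frame produce a travelling wave \<open>\<Phi>\<^sup>t h = h (\<cdot> + c t)\<close>; no compactness or fixed point theorem is
  needed. Along the wave \<open>x \<mapsto> (h (\<rho> j + x))\<^sub>j\<close> shift and flow act as the rotations by \<open>- \<rho>\<close> and
  \<open>c t\<close> of the circle, so the image of a measure on the circle that is ergodic for these rotations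
  is the desired measure: Lebesgue measure if one angle is irrational, and otherwise the uniform
  measure on a finite subgroup.
\<close>

section \<open>Cooperative lattice equations\<close>

text \<open>An infinite chain has no extremal site, so comparison cannot rest on a first touching
  point. Differences of solutions are instead measured against a weight growing exponentially in the
  site index; the same estimate yields order preservation, uniqueness, and continuity of the flow on
  each \<open>K_conf n\<close>. The profiles \<open>h\<close> may be discontinuous. This is
  harmless: the flow acts on each configuration of the family separately, so pointwise limits of
  profiles suffice, and monotone functions are Borel. Under the flow, invariant sets are only
  forward invariant, so ergodicity has to come from inclusions instead of equalities: for an
  irrational angle from masses that cannot decrease along a dense forward orbit, for rational angles
  from the fact that a rotation of finite order is inverted by one of its powers. In the DC case the
  angles \<open>c t\<close> fill a half line unless \<open>c = 0\<close>, so a moving wave always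
  has an irrational angle. Hence the purely rational alternative involves at most two angles, which
  have a common denominator.\<close>

lemma le_barrier:
  fixes z z' :: "real \<Rightarrow> real"
  assumes "0 \<le> t" "z 0 \<le> c"
    and deriv: "\<And>s. s \<in> {0..t} \<Longrightarrow> (z has_real_derivative z' s) (at s within {0..t})"
    and decr: "\<And>s. s \<in> {0..t} \<Longrightarrow> c < z s \<Longrightarrow> z' s \<le> 0"
  shows "z t \<le> c"
proof (rule ccontr)
  assume "\<not> z t \<le> c"
  have cont: "continuous_on {0..t} z"
    using deriv by (rule DERIV_continuous_on)
  define B where "B = {s \<in> {0..t}. z s \<in> {..c}}"
  have "closed B"
    unfolding B_def using continuous_closed_preimage[OF cont, of "{..c}"]
    by (simp add: vimage_def Int_def)
  moreover have "bounded B"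
    by (rule bounded_subset[of "{0..t}"]) (auto simp: B_def)
  ultimately have "compact B"
    by (simp add: compact_eq_bounded_closed)
  moreover have "0 \<in> B"
    using assms by (auto simp: B_def)
  \<comment> \<open>\<open>s\<close> is the last time at which \<open>z\<close> is at most
    \<open>c\<close>. Afterwards the barrier is exceeded, so \<open>z\<close> is nonincreasing up to
    \<open>t\<close>, contradicting \<open>z s \<le> c < z t\<close>.\<close>
  ultimately obtain s where s: "s \<in> B" "\<And>r. r \<in> B \<Longrightarrow> r \<le> s"
    using compact_attains_sup[of B] by auto
  have "s < t"
    using s \<open>\<not> z t \<le> c\<close> by (cases "s = t") (auto simp: B_def)
  have above: "c < z r" if "s < r" "r \<le> t" for r
  proof (rule ccontr)
    assume "\<not> c < z r"
    then have "r \<in> B"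
      using that s(1) by (auto simp: B_def)
    then show False
      using s(2)[of r] that by simp
  qed
  have "z t \<le> z s"
  proof (rule DERIV_nonpos_imp_decreasing_open[where f = z])
    show "s \<le> t"
      using \<open>s < t\<close> by simp
    show "continuous_on {s..t} z"
      using cont by (rule continuous_on_subset) (use s in \<open>auto simp: B_def\<close>)
    fix r assume r: "s < r" "r < t"
    then have "r \<in> interior {0..t}"
      using s(1) by (auto simp: B_def interior_atLeastAtMost_real)
    then have "at r within {0..t} = at r"
      by (rule at_within_interior)
    then have "(z has_real_derivative z' r) (at r)"
      using deriv[of r] r s(1) by (auto simp: B_def)
    moreover have "z' r \<le> 0"
      using decr[of r] above[of r] r s(1) by (auto simp: B_def)
    ultimately show "\<exists>y. (z has_real_derivative y) (at r) \<and> y \<le> 0"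
      by blast
  qed
  then show False
    using s(1) \<open>\<not> z t \<le> c\<close> by (auto simp: B_def)
qed

section \<open>Comparison of solutions in a weighted norm\<close>

text \<open>Exponential growth keeps neighbouring weights comparable and dominates the linear growth
  of configurations in \<open>K_conf n\<close>, so that sitewise convergence there becomes
  convergence in the weighted norm.\<close>

definition weight :: "int \<Rightarrow> real" where
  "weight j = 2 ^ nat \<bar>j\<bar>"

lemma weight_pos: "0 < weight j" and weight_ge_1: "1 \<le> weight j"
  by (simp_all add: weight_def)

lemma weight_neighbour: "\<bar>i - j\<bar> \<le> 1 \<Longrightarrow> weight i \<le> 2 * weight j"
proof -
  assume "\<bar>i - j\<bar> \<le> 1"
  then have "nat \<bar>i\<bar> \<le> Suc (nat \<bar>j\<bar>)"
    by linarith
  then have "(2::real) ^ nat \<bar>i\<bar> \<le> 2 ^ Suc (nat \<bar>j\<bar>)"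
    by (intro power_increasing) auto
  then show ?thesis
    by (simp add: weight_def)
qed

text \<open>\<open>cooperative\<close> is the Kamke condition: monotone in both neighbours, with no
  sign prescribed in the own site \<open>b\<close>. The other bounds are global, so comparison holds
  without growth conditions on the solutions.\<close>

locale cooperative_lattice =
  fixes G :: "real \<Rightarrow> real \<Rightarrow> real \<Rightarrow> real \<Rightarrow> real" and L M :: real
  assumes L_pos: "0 < L"
    and bounded: "\<bar>G t a b c\<bar> \<le> M"
    and lipschitz: "\<bar>G t a b c - G t a' b' c'\<bar> \<le> L * (\<bar>a - a'\<bar> + \<bar>b - b'\<bar> + \<bar>c - c'\<bar>)"
    and cooperative: "a \<le> a' \<Longrightarrow> c \<le> c' \<Longrightarrow> G t a b c \<le> G t a' b c'"
    and cont: "continuous_on UNIV (\<lambda>t. G t a b c)"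
begin

definition solves :: "real \<Rightarrow> (real \<Rightarrow> config) \<Rightarrow> bool" where
  "solves \<tau> x \<longleftrightarrow> (\<forall>t\<in>{0..\<tau>}. \<forall>j. ((\<lambda>s. x s j) has_real_derivative
     G t (x t (j - 1)) (x t j) (x t (j + 1))) (at t within {0..\<tau>}))"

lemma solvesD:
  "solves \<tau> x \<Longrightarrow> t \<in> {0..\<tau>} \<Longrightarrow> ((\<lambda>s. x s j) has_real_derivative
     G t (x t (j - 1)) (x t j) (x t (j + 1))) (at t within {0..\<tau>})"
  by (simp add: solves_def)

lemma M_nonneg: "0 \<le> M"
  using bounded[of 0 0 0 0] by linarith

text \<open>While the weighted difference of two solutions exceeds half of its a priori bound \<open>m\<close>, the
  growth allowed by the Lipschitz condition is beaten by the exponential weight.\<close>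

lemma comparison_halving:
  assumes x: "solves \<tau> x" and y: "solves \<tau> y"
    and init: "\<And>j. x 0 j - y 0 j \<le> \<epsilon> * weight j" and "0 \<le> \<epsilon>" "0 \<le> m"
    and m: "\<And>t j. t \<in> {0..\<tau>} \<Longrightarrow> x t j - y t j \<le> m * exp (10 * L * t) * weight j"
    and t: "t \<in> {0..\<tau>}"
  shows "x t j - y t j \<le> max \<epsilon> (m / 2) * exp (10 * L * t) * weight j"
proof -
  \<comment> \<open>After division by \<open>exp (10 * L * s)\<close> the claim says that
    \<open>z\<close> stays below the constant barrier \<open>c\<close>.\<close>
  define c where "c = max \<epsilon> (m / 2) * weight j"
  define z where "z = (\<lambda>s. (x s j - y s j) * exp (- (10 * L * s)))"
  define gx where "gx = (\<lambda>s. G s (x s (j - 1)) (x s j) (x s (j + 1)))"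
  define gy where "gy = (\<lambda>s. G s (y s (j - 1)) (y s j) (y s (j + 1)))"
  define z' where "z' = (\<lambda>s. (gx s - gy s - 10 * L * (x s j - y s j)) * exp (- (10 * L * s)))"
  have "0 \<le> c"
    using \<open>0 \<le> \<epsilon>\<close> weight_pos[of j] by (simp add: c_def)
  have "z t \<le> c"
  proof (rule le_barrier[where z = z and z' = z'])
    show "0 \<le> t"
      using t by simp
    have "\<epsilon> * weight j \<le> c"
      unfolding c_def using weight_pos[of j] by (intro mult_right_mono) auto
    then show "z 0 \<le> c"
      using init[of j] by (simp add: z_def)
    fix s assume s: "s \<in> {0..t}"
    then have s\<tau>: "s \<in> {0..\<tau>}"
      using t by simp
    have sub: "{0..t} \<subseteq> {0..\<tau>}"
      using t by auto
    have dx: "((\<lambda>s. x s j) has_real_derivative gx s) (at s within {0..t})"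
      and dy: "((\<lambda>s. y s j) has_real_derivative gy s) (at s within {0..t})"
      unfolding gx_def gy_def
      using DERIV_subset[OF solvesD[OF x s\<tau>] sub] DERIV_subset[OF solvesD[OF y s\<tau>] sub] by auto
    show "(z has_real_derivative z' s) (at s within {0..t})"
      unfolding z_def z'_def
      by (auto intro!: derivative_eq_intros dx dy simp: algebra_simps)
    assume "c < z s"
    define E where "E = exp (10 * L * s)"
    have E: "0 < E" "exp (- (10 * L * s)) = 1 / E"
      by (auto simp: E_def exp_minus divide_simps)
    have b: "c * E < x s j - y s j"
      using \<open>c < z s\<close> E(1) unfolding z_def E(2) by (simp add: pos_less_divide_eq)
    have nb: "x s i - y s i \<le> 2 * (m * E * weight j)" if "\<bar>i - j\<bar> \<le> 1" for i
    proof -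
      have "x s i - y s i \<le> m * E * weight i"
        using m[OF s\<tau>] by (simp add: E_def)
      also have "\<dots> \<le> m * E * (2 * weight j)"
        using weight_neighbour[OF that] \<open>0 \<le> m\<close> E by (intro mult_left_mono) auto
      finally show ?thesis by simp
    qed
    have nonneg: "0 \<le> m * E * weight j"
      using \<open>0 \<le> m\<close> E weight_pos[of j] by simp
    \<comment> \<open>Replacing the neighbours of \<open>x\<close> by the larger of \<open>x\<close>
      and \<open>y\<close> can only increase \<open>G\<close>. The neighbour differences are then
      nonnegative, so the one-sided bound \<open>m\<close> controls their absolute values.\<close>
    have "gx s \<le> G s (max (x s (j - 1)) (y s (j - 1))) (x s j) (max (x s (j + 1)) (y s (j + 1)))"
      unfolding gx_def by (rule cooperative) auto
    also have "\<dots> \<le> gy s + L * (\<bar>max (x s (j - 1)) (y s (j - 1)) - y s (j - 1)\<bar> + \<bar>x s j - y s j\<bar>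
        + \<bar>max (x s (j + 1)) (y s (j + 1)) - y s (j + 1)\<bar>)"
      unfolding gy_def using lipschitz[of s "max (x s (j - 1)) (y s (j - 1))" "x s j"
        "max (x s (j + 1)) (y s (j + 1))" "y s (j - 1)" "y s j" "y s (j + 1)"] by linarith
    \<comment> \<open>Each neighbour contributes 2, the ratio of weights, and the own site 1. Since
      \<open>5 * L * m\<close> equals \<open>10 * L * (m / 2)\<close>, the rate
      \<open>10 * L\<close> is exactly what makes half of \<open>m\<close> a barrier.\<close>
    also have "\<dots> \<le> gy s + L * (5 * (m * E * weight j))"
    proof -
      have "\<bar>max (x s (j - 1)) (y s (j - 1)) - y s (j - 1)\<bar> \<le> 2 * (m * E * weight j)"
        using nb[of "j - 1"] nonneg by (auto simp: max_def)
      moreover have "\<bar>max (x s (j + 1)) (y s (j + 1)) - y s (j + 1)\<bar> \<le> 2 * (m * E * weight j)"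
        using nb[of "j + 1"] nonneg by (auto simp: max_def)
      moreover have "\<bar>x s j - y s j\<bar> \<le> m * E * weight j"
      proof -
        have "0 \<le> c * E" using \<open>0 \<le> c\<close> E by simp
        then show ?thesis
          using b m[OF s\<tau>, of j] by (simp add: E_def)
      qed
      ultimately show ?thesis
        using L_pos by (intro add_left_mono mult_left_mono) auto
    qed
    finally have g: "gx s - gy s \<le> 10 * L * (m / 2 * weight j * E)"
      by (simp add: algebra_simps)
    have "m / 2 * weight j * E \<le> c * E"
      unfolding c_def using weight_pos[of j] E by (intro mult_right_mono) auto
    then have "10 * L * (m / 2 * weight j * E) \<le> 10 * L * (x s j - y s j)"
      using b L_pos by (intro mult_left_mono) auto
    then show "z' s \<le> 0"
      unfolding z'_def using g by (intro mult_nonpos_nonneg) auto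
  qed
  then have "z t * exp (10 * L * t) \<le> c * exp (10 * L * t)"
    by (intro mult_right_mono) auto
  moreover have "z t * exp (10 * L * t) = x t j - y t j"
    by (simp add: z_def mult.assoc flip: exp_add)
  ultimately have "x t j - y t j \<le> c * exp (10 * L * t)"
    by simp
  then show ?thesis
    by (simp add: c_def mult_ac)
qed

text \<open>Halving replaces a bound \<open>m\<close> by \<open>max \<epsilon> (m / 2)\<close>.
  Iterating it drives the contribution of \<open>D\<close> to zero and leaves only
  \<open>\<epsilon>\<close>.\<close>

lemma comparison_bounded:
  assumes x: "solves \<tau> x" and y: "solves \<tau> y"
    and init: "\<And>j. x 0 j - y 0 j \<le> \<epsilon> * weight j" and "0 \<le> \<epsilon>"
    and D: "\<And>t j. t \<in> {0..\<tau>} \<Longrightarrow> x t j - y t j \<le> D * weight j"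
    and t: "t \<in> {0..\<tau>}"
  shows "x t j - y t j \<le> \<epsilon> * exp (10 * L * t) * weight j"
proof -
  have iter: "x t j - y t j \<le> max \<epsilon> (\<bar>D\<bar> / 2 ^ k) * exp (10 * L * t) * weight j"
    if "t \<in> {0..\<tau>}" for k t j
    using that
  proof (induction k arbitrary: t j)
    case 0
    have "x t j - y t j \<le> D * weight j"
      using D[OF 0] .
    also have "\<dots> \<le> (max \<epsilon> \<bar>D\<bar> * exp (10 * L * t)) * weight j"
    proof (rule mult_right_mono)
      have "1 \<le> exp (10 * L * t)"
        using L_pos 0 by simp
      then have "max \<epsilon> \<bar>D\<bar> * 1 \<le> max \<epsilon> \<bar>D\<bar> * exp (10 * L * t)"
        by (intro mult_left_mono) auto
      then show "D \<le> max \<epsilon> \<bar>D\<bar> * exp (10 * L * t)"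
        by linarith
    qed (use weight_pos[of j] in simp)
    finally show ?case by simp
  next
    case (Suc k)
    have "x t j - y t j \<le> max \<epsilon> (max \<epsilon> (\<bar>D\<bar> / 2 ^ k) / 2) * exp (10 * L * t) * weight j"
      by (rule comparison_halving[OF x y init \<open>0 \<le> \<epsilon>\<close> _ Suc.IH Suc.prems])
        (use \<open>0 \<le> \<epsilon>\<close> in auto)
    also have "max \<epsilon> (max \<epsilon> (\<bar>D\<bar> / 2 ^ k) / 2) = max \<epsilon> (\<bar>D\<bar> / 2 ^ Suc k)"
      using \<open>0 \<le> \<epsilon>\<close> by (auto simp: max_def)
    finally show ?case .
  qed
  have "(\<lambda>k. \<bar>D\<bar> / 2 ^ k) \<longlonglongrightarrow> 0"
    using tendsto_mult_right_zero[OF LIMSEQ_realpow_zero[of "1 / 2 :: real"], of "\<bar>D\<bar>"]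
    by (simp add: power_divide)
  then have "(\<lambda>k. max \<epsilon> (\<bar>D\<bar> / 2 ^ k) * exp (10 * L * t) * weight j)
      \<longlonglongrightarrow> max \<epsilon> 0 * exp (10 * L * t) * weight j"
    by (intro tendsto_intros)
  then have "x t j - y t j \<le> max \<epsilon> 0 * exp (10 * L * t) * weight j"
    by (rule LIMSEQ_le_const) (use iter[OF t] in blast)
  then show ?thesis
    using \<open>0 \<le> \<epsilon>\<close> by (simp add: max_def split: if_splits)
qed

lemma speed_bound:
  assumes "solves \<tau> x" "t \<in> {0..\<tau>}"
  shows "\<bar>x t j - x 0 j\<bar> \<le> M * t"
proof -
  have "norm (x t j - x 0 j) \<le> M * norm (t - 0)"
  proof (rule field_differentiable_bound[of "{0..\<tau>}" "\<lambda>s. x s j"])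
    fix s assume s: "s \<in> {0..\<tau>}"
    show "((\<lambda>s. x s j) has_field_derivative G s (x s (j - 1)) (x s j) (x s (j + 1)))
        (at s within {0..\<tau>})"
      using solvesD[OF assms(1) s] .
    show "norm (G s (x s (j - 1)) (x s j) (x s (j + 1))) \<le> M"
      using bounded by simp
  qed (use assms in auto)
  then show ?thesis
    using assms by simp
qed

text \<open>Two solutions separate at speed at most \<open>2 * M\<close>, and weights are at least
  1; this supplies the a priori bound. The case \<open>\<epsilon> = 0\<close> is order preservation,
  small \<open>\<epsilon>\<close> gives continuous dependence.\<close>

lemma comparison:
  assumes x: "solves \<tau> x" and y: "solves \<tau> y"
    and init: "\<And>j. x 0 j - y 0 j \<le> \<epsilon> * weight j" and "0 \<le> \<epsilon>"
    and t: "t \<in> {0..\<tau>}"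
  shows "x t j - y t j \<le> \<epsilon> * exp (10 * L * t) * weight j"
proof (rule comparison_bounded[OF x y init \<open>0 \<le> \<epsilon>\<close> _ t])
  fix s i assume s: "s \<in> {0..\<tau>}"
  have "x s i - y s i \<le> \<epsilon> * weight i + 2 * (M * s)"
    using speed_bound[OF x s, of i] speed_bound[OF y s, of i] init[of i] by linarith
  also have "2 * (M * s) \<le> 2 * (M * \<tau>)"
    using s M_nonneg by (intro mult_left_mono) auto
  also have "\<epsilon> * weight i + 2 * (M * \<tau>) \<le> (\<epsilon> + 2 * (M * \<tau>)) * weight i"
    using mult_left_mono[OF weight_ge_1[of i], of "2 * (M * \<tau>)"] M_nonneg s
    by (simp add: distrib_right)
  finally show "x s i - y s i \<le> (\<epsilon> + 2 * (M * \<tau>)) * weight i"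
    by simp
qed

text \<open>The Lipschitz bound is uniform in time, so continuity in \<open>t\<close> with frozen
  arguments is enough.\<close>

lemma continuous_G_comp:
  assumes "\<And>i. continuous_on A (\<lambda>s. x s i)"
  shows "continuous_on A (\<lambda>s. G s (x s (j - 1)) (x s j) (x s (j + 1)))"
proof (rule continuous_on_sequentiallyI)
  fix s :: "nat \<Rightarrow> real" and t
  assume s: "\<forall>n. s n \<in> A" "t \<in> A" "s \<longlonglongrightarrow> t"
  define q where "q = (\<lambda>n. L * (\<bar>x (s n) (j - 1) - x t (j - 1)\<bar> + \<bar>x (s n) j - x t j\<bar>
      + \<bar>x (s n) (j + 1) - x t (j + 1)\<bar>))"
  define r where "r = (\<lambda>n. G (s n) (x t (j - 1)) (x t j) (x t (j + 1)))"
  have xs: "(\<lambda>n. x (s n) i) \<longlonglongrightarrow> x t i" for i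
    using assms[of i] s by (auto simp: continuous_on_sequentially comp_def)
  have "q \<longlonglongrightarrow> L * (\<bar>x t (j - 1) - x t (j - 1)\<bar> + \<bar>x t j - x t j\<bar> + \<bar>x t (j + 1) - x t (j + 1)\<bar>)"
    unfolding q_def by (intro tendsto_intros xs)
  then have q: "q \<longlonglongrightarrow> 0"
    by simp
  have r: "r \<longlonglongrightarrow> G t (x t (j - 1)) (x t j) (x t (j + 1))"
    unfolding r_def using cont s(3) by (auto simp: continuous_on_sequentially comp_def)
  have "(\<lambda>n. G (s n) (x (s n) (j - 1)) (x (s n) j) (x (s n) (j + 1)) - r n) \<longlonglongrightarrow> 0"
  proof (rule Lim_null_comparison[OF _ q])
    show "\<forall>\<^sub>F n in sequentially.
        norm (G (s n) (x (s n) (j - 1)) (x (s n) j) (x (s n) (j + 1)) - r n) \<le> q n"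
      unfolding r_def q_def using lipschitz by simp
  qed
  from tendsto_add[OF this r]
  show "(\<lambda>n. G (s n) (x (s n) (j - 1)) (x (s n) j) (x (s n) (j + 1)))
      \<longlonglongrightarrow> G t (x t (j - 1)) (x t j) (x t (j + 1))"
    by simp
qed

section \<open>Existence of solutions by Picard iteration\<close>

fun picard :: "config \<Rightarrow> nat \<Rightarrow> real \<Rightarrow> config" where
  "picard u 0 t j = u j"
| "picard u (Suc k) t j = u j + integral {0..t}
     (\<lambda>s. G s (picard u k s (j - 1)) (picard u k s j) (picard u k s (j + 1)))"

lemma continuous_picard: "continuous_on {0..\<tau>} (\<lambda>s. picard u k s j)"
proof (induction k arbitrary: j)
  case (Suc k)
  have "continuous_on {0..\<tau>} (\<lambda>s. G s (picard u k s (j - 1)) (picard u k s j) (picard u k s (j + 1)))"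
    by (rule continuous_G_comp) (rule Suc)
  then show ?case
    by (auto intro!: continuous_intros indefinite_integral_continuous_1 integrable_continuous_real)
qed simp

text \<open>This is a contraction by 1/2 in the supremum norm weighted by
  \<open>exp (- 6 * L * s)\<close>: the Lipschitz bound over three sites costs \<open>3 * L\<close>,
  and integrating the exponential gains \<open>1 / (6 * L)\<close>.\<close>

lemma integral_diff_bound:
  assumes "0 \<le> t" "0 \<le> C"
    and x: "\<And>i. continuous_on {0..t} (\<lambda>s. x s i)" and y: "\<And>i. continuous_on {0..t} (\<lambda>s. y s i)"
    and xy: "\<And>s i. s \<in> {0..t} \<Longrightarrow> \<bar>x s i - y s i\<bar> \<le> C * exp (6 * L * s)"
  shows "\<bar>integral {0..t} (\<lambda>s. G s (x s (j - 1)) (x s j) (x s (j + 1)))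
     - integral {0..t} (\<lambda>s. G s (y s (j - 1)) (y s j) (y s (j + 1)))\<bar> \<le> C / 2 * exp (6 * L * t)"
proof -
  define gx where "gx = (\<lambda>s. G s (x s (j - 1)) (x s j) (x s (j + 1)))"
  define gy where "gy = (\<lambda>s. G s (y s (j - 1)) (y s j) (y s (j + 1)))"
  have int: "gx integrable_on {0..t}" "gy integrable_on {0..t}"
    unfolding gx_def gy_def
    by (intro integrable_continuous_real continuous_G_comp x y)+
  have ei: "((\<lambda>s. 3 * L * C * exp (6 * L * s)) has_integral
      C / 2 * exp (6 * L * t) - C / 2 * exp (6 * L * 0)) {0..t}"
    using \<open>0 \<le> t\<close>
    by (intro fundamental_theorem_of_calculus)
       (auto intro!: derivative_eq_intros simp flip: has_real_derivative_iff_has_vector_derivative)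
  have "norm (integral {0..t} (\<lambda>s. gx s - gy s)) \<le> integral {0..t} (\<lambda>s. 3 * L * C * exp (6 * L * s))"
  proof (rule integral_norm_bound_integral)
    fix s assume s: "s \<in> {0..t}"
    have "\<bar>gx s - gy s\<bar> \<le> L * (\<bar>x s (j - 1) - y s (j - 1)\<bar> + \<bar>x s j - y s j\<bar> + \<bar>x s (j + 1) - y s (j + 1)\<bar>)"
      unfolding gx_def gy_def by (rule lipschitz)
    also have "\<dots> \<le> L * (C * exp (6 * L * s) + C * exp (6 * L * s) + C * exp (6 * L * s))"
      using L_pos xy[OF s] by (intro mult_left_mono add_mono) auto
    finally show "norm (gx s - gy s) \<le> 3 * L * C * exp (6 * L * s)"
      by (simp add: algebra_simps)
  qed (use int ei in \<open>auto intro: integrable_diff\<close>)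
  also have "\<dots> \<le> C / 2 * exp (6 * L * t)"
    using integral_unique[OF ei] \<open>0 \<le> C\<close> by simp
  finally show ?thesis
    using integral_diff[OF int] by (simp add: gx_def gy_def)
qed

lemma picard_step:
  assumes "0 \<le> t"
  shows "\<bar>picard u (Suc k) t j - picard u k t j\<bar> \<le> M / L * (1 / 2) ^ k * exp (6 * L * t)"
  using assms
proof (induction k arbitrary: t j)
  case 0
  have "norm (integral {0..t} (\<lambda>s. G s (u (j - 1)) (u j) (u (j + 1)))) \<le> integral {0..t} (\<lambda>s. M)"
    using bounded
    by (intro integral_norm_bound_integral integrable_continuous_real continuous_on_subset[OF cont]) auto
  also have "\<dots> = M * t"
    using 0 by simp
  also have "\<dots> \<le> M / L * exp (6 * L * t)"
  proof -
    \<comment> \<open>The first step grows linearly in time; absorbing \<open>L * t\<close> into the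
      exponential weight produces the constant \<open>M / L\<close>.\<close>
    have "L * t \<le> exp (6 * L * t)"
      using exp_ge_add_one_self[of "6 * L * t"] mult_nonneg_nonneg[of L t] L_pos 0 by linarith
    then have "M * (L * t) \<le> M * exp (6 * L * t)"
      using M_nonneg by (rule mult_left_mono)
    then show ?thesis
      using L_pos by (simp add: field_simps)
  qed
  finally show ?case by simp
next
  case (Suc k)
  have "\<bar>integral {0..t} (\<lambda>s. G s (picard u (Suc k) s (j - 1)) (picard u (Suc k) s j) (picard u (Suc k) s (j + 1)))
     - integral {0..t} (\<lambda>s. G s (picard u k s (j - 1)) (picard u k s j) (picard u k s (j + 1)))\<bar>
     \<le> (M / L * (1 / 2) ^ k) / 2 * exp (6 * L * t)"
    using Suc M_nonneg L_pos
    by (intro integral_diff_bound continuous_picard) auto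
  then show ?case
    by (simp only: picard.simps(2)[of u "Suc k" t j] picard.simps(2)[of u k t j]) simp
qed

text \<open>A telescoping sum of \<open>picard_step\<close>. With the bound written as a difference
  of powers the induction on \<open>l\<close> closes exactly.\<close>

lemma picard_diff:
  assumes "0 \<le> t" "k \<le> l"
  shows "\<bar>picard u l t j - picard u k t j\<bar> \<le> 2 * (M / L) * exp (6 * L * t) * ((1 / 2) ^ k - (1 / 2) ^ l)"
  using assms(2)
proof (induction l rule: dec_induct)
  case (step l)
  define C where "C = 2 * (M / L) * exp (6 * L * t)"
  have "\<bar>picard u (Suc l) t j - picard u l t j\<bar> \<le> C * ((1 / 2) ^ l - (1 / 2) ^ Suc l)"
    using picard_step[OF assms(1), of u l j] by (simp add: C_def mult_ac del: picard.simps)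
  moreover have "\<bar>picard u l t j - picard u k t j\<bar> \<le> C * ((1 / 2) ^ k - (1 / 2) ^ l)"
    using step by (simp add: C_def)
  ultimately have "\<bar>picard u (Suc l) t j - picard u k t j\<bar> \<le> C * ((1 / 2) ^ k - (1 / 2) ^ Suc l)"
    unfolding right_diff_distrib by linarith
  then show ?case
    by (simp only: C_def)
qed simp

lemma ex_picard_limit:
  "\<exists>x. \<forall>t\<ge>0. \<forall>j k. \<bar>picard u k t j - x t j\<bar> \<le> 2 * (M / L) * exp (6 * L * t) * (1 / 2) ^ k"
proof (intro exI[of _ "\<lambda>t j. lim (\<lambda>k. picard u k t j)"] allI impI)
  fix t :: real and j :: int and k :: nat assume t: "0 \<le> t"
  define C where "C = 2 * (M / L) * exp (6 * L * t)"
  have C: "0 \<le> C"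
    using M_nonneg L_pos by (simp add: C_def)
  have bd: "\<bar>picard u l t j - picard u k t j\<bar> \<le> C * (1 / 2) ^ k" if "k \<le> l" for k l
  proof -
    have "\<bar>picard u l t j - picard u k t j\<bar> \<le> C * ((1 / 2) ^ k - (1 / 2) ^ l)"
      using picard_diff[OF t that, of u j] by (simp add: C_def)
    also have "\<dots> \<le> C * (1 / 2) ^ k"
      using C by (intro mult_left_mono) auto
    finally show ?thesis .
  qed
  have z: "(\<lambda>k. C * (1 / 2) ^ k) \<longlonglongrightarrow> 0"
    by (intro tendsto_mult_right_zero LIMSEQ_realpow_zero) auto
  have "Cauchy (\<lambda>k. picard u k t j)"
  proof (rule CauchyI')
    fix e :: real assume "0 < e"
    then obtain N where N: "C * (1 / 2) ^ N < e"
      using order_tendstoD(2)[OF z \<open>0 < e\<close>] by (auto simp: eventually_sequentially)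
    show "\<exists>N. \<forall>m\<ge>N. \<forall>n>m. dist (picard u m t j) (picard u n t j) < e"
    proof (intro exI[of _ N] allI impI)
      fix m n :: nat assume "N \<le> m" "m < n"
      have "\<bar>picard u n t j - picard u m t j\<bar> \<le> C * (1 / 2) ^ m"
        using bd \<open>m < n\<close> by simp
      also have "\<dots> \<le> C * (1 / 2) ^ N"
        using C \<open>N \<le> m\<close> by (intro mult_left_mono power_decreasing) auto
      finally show "dist (picard u m t j) (picard u n t j) < e"
        using N by (simp add: dist_real_def abs_minus_commute)
    qed
  qed
  then have "(\<lambda>k. picard u k t j) \<longlonglongrightarrow> lim (\<lambda>k. picard u k t j)"
    by (simp add: Cauchy_convergent_iff convergent_LIMSEQ_iff)
  then have "(\<lambda>l. \<bar>picard u k t j - picard u l t j\<bar>)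
      \<longlonglongrightarrow> \<bar>picard u k t j - lim (\<lambda>k. picard u k t j)\<bar>"
    by (intro tendsto_intros)
  then show "\<bar>picard u k t j - lim (\<lambda>k. picard u k t j)\<bar> \<le> 2 * (M / L) * exp (6 * L * t) * (1 / 2) ^ k"
    unfolding C_def[symmetric]
    by (rule LIMSEQ_le_const2) (use bd[of k] in \<open>auto simp: abs_minus_commute[of "picard u k t j"] intro!: exI[of _ k]\<close>)
qed

text \<open>The error of the iterates is locally bounded in time, so convergence is uniform on every
  \<open>{0..\<tau>}\<close> and one limit \<open>x\<close> serves all \<open>\<tau>\<close>. It
  inherits continuity and then the integral equation, which is differentiated.\<close>

lemma ex_solution: "\<exists>x. x 0 = u \<and> (\<forall>\<tau>. solves \<tau> x)"
proof -
  define C where "C = 2 * (M / L)"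
  have C: "0 \<le> C"
    using M_nonneg L_pos by (simp add: C_def)
  have z: "(\<lambda>k. B * (1 / 2) ^ k) \<longlonglongrightarrow> 0" for B :: real
    by (intro tendsto_mult_right_zero LIMSEQ_realpow_zero) auto
  obtain x where x: "\<And>t j k. 0 \<le> t \<Longrightarrow> \<bar>picard u k t j - x t j\<bar> \<le> C * exp (6 * L * t) * (1 / 2) ^ k"
    unfolding C_def using ex_picard_limit by blast
  have "uniform_limit {0..\<tau>} (\<lambda>k s. picard u k s j) (\<lambda>s. x s j) sequentially" for \<tau> j
  proof (rule uniform_limitI)
    fix e :: real assume "0 < e"
    show "\<forall>\<^sub>F k in sequentially. \<forall>s\<in>{0..\<tau>}. dist (picard u k s j) (x s j) < e"
      using order_tendstoD(2)[OF z[of "C * exp (6 * L * \<tau>)"] \<open>0 < e\<close>]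
    proof (rule eventually_mono, intro ballI)
      fix k s assume k: "C * exp (6 * L * \<tau>) * (1 / 2) ^ k < e" and s: "s \<in> {0..\<tau>}"
      have "\<bar>picard u k s j - x s j\<bar> \<le> C * exp (6 * L * s) * (1 / 2) ^ k"
        using x s by simp
      also have "\<dots> \<le> C * exp (6 * L * \<tau>) * (1 / 2) ^ k"
        using s C L_pos by (intro mult_right_mono mult_left_mono) auto
      finally show "dist (picard u k s j) (x s j) < e"
        using k by (simp add: dist_real_def)
    qed
  qed
  then have cx: "continuous_on {0..\<tau>} (\<lambda>s. x s j)" for \<tau> j
    by (rule uniform_limit_theorem[rotated]) (auto simp: continuous_picard)
  have eq: "x t j = u j + integral {0..t} (\<lambda>s. G s (x s (j - 1)) (x s j) (x s (j + 1)))"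
    if t: "0 \<le> t" for t j
  proof -
    let ?I = "integral {0..t} (\<lambda>s. G s (x s (j - 1)) (x s j) (x s (j + 1)))"
    \<comment> \<open>Both \<open>x\<close> and the right-hand side of the integral equation are
      compared with iterate \<open>Suc k\<close>; as \<open>k\<close> is arbitrary, their distance
      vanishes.\<close>
    have "\<bar>x t j - (u j + ?I)\<bar> \<le> 2 * C * exp (6 * L * t) * (1 / 2) ^ k" for k
    proof -
      have "\<bar>integral {0..t} (\<lambda>s. G s (picard u k s (j - 1)) (picard u k s j) (picard u k s (j + 1))) - ?I\<bar>
          \<le> (C * (1 / 2) ^ k) / 2 * exp (6 * L * t)"
        using x C t by (intro integral_diff_bound continuous_picard cx) (auto simp: algebra_simps)
      then have "\<bar>picard u (Suc k) t j - (u j + ?I)\<bar> \<le> (C * (1 / 2) ^ k) / 2 * exp (6 * L * t)"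
        by simp
      moreover have "\<bar>picard u (Suc k) t j - x t j\<bar> \<le> C * exp (6 * L * t) * (1 / 2) ^ Suc k"
        by (rule x[OF t])
      ultimately have "\<bar>x t j - (u j + ?I)\<bar> \<le> C * (1 / 2) ^ k * exp (6 * L * t)"
        unfolding abs_le_iff by (simp del: picard.simps add: mult_ac)
      moreover have "0 \<le> C * (1 / 2) ^ k * exp (6 * L * t)"
        using C by simp
      ultimately show ?thesis by (simp add: mult_ac)
    qed
    then have "\<bar>x t j - (u j + ?I)\<bar> \<le> 0"
      by (intro LIMSEQ_le_const[OF z[of "2 * C * exp (6 * L * t)"]]) auto
    then show ?thesis by simp
  qed
  have "solves \<tau> x" for \<tau>
    unfolding solves_def
  proof (intro ballI allI)
    fix t j assume t: "t \<in> {0..\<tau>}"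
    have "((\<lambda>t. integral {0..t} (\<lambda>s. G s (x s (j - 1)) (x s j) (x s (j + 1)))) has_real_derivative
        G t (x t (j - 1)) (x t j) (x t (j + 1))) (at t within {0..\<tau>})"
      by (intro integral_has_real_derivative continuous_G_comp cx t)
    then have "((\<lambda>t. u j + integral {0..t} (\<lambda>s. G s (x s (j - 1)) (x s j) (x s (j + 1)))) has_real_derivative
        G t (x t (j - 1)) (x t j) (x t (j + 1))) (at t within {0..\<tau>})"
      by (auto intro!: derivative_eq_intros)
    then show "((\<lambda>s. x s j) has_real_derivative G t (x t (j - 1)) (x t j) (x t (j + 1)))
        (at t within {0..\<tau>})"
      by (rule has_field_derivative_transform_within[OF _ zero_less_one t]) (use eq in auto)
  qed
  moreover have "x 0 = u"
    using eq[of 0] by auto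
  ultimately show ?thesis by blast
qed

end

section \<open>The flow of the twist chain\<close>

lemma C1_plane_partials:
  assumes "C1_plane W"
  shows "((\<lambda>x. W x v) has_real_derivative partial1 W u v) (at u)"
    and "((\<lambda>y. W u y) has_real_derivative partial2 W u v) (at v)"
  using assms unfolding C1_plane_def partial1_def partial2_def
  by (simp_all add: DERIV_deriv_iff_field_differentiable)

lemma partial_periodic:
  assumes "\<And>u v. W (u + 1) (v + 1) = W u v"
  shows "partial1 W (u + 1) (v + 1) = partial1 W u v" "partial2 W (u + 1) (v + 1) = partial2 W u v"
  using assms by (simp_all add: partial1_def partial2_def deriv_def DERIV_shift)

text \<open>Stated in two variables so that one induction serves several purposes: besides
  \<open>V\<close> and its derivatives, \<open>W\<close> is later instantiated with
  \<open>h u - v\<close>, with the indicator of a periodic set and with \<open>F u\<close>.\<close>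

lemma periodic_of_int:
  fixes W :: "real \<Rightarrow> real \<Rightarrow> real"
  assumes "\<And>u v. W (u + 1) (v + 1) = W u v"
  shows "W (u + of_int k) (v + of_int k) = W u v"
proof -
  have nat: "W (u + of_nat m) (v + of_nat m) = W u v" for m u v
  proof (induction m)
    case (Suc m)
    then show ?case
      using assms[of "u + of_nat m" "v + of_nat m"] by (simp add: add_ac)
  qed simp
  show ?thesis
  proof (cases k)
    case (nonneg m)
    then show ?thesis using nat by simp
  next
    case (neg m)
    then have "of_int k = - (of_nat (Suc m) :: real)"
      by simp
    then show ?thesis
      using nat[of "u - of_nat (Suc m)" "Suc m" "v - of_nat (Suc m)"] by (simp only: diff_add_cancel diff_conv_add_uminus[symmetric])
  qed
qed

lemma strip_bounded:
  fixes Q :: "real \<Rightarrow> real \<Rightarrow> real"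
  assumes cont: "continuous_on UNIV (\<lambda>(u, v). Q u v)"
    and per: "\<And>u v. Q (u + 1) (v + 1) = Q u v"
  shows "\<exists>B. \<forall>u v. \<bar>u - v\<bar> \<le> n \<longrightarrow> \<bar>Q u v\<bar> \<le> B"
proof -
  let ?K = "{0..1::real} \<times> {- n..n + 1}"
  have "compact ((\<lambda>(u, v). Q u v) ` ?K)"
    by (intro compact_continuous_image continuous_on_subset[OF cont] compact_Times) auto
  then obtain B where B: "\<forall>q\<in>(\<lambda>(u, v). Q u v) ` ?K. norm q \<le> B"
    using compact_imp_bounded bounded_iff by blast
  have "\<bar>Q u v\<bar> \<le> B" if "\<bar>u - v\<bar> \<le> n" for u v
  proof -
    define k where "k = \<lfloor>u\<rfloor>"
    have u: "0 \<le> u - of_int k" "u - of_int k \<le> 1"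
      unfolding k_def by linarith+
    have "Q u v = Q (u - of_int k) (v - of_int k)"
      using periodic_of_int[of Q "u - of_int k" k "v - of_int k", OF per] by simp
    moreover have "(u - of_int k, v - of_int k) \<in> ?K"
      using that u by auto
    ultimately show ?thesis
      using B by (metis (mono_tags, lifting) image_eqI real_norm_def split_conv)
  qed
  then show ?thesis by blast
qed

text \<open>Changing one variable at a time may leave the strip, so the derivatives are bounded on
  the wider strip of width \<open>n + 2\<close>. This handles points at distance at most 1; for
  distant points the bound \<open>2 * M\<close> on the difference of values already suffices, whence
  the constant \<open>B + 2 * M\<close>.\<close>

lemma strip_lipschitz:
  fixes W :: "real \<Rightarrow> real \<Rightarrow> real"
  assumes C1: "C1_plane W" and per: "\<And>u v. W (u + 1) (v + 1) = W u v" and "0 \<le> n"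
  obtains L M where "0 < L"
    "\<And>u v. \<bar>u - v\<bar> \<le> n \<Longrightarrow> \<bar>W u v\<bar> \<le> M"
    "\<And>u v u' v'. \<bar>u - v\<bar> \<le> n \<Longrightarrow> \<bar>u' - v'\<bar> \<le> n \<Longrightarrow> \<bar>W u v - W u' v'\<bar> \<le> L * (\<bar>u - u'\<bar> + \<bar>v - v'\<bar>)"
proof -
  have "\<exists>B. \<forall>u v. \<bar>u - v\<bar> \<le> n + 2 \<longrightarrow> \<bar>partial1 W u v\<bar> \<le> B"
    "\<exists>B. \<forall>u v. \<bar>u - v\<bar> \<le> n + 2 \<longrightarrow> \<bar>partial2 W u v\<bar> \<le> B"
    using C1 unfolding C1_plane_def by (auto intro!: strip_bounded partial_periodic per)
  then obtain B1 B2 where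
    B1: "\<And>u v. \<bar>u - v\<bar> \<le> n + 2 \<Longrightarrow> \<bar>partial1 W u v\<bar> \<le> B1" and
    B2: "\<And>u v. \<bar>u - v\<bar> \<le> n + 2 \<Longrightarrow> \<bar>partial2 W u v\<bar> \<le> B2"
    by blast
  define B where "B = max 1 (max B1 B2)"
  have "0 < B"
    by (simp add: B_def)
  have step1: "\<bar>W u v - W u' v\<bar> \<le> B * \<bar>u - u'\<bar>" if "\<bar>u - v\<bar> \<le> n + 2" "\<bar>u' - v\<bar> \<le> n + 2" for u u' v
  proof -
    have "norm (W u v - W u' v) \<le> B * norm (u - u')"
    proof (rule field_differentiable_bound[of "{v - (n + 2)..v + (n + 2)}" "\<lambda>x. W x v"])
      fix x assume "x \<in> {v - (n + 2)..v + (n + 2)}"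
      then have "\<bar>x - v\<bar> \<le> n + 2"
        by auto
      then show "norm (partial1 W x v) \<le> B"
        using B1[of x v] by (auto simp: B_def)
      show "((\<lambda>x. W x v) has_real_derivative partial1 W x v) (at x within {v - (n + 2)..v + (n + 2)})"
        by (rule has_field_derivative_at_within) (rule C1_plane_partials[OF C1])
    qed (use that in auto)
    then show ?thesis by simp
  qed
  have step2: "\<bar>W u v - W u v'\<bar> \<le> B * \<bar>v - v'\<bar>" if "\<bar>u - v\<bar> \<le> n + 2" "\<bar>u - v'\<bar> \<le> n + 2" for u v v'
  proof -
    have "norm (W u v - W u v') \<le> B * norm (v - v')"
    proof (rule field_differentiable_bound[of "{u - (n + 2)..u + (n + 2)}" "\<lambda>y. W u y"])
      fix y assume "y \<in> {u - (n + 2)..u + (n + 2)}"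
      then have "\<bar>u - y\<bar> \<le> n + 2"
        by auto
      then show "norm (partial2 W u y) \<le> B"
        using B2[of u y] by (auto simp: B_def)
      show "((\<lambda>y. W u y) has_real_derivative partial2 W u y) (at y within {u - (n + 2)..u + (n + 2)})"
        by (rule has_field_derivative_at_within) (rule C1_plane_partials[OF C1])
    qed (use that in auto)
    then show ?thesis by simp
  qed
  \<comment> \<open>After reduction of \<open>u\<close> modulo 1, go from the origin along the first
    axis by at most 1 and then vertically by at most \<open>n + 1\<close>.\<close>
  define M where "M = \<bar>W 0 0\<bar> + B * (n + 1) + B"
  have M: "\<bar>W u v\<bar> \<le> M" if "\<bar>u - v\<bar> \<le> n" for u v
  proof -
    define k where "k = \<lfloor>u\<rfloor>"
    define u' v' where "u' = u - of_int k" and "v' = v - of_int k"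
    have u': "0 \<le> u'" "u' \<le> 1"
      unfolding u'_def k_def by linarith+
    have uv': "\<bar>u' - v'\<bar> \<le> n"
      using that by (simp add: u'_def v'_def)
    have "W u v = W u' v'"
      unfolding u'_def v'_def
      using periodic_of_int[of W "u - of_int k" k "v - of_int k", OF per] by simp
    moreover have "\<bar>W u' v' - W u' 0\<bar> \<le> B * \<bar>v' - 0\<bar>"
      by (rule step2) (use uv' u' \<open>0 \<le> n\<close> in auto)
    moreover have "B * \<bar>v' - 0\<bar> \<le> B * (n + 1)"
      using \<open>0 < B\<close> uv' u' by (intro mult_left_mono) auto
    moreover have "\<bar>W u' 0 - W 0 0\<bar> \<le> B * \<bar>u' - 0\<bar>"
      by (rule step1) (use u' \<open>0 \<le> n\<close> in auto)
    moreover have "B * \<bar>u' - 0\<bar> \<le> B * 1"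
      using \<open>0 < B\<close> u' by (intro mult_left_mono) auto
    ultimately show ?thesis
      unfolding M_def by simp
  qed
  have "0 \<le> M"
    using M[of 0 0] \<open>0 \<le> n\<close> by simp
  show thesis
  proof (rule that[of "B + 2 * M" M])
    show "0 < B + 2 * M"
      using \<open>0 < B\<close> \<open>0 \<le> M\<close> by simp
    fix u v u' v' :: real assume uv: "\<bar>u - v\<bar> \<le> n" "\<bar>u' - v'\<bar> \<le> n"
    define r where "r = \<bar>u - u'\<bar> + \<bar>v - v'\<bar>"
    show "\<bar>W u v - W u' v'\<bar> \<le> (B + 2 * M) * (\<bar>u - u'\<bar> + \<bar>v - v'\<bar>)"
    proof (cases "r \<le> 1")
      case True
      have "\<bar>W u v - W u' v\<bar> \<le> B * \<bar>u - u'\<bar>"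
        by (rule step1) (use uv True in \<open>auto simp: r_def\<close>)
      moreover have "\<bar>W u' v - W u' v'\<bar> \<le> B * \<bar>v - v'\<bar>"
        by (rule step2) (use uv True in \<open>auto simp: r_def\<close>)
      moreover have "0 \<le> 2 * M * r"
        using \<open>0 \<le> M\<close> by (simp add: r_def)
      ultimately show ?thesis
        unfolding r_def distrib_left distrib_right by linarith
    next
      case False
      have "\<bar>W u v - W u' v'\<bar> \<le> 2 * M * 1"
        using M[OF uv(1)] M[OF uv(2)] by linarith
      also have "\<dots> \<le> 2 * M * r"
        using False \<open>0 \<le> M\<close> by (intro mult_left_mono) auto
      also have "\<dots> \<le> (B + 2 * M) * r"
        using \<open>0 < B\<close> False by (intro mult_right_mono) auto
      finally show ?thesis
        by (simp add: r_def)
    qed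
  qed (use M in auto)
qed

definition clip :: "real \<Rightarrow> real \<Rightarrow> real" where
  "clip n d = max (- n) (min n d)"

lemma clip_bounded: "0 \<le> n \<Longrightarrow> \<bar>clip n d\<bar> \<le> n"
  and clip_lipschitz: "\<bar>clip n d - clip n d'\<bar> \<le> \<bar>d - d'\<bar>"
  and clip_mono: "d \<le> d' \<Longrightarrow> clip n d \<le> clip n d'"
  and clip_eq: "\<bar>d\<bar> \<le> n \<Longrightarrow> clip n d = d"
  by (auto simp: clip_def max_def min_def)

text \<open>No symmetry of the mixed derivatives is used: \<open>V\<^sub>1\<close> is nonincreasing in \<open>v\<close>, so
  \<open>V u' v - V u v\<close> is nonincreasing in \<open>v\<close> for \<open>u \<le> u'\<close>, and its derivative in \<open>v\<close> is
  \<open>V\<^sub>2 u' v - V\<^sub>2 u v\<close>.\<close>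

lemma partial2_antimono:
  assumes C1: "C1_plane V" and anti: "\<And>u v v'. v \<le> v' \<Longrightarrow> partial1 V u v' \<le> partial1 V u v"
    and "u \<le> u'"
  shows "partial2 V u' v \<le> partial2 V u v"
proof (rule ccontr)
  assume "\<not> partial2 V u' v \<le> partial2 V u v"
  then have pos: "0 < partial2 V u' v - partial2 V u v"
    by simp
  have "((\<lambda>y. V u' y - V u y) has_real_derivative partial2 V u' v - partial2 V u v) (at v)"
    by (intro derivative_intros C1_plane_partials C1)
  from DERIV_pos_inc_right[OF this pos] obtain d where d: "0 < d"
    "\<And>h. 0 < h \<Longrightarrow> h < d \<Longrightarrow> V u' v - V u v < V u' (v + h) - V u (v + h)"
    by blast
  define w where "w = v + d / 2"
  have less: "V u' v - V u v < V u' w - V u w"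
    using d by (simp add: w_def)
  have "V u' w - V u' v \<le> V u w - V u v"
  proof (rule DERIV_nonpos_imp_nonincreasing[where f = "\<lambda>x. V x w - V x v", OF \<open>u \<le> u'\<close>])
    fix x
    have "((\<lambda>x. V x w - V x v) has_real_derivative partial1 V x w - partial1 V x v) (at x)"
      by (intro derivative_intros C1_plane_partials C1)
    moreover have "partial1 V x w - partial1 V x v \<le> 0"
      using anti[of v w x] d by (simp add: w_def)
    ultimately show "\<exists>y. ((\<lambda>x. V x w - V x v) has_real_derivative y) (at x) \<and> y \<le> 0"
      by blast
  qed
  then show False
    using less by simp
qed

section \<open>Configurations with bounded differences and their translations\<close>

lemma K_conf_mono: "m \<le> n \<Longrightarrow> K_conf m \<subseteq> K_conf n"
  unfolding K_conf_def by (auto intro: order_trans)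

lemma K_confD: "u \<in> K_conf n \<Longrightarrow> \<bar>u (i + 1) - u i\<bar> \<le> real n"
  by (simp add: K_conf_def)

lemma K_conf_growth:
  assumes "u \<in> K_conf n"
  shows "\<bar>u i - u j\<bar> \<le> real n * of_int \<bar>i - j\<bar>"
proof -
  have nat: "\<bar>u (j + int k) - u j\<bar> \<le> real n * real k" for j k
  proof (induction k)
    case (Suc k)
    then show ?case
      using K_confD[OF assms, of "j + int k"] by (simp add: algebra_simps)
  qed simp
  show ?thesis
  proof (cases "j \<le> i")
    case True
    then show ?thesis
      using nat[of j "nat (i - j)"] by simp
  next
    case False
    then show ?thesis
      using nat[of i "nat (j - i)"] by (simp add: abs_minus_commute)
  qed
qed

lemma X_confE:
  assumes "u \<in> X_conf" obtains n where "u \<in> K_conf n"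
  using assms by (auto simp: X_conf_def)

lemma K_conf_subset_X_conf: "K_conf n \<subseteq> X_conf"
proof -
  have "K_conf n \<subseteq> K_conf (max 1 n)"
    by (rule K_conf_mono) simp
  also have "\<dots> \<subseteq> X_conf"
    unfolding X_conf_def by (rule UN_upper) simp
  finally show ?thesis .
qed

lemma T_trans_K_conf: "u \<in> K_conf n \<Longrightarrow> T_trans p q u \<in> K_conf n"
proof -
  assume u: "u \<in> K_conf n"
  have "\<bar>u (i + 1 + p) - u (i + p)\<bar> \<le> real n" for i
    using K_confD[OF u, of "i + p"] by (simp add: add_ac)
  then show ?thesis
    by (simp add: K_conf_def T_trans_def)
qed

lemma T_trans_X_conf: "u \<in> X_conf \<Longrightarrow> T_trans p q u \<in> X_conf"
  using T_trans_K_conf unfolding X_conf_def by blast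

lemma T_trans_T_trans: "T_trans p q (T_trans p' q' u) = T_trans (p + p') (q + q') u"
  by (simp add: T_trans_def add_ac)

lemma T_trans_0 [simp]: "T_trans 0 0 u = u"
  by (simp add: T_trans_def)

lemma T_shift_eq_T_trans: "T_shift = T_trans (- 1) 0"
  by (simp add: T_shift_def T_trans_def fun_eq_iff)

section \<open>Truncation, uniqueness and order preservation of the flow\<close>

locale twist_chain =
  fixes V :: "real \<Rightarrow> real \<Rightarrow> real" and F :: "real \<Rightarrow> real"
  assumes smooth: "C2_plane V"
    and periodic: "V (u + 1) (v + 1) = V u v"
    and twist: "partial2 (partial1 V) u v \<le> 0"
    and F_cont: "continuous_on UNIV F"
    and F_bounded: "bounded (range F)"
begin

lemma C1: "C1_plane V" "C1_plane (partial1 V)" "C1_plane (partial2 V)"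
  using smooth by (auto simp: C2_plane_def)

lemma partial1_antimono: "v \<le> v' \<Longrightarrow> partial1 V u v' \<le> partial1 V u v"
  by (rule DERIV_nonpos_imp_nonincreasing[where f = "partial1 V u"])
     (use C1_plane_partials(2)[OF C1(2)] twist in blast)+

text \<open>Clipping the differences makes the field globally bounded and Lipschitz without destroying
  monotonicity, and changes nothing on \<open>K_conf n\<close>.\<close>

definition trunc_field :: "nat \<Rightarrow> real \<Rightarrow> real \<Rightarrow> real \<Rightarrow> real \<Rightarrow> real" where
  "trunc_field n t a b c =
     - partial2 V (b - clip n (b - a)) b - partial1 V b (b + clip n (c - b)) + F t"

lemma trunc_field_eq:
  "\<bar>b - a\<bar> \<le> real n \<Longrightarrow> \<bar>c - b\<bar> \<le> real n \<Longrightarrow>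
     trunc_field n t a b c = - partial2 V a b - partial1 V b c + F t"
  by (simp add: trunc_field_def clip_eq)

lemma trunc_field_periodic:
  "trunc_field n t (a + of_int k) (b + of_int k) (c + of_int k) = trunc_field n t a b c"
  using periodic_of_int[of "partial2 V" "b - clip n (b - a)" k b] partial_periodic(2)[of V, OF periodic]
    periodic_of_int[of "partial1 V" b k "b + clip n (c - b)"] partial_periodic(1)[of V, OF periodic]
  by (simp add: trunc_field_def algebra_simps)

lemma cooperative_trunc_field: "\<exists>L M. cooperative_lattice (trunc_field n) L M"
proof -
  obtain L1 M1 where 1: "0 < L1" "\<And>u v. \<bar>u - v\<bar> \<le> real n \<Longrightarrow> \<bar>partial1 V u v\<bar> \<le> M1"
    "\<And>u v u' v'. \<bar>u - v\<bar> \<le> real n \<Longrightarrow> \<bar>u' - v'\<bar> \<le> real n \<Longrightarrow>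
       \<bar>partial1 V u v - partial1 V u' v'\<bar> \<le> L1 * (\<bar>u - u'\<bar> + \<bar>v - v'\<bar>)"
    by (rule strip_lipschitz[OF C1(2) partial_periodic(1)[of V, OF periodic], of "real n"]) (simp, rule that)
  obtain L2 M2 where 2: "0 < L2" "\<And>u v. \<bar>u - v\<bar> \<le> real n \<Longrightarrow> \<bar>partial2 V u v\<bar> \<le> M2"
    "\<And>u v u' v'. \<bar>u - v\<bar> \<le> real n \<Longrightarrow> \<bar>u' - v'\<bar> \<le> real n \<Longrightarrow>
       \<bar>partial2 V u v - partial2 V u' v'\<bar> \<le> L2 * (\<bar>u - u'\<bar> + \<bar>v - v'\<bar>)"
    by (rule strip_lipschitz[OF C1(3) partial_periodic(2)[of V, OF periodic], of "real n"]) (simp, rule that)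
  obtain MF where MF: "\<And>t. \<bar>F t\<bar> \<le> MF"
    using F_bounded by (auto simp: bounded_iff)
  have clip_n: "\<bar>clip (real n) d\<bar> \<le> real n" for d
    by (rule clip_bounded) simp
  have "cooperative_lattice (trunc_field n) (3 * (L1 + L2)) (M1 + M2 + MF)"
  proof
    show "0 < 3 * (L1 + L2)"
      using 1 2 by simp
    fix t a b c
    have "\<bar>partial1 V b (b + clip n (c - b))\<bar> \<le> M1" "\<bar>partial2 V (b - clip n (b - a)) b\<bar> \<le> M2"
      using clip_n by (auto intro!: 1(2) 2(2))
    then show "\<bar>trunc_field n t a b c\<bar> \<le> M1 + M2 + MF"
      using MF[of t] unfolding trunc_field_def by linarith
    show "continuous_on UNIV (\<lambda>t. trunc_field n t a b c)"
      unfolding trunc_field_def by (intro continuous_intros F_cont)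
    fix a' b' c'
    have "\<bar>partial1 V b (b + clip n (c - b)) - partial1 V b' (b' + clip n (c' - b'))\<bar>
        \<le> L1 * (\<bar>b - b'\<bar> + \<bar>b + clip n (c - b) - (b' + clip n (c' - b'))\<bar>)"
      using clip_n by (intro 1(3)) auto
    \<comment> \<open>The clipped difference depends on \<open>b\<close> too, so the second argument
      moves by up to twice the change of \<open>b\<close> plus the change of \<open>c\<close>; the
      first argument adds one more change of \<open>b\<close>, hence the factor 3.\<close>
    also have "\<dots> \<le> L1 * (3 * (\<bar>a - a'\<bar> + \<bar>b - b'\<bar> + \<bar>c - c'\<bar>))"
    proof (rule mult_left_mono)
      show "\<bar>b - b'\<bar> + \<bar>b + clip n (c - b) - (b' + clip n (c' - b'))\<bar>
          \<le> 3 * (\<bar>a - a'\<bar> + \<bar>b - b'\<bar> + \<bar>c - c'\<bar>)"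
        using clip_lipschitz[of n "c - b" "c' - b'"] by (smt (verit))
    qed (use 1(1) in simp)
    finally have p1: "\<bar>partial1 V b (b + clip n (c - b)) - partial1 V b' (b' + clip n (c' - b'))\<bar>
        \<le> L1 * (3 * (\<bar>a - a'\<bar> + \<bar>b - b'\<bar> + \<bar>c - c'\<bar>))" .
    have "\<bar>partial2 V (b - clip n (b - a)) b - partial2 V (b' - clip n (b' - a')) b'\<bar>
        \<le> L2 * (\<bar>b - clip n (b - a) - (b' - clip n (b' - a'))\<bar> + \<bar>b - b'\<bar>)"
      using clip_n by (intro 2(3)) auto
    also have "\<dots> \<le> L2 * (3 * (\<bar>a - a'\<bar> + \<bar>b - b'\<bar> + \<bar>c - c'\<bar>))"
    proof (rule mult_left_mono)
      show "\<bar>b - clip n (b - a) - (b' - clip n (b' - a'))\<bar> + \<bar>b - b'\<bar>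
          \<le> 3 * (\<bar>a - a'\<bar> + \<bar>b - b'\<bar> + \<bar>c - c'\<bar>)"
        using clip_lipschitz[of n "b - a" "b' - a'"] by (smt (verit))
    qed (use 2(1) in simp)
    finally have "\<bar>trunc_field n t a b c - trunc_field n t a' b' c'\<bar>
        \<le> L1 * (3 * (\<bar>a - a'\<bar> + \<bar>b - b'\<bar> + \<bar>c - c'\<bar>))
          + L2 * (3 * (\<bar>a - a'\<bar> + \<bar>b - b'\<bar> + \<bar>c - c'\<bar>))"
      using p1 unfolding trunc_field_def by linarith
    also have "\<dots> = 3 * (L1 + L2) * (\<bar>a - a'\<bar> + \<bar>b - b'\<bar> + \<bar>c - c'\<bar>)"
      by (simp only: distrib_right distrib_left mult_ac)
    finally show "\<bar>trunc_field n t a b c - trunc_field n t a' b' c'\<bar>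
        \<le> 3 * (L1 + L2) * (\<bar>a - a'\<bar> + \<bar>b - b'\<bar> + \<bar>c - c'\<bar>)" .
  next
    fix a a' b c c' t :: real assume "a \<le> a'" "c \<le> c'"
    \<comment> \<open>Raising \<open>a\<close> raises the first argument of
      \<open>V\<^sub>2\<close>, and raising \<open>c\<close> raises the second argument of
      \<open>V\<^sub>1\<close>. Both derivatives are nonincreasing in these arguments and enter the
      field with a minus sign.\<close>
    then have "clip n (b - a') \<le> clip n (b - a)" "clip n (c - b) \<le> clip n (c' - b)"
      by (auto intro: clip_mono)
    then have "partial2 V (b - clip n (b - a')) b \<le> partial2 V (b - clip n (b - a)) b"
      "partial1 V b (b + clip n (c' - b)) \<le> partial1 V b (b + clip n (c - b))"
      by (auto intro!: partial2_antimono[OF C1(1) partial1_antimono] partial1_antimono)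
    then show "trunc_field n t a b c \<le> trunc_field n t a' b c'"
      by (simp add: trunc_field_def)
  qed
  then show ?thesis by blast
qed

abbreviation tr_solves :: "nat \<Rightarrow> real \<Rightarrow> (real \<Rightarrow> config) \<Rightarrow> bool" where
  "tr_solves n \<equiv> cooperative_lattice.solves (trunc_field n)"

lemma solves_iff:
  "tr_solves n \<tau> x \<longleftrightarrow> (\<forall>t\<in>{0..\<tau>}. \<forall>j. ((\<lambda>s. x s j) has_real_derivative
     trunc_field n t (x t (j - 1)) (x t j) (x t (j + 1))) (at t within {0..\<tau>}))"
proof -
  obtain L M where "cooperative_lattice (trunc_field n) L M"
    using cooperative_trunc_field by blast
  then show ?thesis
    by (rule cooperative_lattice.solves_def)
qed

text \<open>Repackages \<open>comparison\<close> with a rate \<open>K\<close> that depends on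
  \<open>n\<close> alone, so that later arguments need not mention the constants of the truncated
  field.\<close>

lemma solves_comparison:
  "\<exists>K. \<forall>\<tau> x y \<epsilon>. tr_solves n \<tau> x \<longrightarrow> tr_solves n \<tau> y \<longrightarrow> 0 \<le> \<epsilon> \<longrightarrow>
     (\<forall>j. x 0 j - y 0 j \<le> \<epsilon> * weight j) \<longrightarrow>
     (\<forall>t\<in>{0..\<tau>}. \<forall>j. x t j - y t j \<le> \<epsilon> * exp (K * t) * weight j)"
proof -
  obtain L M where "cooperative_lattice (trunc_field n) L M"
    using cooperative_trunc_field by blast
  then interpret cooperative_lattice "trunc_field n" L M .
  show ?thesis
  proof (intro exI[of _ "10 * L"] allI impI ballI)
    fix \<tau> x y \<epsilon> t j
    assume "solves \<tau> x" "solves \<tau> y" "0 \<le> \<epsilon>" "\<forall>j. x 0 j - y 0 j \<le> \<epsilon> * weight j" "t \<in> {0..\<tau>}"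
    then show "x t j - y t j \<le> \<epsilon> * exp (10 * L * t) * weight j"
      by (intro comparison) auto
  qed
qed

lemma solves_order:
  assumes "tr_solves n \<tau> x" "tr_solves n \<tau> y" "x 0 \<le> y 0" "t \<in> {0..\<tau>}"
  shows "x t \<le> y t"
proof -
  obtain K where K: "\<And>\<tau> x y \<epsilon> t j. tr_solves n \<tau> x \<Longrightarrow> tr_solves n \<tau> y \<Longrightarrow> 0 \<le> \<epsilon> \<Longrightarrow>
     (\<And>j. x 0 j - y 0 j \<le> \<epsilon> * weight j) \<Longrightarrow> t \<in> {0..\<tau>} \<Longrightarrow> x t j - y t j \<le> \<epsilon> * exp (K * t) * weight j"
    using solves_comparison[of n] by metis
  have "x t j \<le> y t j" for j
    using K[OF assms(1,2) order_refl _ assms(4), of j] assms(3) by (simp add: le_fun_def)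
  then show ?thesis
    by (simp add: le_fun_def)
qed

lemma solves_T_trans:
  assumes "tr_solves n \<tau> x" shows "tr_solves n \<tau> (\<lambda>t. T_trans p q (x t))"
  unfolding solves_iff
proof (intro ballI allI)
  fix t j assume "t \<in> {0..\<tau>}"
  then have "((\<lambda>s. x s (j + p)) has_real_derivative
      trunc_field n t (x t (j + p - 1)) (x t (j + p)) (x t (j + p + 1))) (at t within {0..\<tau>})"
    using assms by (simp add: solves_iff)
  then have "((\<lambda>s. x s (j + p) + of_int q) has_real_derivative
      trunc_field n t (x t (j + p - 1)) (x t (j + p)) (x t (j + p + 1))) (at t within {0..\<tau>})"
    by (auto intro!: derivative_eq_intros)
  moreover have "j - 1 + p = j + p - 1" "j + 1 + p = j + p + 1"
    by simp_all
  ultimately show "((\<lambda>s. T_trans p q (x s) j) has_real_derivative trunc_field n t (T_trans p q (x t) (j - 1))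
      (T_trans p q (x t) j) (T_trans p q (x t) (j + 1))) (at t within {0..\<tau>})"
    unfolding T_trans_def by (simp only: trunc_field_periodic)
qed

text \<open>Membership in \<open>K_conf n\<close> is an order relation, namely that \<open>x\<close>
  lies between its translates \<open>T_trans 1 (- int n) x\<close> and
  \<open>T_trans 1 (int n) x\<close>. Translates of solutions are solutions, so order preservation
  propagates it.\<close>

lemma solves_K_conf:
  assumes x: "tr_solves n \<tau> x" and "x 0 \<in> K_conf n" "t \<in> {0..\<tau>}"
  shows "x t \<in> K_conf n"
proof -
  have b: "\<bar>x 0 (i + 1) - x 0 i\<bar> \<le> real n" for i
    using K_confD[OF assms(2)] .
  have "T_trans 1 (- int n) (x t) \<le> x t"
    by (rule solves_order[OF solves_T_trans[OF x] x _ assms(3)])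
       (use b in \<open>auto simp: le_fun_def T_trans_def abs_le_iff algebra_simps\<close>)
  moreover have "x t \<le> T_trans 1 (int n) (x t)"
    by (rule solves_order[OF x solves_T_trans[OF x] _ assms(3)])
       (use b in \<open>auto simp: le_fun_def T_trans_def abs_le_iff algebra_simps\<close>)
  ultimately show ?thesis
    by (auto simp: K_conf_def le_fun_def T_trans_def abs_le_iff algebra_simps)
qed

lemma is_solution_solves:
  assumes "is_solution V F u x" "\<And>t. t \<in> {0..\<tau>} \<Longrightarrow> x t \<in> K_conf n"
  shows "tr_solves n \<tau> x"
  unfolding solves_iff
proof (intro ballI allI)
  fix t j assume t: "t \<in> {0..\<tau>}"
  then have "((\<lambda>s. x s j) has_real_derivative
      - partial2 V (x t (j - 1)) (x t j) - partial1 V (x t j) (x t (j + 1)) + F t) (at t within {0..})"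
    using assms(1) by (simp add: is_solution_def)
  then have "((\<lambda>s. x s j) has_real_derivative
      - partial2 V (x t (j - 1)) (x t j) - partial1 V (x t j) (x t (j + 1)) + F t) (at t within {0..\<tau>})"
    by (rule DERIV_subset) auto
  then show "((\<lambda>s. x s j) has_real_derivative trunc_field n t (x t (j - 1)) (x t j) (x t (j + 1)))
      (at t within {0..\<tau>})"
    using K_confD[OF assms(2)[OF t], of j] K_confD[OF assms(2)[OF t], of "j - 1"]
    by (simp add: trunc_field_eq)
qed

text \<open>A truncated solution starting in \<open>K_conf n\<close> never leaves it, and there the
  truncation is invisible, so it solves the original system.\<close>

lemma ex_is_solution:
  assumes u: "u \<in> K_conf n"
  shows "\<exists>x. is_solution V F u x \<and> (\<forall>t\<ge>0. x t \<in> K_conf n)"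
proof -
  obtain L M where "cooperative_lattice (trunc_field n) L M"
    using cooperative_trunc_field by blast
  then obtain x where x: "x 0 = u" "\<And>\<tau>. tr_solves n \<tau> x"
    using cooperative_lattice.ex_solution by blast
  have K: "x t \<in> K_conf n" if "0 \<le> t" for t
    using solves_K_conf[OF x(2)[of t]] x(1) u that by simp
  have "((\<lambda>s. x s j) has_real_derivative
      - partial2 V (x t (j - 1)) (x t j) - partial1 V (x t j) (x t (j + 1)) + F t) (at t within {0..})"
    if t: "0 \<le> t" for t j
  proof -
    have "((\<lambda>s. x s j) has_real_derivative trunc_field n t (x t (j - 1)) (x t j) (x t (j + 1)))
        (at t within {0..t + 1})"
      using x(2)[of "t + 1"] t by (simp add: solves_iff)
    also have "at t within {0..t + 1} = at t within {0..}"
      by (rule at_within_nhd[of t "{..<t + 1}"]) auto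
    finally show ?thesis
      using K_confD[OF K[OF t], of j] K_confD[OF K[OF t], of "j - 1"] by (simp add: trunc_field_eq)
  qed
  then have "is_solution V F u x"
    using K x(1) by (auto simp: is_solution_def intro!: exI[of _ n])
  then show ?thesis
    using K by blast
qed

text \<open>On a compact time interval each solution has its own width; with the larger one both
  solve the same truncated system and become comparable.\<close>

lemma is_solution_common_K:
  assumes "is_solution V F u x" "is_solution V F v y" "0 \<le> \<tau>"
  obtains n where "tr_solves n \<tau> x" "tr_solves n \<tau> y"
proof -
  obtain a b where ab: "\<And>t. t \<in> {0..\<tau>} \<Longrightarrow> x t \<in> K_conf a" "\<And>t. t \<in> {0..\<tau>} \<Longrightarrow> y t \<in> K_conf b"
    using assms unfolding is_solution_def by metis
  have "tr_solves (max a b) \<tau> x" "tr_solves (max a b) \<tau> y"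
    using ab K_conf_mono[of a "max a b"] K_conf_mono[of b "max a b"]
    by (auto intro!: is_solution_solves[OF assms(1)] is_solution_solves[OF assms(2)])
  then show thesis
    by (rule that)
qed

lemma is_solution_order:
  assumes "is_solution V F u x" "is_solution V F v y" "u \<le> v" "0 \<le> t"
  shows "x t \<le> y t"
proof -
  obtain n where "tr_solves n t x" "tr_solves n t y"
    using is_solution_common_K[OF assms(1,2,4)] .
  then show ?thesis
    by (rule solves_order) (use assms in \<open>auto simp: is_solution_def\<close>)
qed

text \<open>Uniqueness, and with it the meaning of the definite description in \<open>flow\<close>,
  is order preservation applied in both directions.\<close>

lemma flow_eq:
  assumes "is_solution V F u x" "0 \<le> t"
  shows "flow V F t u = x t"
  unfolding flow_def
proof (rule the_equality)
  show "\<exists>y. is_solution V F u y \<and> x t = y t"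
    using assms by blast
  fix w assume "\<exists>y. is_solution V F u y \<and> w = y t"
  then show "w = x t"
    using is_solution_order[OF _ assms(1) order_refl assms(2)]
      is_solution_order[OF assms(1) _ order_refl assms(2)] by (metis order_antisym)
qed

lemma flow_K_conf: "u \<in> K_conf n \<Longrightarrow> 0 \<le> t \<Longrightarrow> flow V F t u \<in> K_conf n"
  using ex_is_solution flow_eq by metis

lemma flow_X_conf: "u \<in> X_conf \<Longrightarrow> 0 \<le> t \<Longrightarrow> flow V F t u \<in> X_conf"
  using flow_K_conf unfolding X_conf_def by blast

lemma ex_is_solution_X: "u \<in> X_conf \<Longrightarrow> \<exists>x. is_solution V F u x"
  using ex_is_solution X_confE by metis

lemma flow_mono:
  assumes "u \<in> X_conf" "v \<in> X_conf" "u \<le> v" "0 \<le> t"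
  shows "flow V F t u \<le> flow V F t v"
  using assms ex_is_solution_X flow_eq is_solution_order by metis

lemma flow_T_trans:
  assumes "u \<in> X_conf" "0 \<le> t"
  shows "flow V F t (T_trans p q u) = T_trans p q (flow V F t u)"
proof -
  obtain n where u: "u \<in> K_conf n"
    using X_confE[OF assms(1)] .
  obtain x where x: "is_solution V F u x" "\<And>t. 0 \<le> t \<Longrightarrow> x t \<in> K_conf n"
    using ex_is_solution[OF u] by blast
  obtain y where y: "is_solution V F (T_trans p q u) y" "\<And>t. 0 \<le> t \<Longrightarrow> y t \<in> K_conf n"
    using ex_is_solution[OF T_trans_K_conf[OF u]] by blast
  have sx: "tr_solves n t (\<lambda>t. T_trans p q (x t))"
    using x by (auto intro!: solves_T_trans is_solution_solves)
  have sy: "tr_solves n t y"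
    using y by (auto intro!: is_solution_solves)
  have "T_trans p q (x 0) = y 0"
    using x(1) y(1) by (simp add: is_solution_def)
  then have "T_trans p q (x t) = y t"
    using solves_order[OF sx sy, of t] solves_order[OF sy sx, of t] assms(2) by (simp add: order_antisym)
  then show ?thesis
    using flow_eq[OF x(1) assms(2)] flow_eq[OF y(1) assms(2)] by simp
qed

text \<open>Shifting time by \<open>s\<close> preserves the equation when \<open>s\<close> is a
  period of \<open>F\<close>: every \<open>s\<close> for a constant drive, natural numbers for a
  drive of period 1.\<close>

lemma flow_add:
  assumes "u \<in> X_conf" "0 \<le> t" "0 \<le> s" and F: "\<And>r. F (r + s) = F r"
  shows "flow V F (t + s) u = flow V F t (flow V F s u)"
proof -
  obtain x where x: "is_solution V F u x"
    using ex_is_solution_X[OF assms(1)] by blast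
  have "is_solution V F (x s) (\<lambda>r. x (r + s))"
    unfolding is_solution_def
  proof (intro conjI allI impI)
    fix \<tau> :: real assume "0 \<le> \<tau>"
    then obtain n where "\<forall>t\<in>{0..\<tau> + s}. x t \<in> K_conf n"
      using x \<open>0 \<le> s\<close> unfolding is_solution_def by (meson add_nonneg_nonneg)
    then show "\<exists>n. \<forall>t\<in>{0..\<tau>}. x (t + s) \<in> K_conf n"
      using \<open>0 \<le> s\<close> by (intro exI[of _ n]) auto
  next
    fix r :: real and j assume "0 \<le> r"
    then have "((\<lambda>s. x s j) has_real_derivative - partial2 V (x (r + s) (j - 1)) (x (r + s) j)
        - partial1 V (x (r + s) j) (x (r + s) (j + 1)) + F (r + s)) (at (r + s) within {0..})"
      using x \<open>0 \<le> s\<close> by (simp add: is_solution_def)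
    then have "((\<lambda>s. x s j) has_real_derivative - partial2 V (x (r + s) (j - 1)) (x (r + s) j)
        - partial1 V (x (r + s) j) (x (r + s) (j + 1)) + F r) (at (r + s) within (\<lambda>r. r + s) ` {0..})"
      unfolding F by (rule DERIV_subset) (use \<open>0 \<le> s\<close> in auto)
    from DERIV_image_chain[OF this, of 1]
    have "((\<lambda>r. r + s) has_real_derivative 1) (at r within {0..}) \<Longrightarrow>
      ((\<lambda>r. x (r + s) j) has_real_derivative - partial2 V (x (r + s) (j - 1)) (x (r + s) j)
        - partial1 V (x (r + s) j) (x (r + s) (j + 1)) + F r) (at r within {0..})"
      by (simp add: o_def)
    moreover have "((\<lambda>r. r + s) has_real_derivative 1) (at r within {0..})"
      by (auto intro!: derivative_eq_intros)
    ultimately show "((\<lambda>r. x (r + s) j) has_real_derivative - partial2 V (x (r + s) (j - 1)) (x (r + s) j)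
        - partial1 V (x (r + s) j) (x (r + s) (j + 1)) + F r) (at r within {0..})"
      by blast
  qed simp
  then show ?thesis
    using flow_eq[OF x] assms flow_eq by simp
qed

lemma flow_speed: "\<exists>M. \<forall>u\<in>K_conf n. \<forall>t\<ge>0. \<forall>j. \<bar>flow V F t u j - u j\<bar> \<le> M * t"
proof -
  obtain L M where "cooperative_lattice (trunc_field n) L M"
    using cooperative_trunc_field by blast
  then interpret cooperative_lattice "trunc_field n" L M .
  show ?thesis
  proof (intro exI[of _ M] ballI allI impI)
    fix u t j assume u: "u \<in> K_conf n" and t: "(0::real) \<le> t"
    obtain x where x: "is_solution V F u x" "\<And>t. 0 \<le> t \<Longrightarrow> x t \<in> K_conf n"
      using ex_is_solution[OF u] by blast
    have "solves t x"
      using x by (auto intro!: is_solution_solves)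
    then have "\<bar>x t j - x 0 j\<bar> \<le> M * t"
      by (rule speed_bound) (use t in auto)
    then show "\<bar>flow V F t u j - u j\<bar> \<le> M * t"
      using flow_eq[OF x(1) t] x(1) by (simp add: is_solution_def)
  qed
qed

section \<open>Continuity of the flow on configurations with bounded differences\<close>

text \<open>Near the origin finitely many sites converge uniformly; far out the difference of two
  members of \<open>K_conf n\<close> grows only linearly and is swallowed by the weight.\<close>

lemma K_conf_weighted_convergence:
  assumes U: "\<And>k. U k \<in> K_conf n" and u: "u \<in> K_conf n" and lim: "\<And>j. (\<lambda>k. U k j) \<longlonglongrightarrow> u j"
    and "0 < \<epsilon>"
  shows "\<forall>\<^sub>F k in sequentially. \<forall>j. \<bar>U k j - u j\<bar> \<le> \<epsilon> * weight j"
proof -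
  \<comment> \<open>This is \<open>(1 + 2 * n * m) / 2 ^ m\<close>: two configurations that differ
    by at most 1 at site 0 differ by at most \<open>1 + 2 * n * m\<close> at sites \<open>m\<close>
    and \<open>- m\<close>.\<close>
  have "(\<lambda>m. (1 / 2) ^ m + 2 * real n * (of_nat m * (1 / 2) ^ m)) \<longlonglongrightarrow> 0 + 2 * real n * (0 :: real)"
    by (intro tendsto_intros LIMSEQ_realpow_zero powser_times_n_limit_0) auto
  then have "\<forall>\<^sub>F m in sequentially. (1 / 2) ^ m + 2 * real n * (of_nat m * (1 / 2) ^ m) < \<epsilon>"
    using \<open>0 < \<epsilon>\<close> by (intro order_tendstoD(2)) auto
  then obtain N where N: "\<And>m. N \<le> m \<Longrightarrow> (1 / 2) ^ m + 2 * real n * (of_nat m * (1 / 2) ^ m) < \<epsilon>"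
    by (auto simp: eventually_sequentially)
  have tail: "1 + 2 * real n * of_int \<bar>j\<bar> \<le> \<epsilon> * weight j" if "int N \<le> \<bar>j\<bar>" for j
  proof -
    define m where "m = nat \<bar>j\<bar>"
    have j: "of_int \<bar>j\<bar> = real m" "weight j = 2 ^ m"
      by (auto simp: m_def weight_def)
    have "((1 / 2) ^ m + 2 * real n * (real m * (1 / 2) ^ m)) * 2 ^ m \<le> \<epsilon> * 2 ^ m"
      using N[of m] that by (intro mult_right_mono less_imp_le) (auto simp: m_def)
    also have "((1 / 2) ^ m + 2 * real n * (real m * (1 / 2) ^ m)) * 2 ^ m
        = (1 + 2 * real n * real m) * ((1 / 2) ^ m * 2 ^ m)"
      by (simp add: algebra_simps)
    also have "(1 / 2 :: real) ^ m * 2 ^ m = 1"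
      by (simp flip: power_mult_distrib)
    finally show ?thesis
      unfolding j by simp
  qed
  have close: "\<forall>\<^sub>F k in sequentially. \<bar>U k j - u j\<bar> < e" if "0 < e" for e j
    using tendstoD[OF lim that] by (simp add: dist_real_def)
  have "\<forall>\<^sub>F k in sequentially. \<forall>j\<in>{- int N..int N}. \<bar>U k j - u j\<bar> < \<epsilon>"
    using close[OF \<open>0 < \<epsilon>\<close>] by (intro eventually_ball_finite) auto
  moreover have "\<forall>\<^sub>F k in sequentially. \<bar>U k 0 - u 0\<bar> < 1"
    by (rule close) simp
  ultimately show ?thesis
  proof eventually_elim
    case (elim k)
    show ?case
    proof
      fix j
      show "\<bar>U k j - u j\<bar> \<le> \<epsilon> * weight j"
      proof (cases "int N \<le> \<bar>j\<bar>")
        case True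
        have "\<bar>U k j - u j\<bar> \<le> 1 + 2 * real n * of_int \<bar>j\<bar>"
          using K_conf_growth[OF U[of k], of j 0] K_conf_growth[OF u, of j 0] elim(2) by simp
        then show ?thesis
          using tail[OF True] by simp
      next
        case False
        then have "\<bar>U k j - u j\<bar> < \<epsilon>"
          by (intro bspec[OF elim(1)]) auto
        also have "\<epsilon> * 1 \<le> \<epsilon> * weight j"
          using \<open>0 < \<epsilon>\<close> weight_ge_1 by (intro mult_left_mono) auto
        finally show ?thesis by simp
      qed
    qed
  qed
qed

lemma flow_continuous:
  assumes U: "\<And>k. U k \<in> K_conf n" and u: "u \<in> K_conf n" and lim: "\<And>j. (\<lambda>k. U k j) \<longlonglongrightarrow> u j"
    and t: "0 \<le> t"
  shows "(\<lambda>k. flow V F t (U k) j) \<longlonglongrightarrow> flow V F t u j"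
proof (rule tendstoI)
  fix e :: real assume "0 < e"
  obtain K where K: "\<And>\<tau> x y \<epsilon> t j. tr_solves n \<tau> x \<Longrightarrow> tr_solves n \<tau> y \<Longrightarrow> 0 \<le> \<epsilon> \<Longrightarrow>
     (\<And>j. x 0 j - y 0 j \<le> \<epsilon> * weight j) \<Longrightarrow> t \<in> {0..\<tau>} \<Longrightarrow> x t j - y t j \<le> \<epsilon> * exp (K * t) * weight j"
    using solves_comparison[of n] by metis
  \<comment> \<open>Chosen so that the comparison bound at time \<open>t\<close> and site
    \<open>j\<close> equals \<open>e / 2\<close>.\<close>
  define \<epsilon> where "\<epsilon> = e / (2 * (exp (K * t) * weight j))"
  have \<epsilon>: "0 < \<epsilon>" "\<epsilon> * exp (K * t) * weight j < e"
    using \<open>0 < e\<close> weight_pos[of j] by (auto simp: \<epsilon>_def field_simps)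
  obtain y where y: "is_solution V F u y" "\<And>t. 0 \<le> t \<Longrightarrow> y t \<in> K_conf n"
    using ex_is_solution[OF u] by blast
  have sy: "tr_solves n t y"
    using y by (auto intro!: is_solution_solves)
  show "\<forall>\<^sub>F k in sequentially. dist (flow V F t (U k) j) (flow V F t u j) < e"
    using K_conf_weighted_convergence[OF U u lim \<epsilon>(1)]
  proof (rule eventually_mono)
    fix k assume k: "\<forall>j. \<bar>U k j - u j\<bar> \<le> \<epsilon> * weight j"
    obtain x where x: "is_solution V F (U k) x" "\<And>t. 0 \<le> t \<Longrightarrow> x t \<in> K_conf n"
      using ex_is_solution[OF U] by blast
    have sx: "tr_solves n t x"
      using x by (auto intro!: is_solution_solves)
    have 0: "x 0 = U k" "y 0 = u"
      using x y by (auto simp: is_solution_def)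
    have "x t j - y t j \<le> \<epsilon> * exp (K * t) * weight j"
      by (rule K[OF sx sy]) (use \<epsilon>(1) k t 0 in \<open>auto simp: abs_le_iff\<close>)
    moreover have "y t j - x t j \<le> \<epsilon> * exp (K * t) * weight j"
      by (rule K[OF sy sx]) (use \<epsilon>(1) k t 0 in \<open>auto simp: abs_le_iff\<close>)
    ultimately show "dist (flow V F t (U k) j) (flow V F t u j) < e"
      using \<epsilon>(2) flow_eq[OF x(1) t] flow_eq[OF y(1) t] by (simp add: dist_real_def)
  qed
qed

end

section \<open>Travelling waves\<close>

text \<open>Lifts of monotone circle maps of degree one. Jumps are allowed, which makes the class
  stable under pointwise limits and bounded suprema.\<close>

definition degree_one :: "(real \<Rightarrow> real) set" where
  "degree_one = {h. mono h \<and> (\<forall>x. h (x + 1) = h x + 1)}"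

lemma degree_oneI: "(\<And>x y. x \<le> y \<Longrightarrow> h x \<le> h y) \<Longrightarrow> (\<And>x. h (x + 1) = h x + 1) \<Longrightarrow> h \<in> degree_one"
  by (auto simp: degree_one_def mono_def)

lemma degree_one_mono: "h \<in> degree_one \<Longrightarrow> x \<le> y \<Longrightarrow> h x \<le> h y"
  and degree_one_1: "h \<in> degree_one \<Longrightarrow> h (x + 1) = h x + 1"
  by (auto simp: degree_one_def mono_def)

lemma degree_one_of_int:
  assumes "h \<in> degree_one" shows "h (x + of_int k) = h x + of_int k"
  using periodic_of_int[of "\<lambda>u v. h u - v" x k x] degree_one_1[OF assms] by simp

text \<open>Rounding \<open>y - z\<close> down to an integer traps \<open>h y\<close> between two
  integer translates of \<open>h z\<close>. All uniform bounds on profiles, orbits and hull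
  configurations come from here.\<close>

lemma degree_one_osc:
  assumes h: "h \<in> degree_one" shows "\<bar>h y - h z - (y - z)\<bar> \<le> 1"
proof -
  define k where "k = \<lfloor>y - z\<rfloor>"
  have k: "of_int k \<le> y - z" "y - z < of_int k + 1"
    unfolding k_def by linarith+
  have "h (z + of_int k) \<le> h y" "h y \<le> h (z + of_int (k + 1))"
    using k by (auto intro!: degree_one_mono[OF h])
  then have "h z + of_int k \<le> h y" "h y \<le> h z + of_int k + 1"
    using degree_one_of_int[OF h, of z k] degree_one_of_int[OF h, of z "k + 1"] by simp_all
  then show ?thesis
    using k by linarith
qed

lemma degree_one_translate: "h \<in> degree_one \<Longrightarrow> (\<lambda>x. h (x + a)) \<in> degree_one"
proof (rule degree_oneI)
  fix x assume "h \<in> degree_one"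
  then show "h (x + 1 + a) = h (x + a) + 1"
    using degree_one_1[of h "x + a"] by (simp add: add_ac)
qed (auto intro: degree_one_mono)

lemma degree_one_id: "(\<lambda>x. x) \<in> degree_one"
  by (rule degree_oneI) auto

lemma degree_one_limit:
  assumes H: "\<And>k::nat. H k \<in> degree_one" and lim: "\<And>x. (\<lambda>k. H k x) \<longlonglongrightarrow> h x"
  shows "h \<in> degree_one"
proof (rule degree_oneI)
  fix x y :: real assume "x \<le> y"
  then show "h x \<le> h y"
    by (intro LIMSEQ_le[OF lim lim]) (auto intro: degree_one_mono[OF H])
next
  fix x
  have "(\<lambda>k. H k (x + 1)) \<longlonglongrightarrow> h x + 1"
    unfolding degree_one_1[OF H] by (intro tendsto_intros lim)
  then show "h (x + 1) = h x + 1"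
    using LIMSEQ_unique[OF lim] by blast
qed

lemma degree_one_SUP:
  assumes "T \<noteq> {}" and H: "\<And>t. t \<in> T \<Longrightarrow> H t \<in> degree_one"
    and bdd: "\<And>x. bdd_above ((\<lambda>t. H t x) ` T)"
  shows "(\<lambda>x. SUP t\<in>T. H t x) \<in> degree_one"
proof (rule degree_oneI)
  fix x y :: real assume "x \<le> y"
  then show "(SUP t\<in>T. H t x) \<le> (SUP t\<in>T. H t y)"
    by (intro cSUP_mono assms bdd) (auto intro: degree_one_mono[OF H])
next
  fix x
  show "(SUP t\<in>T. H t (x + 1)) = (SUP t\<in>T. H t x) + 1"
  proof (rule antisym)
    show "(SUP t\<in>T. H t (x + 1)) \<le> (SUP t\<in>T. H t x) + 1"
      using assms by (intro cSUP_least) (auto simp: degree_one_1[OF H] intro: cSUP_upper)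
    have "(SUP t\<in>T. H t x) \<le> (SUP t\<in>T. H t (x + 1)) - 1"
    proof (rule cSUP_least)
      fix t assume t: "t \<in> T"
      have "H t (x + 1) \<le> (SUP t\<in>T. H t (x + 1))"
        by (rule cSUP_upper[OF t bdd])
      then show "H t x \<le> (SUP t\<in>T. H t (x + 1)) - 1"
        using degree_one_1[OF H[OF t]] by simp
    qed (rule assms)
    then show "(SUP t\<in>T. H t x) + 1 \<le> (SUP t\<in>T. H t (x + 1))"
      by simp
  qed
qed

text \<open>A Fekete type argument: \<open>b\<close> at a product \<open>m n\<close> is estimated
  once as \<open>n\<close> copies of \<open>m\<close> and once as \<open>m\<close> copies of
  \<open>n\<close>. Hence every lower slope \<open>(b m - D) / m\<close> lies below every upper
  slope \<open>(b n + D) / n\<close>, and \<open>c\<close> separates them.\<close>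

lemma quasi_additive_slope:
  fixes b :: "nat \<Rightarrow> real"
  assumes quasi: "\<And>m n. \<bar>b (m + n) - b m - b n\<bar> \<le> D"
  shows "\<exists>c. \<forall>n. \<bar>b n - c * real n\<bar> \<le> D"
proof -
  have mult: "real (Suc k) * (b m - D) + D \<le> b (Suc k * m) \<and> b (Suc k * m) \<le> real (Suc k) * (b m + D) - D" for k m
  proof (induction k)
    case (Suc k)
    have "\<bar>b (m + Suc k * m) - b m - b (Suc k * m)\<bar> \<le> D"
      by (rule quasi)
    moreover have "Suc (Suc k) * m = m + Suc k * m" "real (Suc (Suc k)) = 1 + real (Suc k)"
      by simp_all
    ultimately show ?case
      using Suc by (simp only: distrib_right mult_1) linarith
  qed simp
  have le: "(b m - D) / real m \<le> (b n + D) / real n" if pos: "0 < m" "0 < n" for m n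
  proof -
    obtain m' n' where mn: "m = Suc m'" "n = Suc n'"
      using pos by (cases m; cases n) auto
    have "0 \<le> D"
      using quasi[of 0 0] by linarith
    then have "real n * (b m - D) \<le> real m * (b n + D)"
      using mult[of n' m] mult[of m' n] unfolding mn[symmetric] by (simp add: mult.commute)
    then show ?thesis
      using that by (simp add: field_simps)
  qed
  define c where "c = (SUP m\<in>{0<..}. (b m - D) / real m)"
  have lower: "(b n - D) / real n \<le> c" if "0 < n" for n
    unfolding c_def using that le[of _ 1] by (intro cSUP_upper) (auto intro!: bdd_aboveI2)
  have upper: "c \<le> (b n + D) / real n" if "0 < n" for n
    unfolding c_def using that le by (intro cSUP_least) auto
  have "\<bar>b n - c * real n\<bar> \<le> D" for n
  proof (cases "n = 0")
    case True
    then show ?thesis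
      using quasi[of 0 0] by simp
  next
    case False
    then have "b n - D \<le> c * real n" "c * real n \<le> b n + D"
      using lower[of n] upper[of n] by (simp_all add: pos_divide_le_eq pos_le_divide_eq)
    then show ?thesis
      by linarith
  qed
  then show ?thesis by blast
qed

section \<open>Order preserving semigroups commuting with translations\<close>

text \<open>\<open>S\<close> will be the half line or the natural numbers, which treats both drives
  at once. \<open>S_diff\<close> allows a late time to be split as an earlier orbit followed by time
  \<open>r\<close>; \<open>cont\<close> is sequential and pointwise, matching the monotone limits
  taken below.\<close>

locale degree_one_semigroup =
  fixes S :: "real set" and \<Phi> :: "real \<Rightarrow> (real \<Rightarrow> real) \<Rightarrow> real \<Rightarrow> real"
  assumes S_nat: "real n \<in> S"
    and S_nonneg: "t \<in> S \<Longrightarrow> 0 \<le> t"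
    and S_add: "s \<in> S \<Longrightarrow> t \<in> S \<Longrightarrow> s + t \<in> S"
    and S_diff: "s \<in> S \<Longrightarrow> t \<in> S \<Longrightarrow> s \<le> t \<Longrightarrow> t - s \<in> S"
    and closed: "t \<in> S \<Longrightarrow> h \<in> degree_one \<Longrightarrow> \<Phi> t h \<in> degree_one"
    and order: "t \<in> S \<Longrightarrow> h \<in> degree_one \<Longrightarrow> k \<in> degree_one \<Longrightarrow> h \<le> k \<Longrightarrow> \<Phi> t h \<le> \<Phi> t k"
    and shift: "t \<in> S \<Longrightarrow> h \<in> degree_one \<Longrightarrow> \<Phi> t (\<lambda>x. h (x + a)) = (\<lambda>x. \<Phi> t h (x + a))"
    and add: "s \<in> S \<Longrightarrow> t \<in> S \<Longrightarrow> h \<in> degree_one \<Longrightarrow> \<Phi> (t + s) h = \<Phi> t (\<Phi> s h)"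
    and cont: "t \<in> S \<Longrightarrow> (\<And>k. H k \<in> degree_one) \<Longrightarrow> h \<in> degree_one \<Longrightarrow>
       (\<And>x. (\<lambda>k. H k x) \<longlonglongrightarrow> h x) \<Longrightarrow> (\<lambda>k. \<Phi> t (H k) x) \<longlonglongrightarrow> \<Phi> t h x"
    and locally_bounded: "\<exists>C. \<forall>t\<in>S. t \<le> 1 \<longrightarrow> \<bar>\<Phi> t (\<lambda>x. x) 0\<bar> \<le> C"
begin

definition displacement :: "real \<Rightarrow> real" where
  "displacement t = \<Phi> t (\<lambda>x. x) 0"

text \<open>One unit of error arises from squeezing \<open>h\<close> between two translations of the
  identity, the other from the oscillation of the image of the identity.\<close>

lemma image_bounds:
  assumes t: "t \<in> S" and h: "h \<in> degree_one"
  shows "\<bar>\<Phi> t h x - (x + h 0 + displacement t)\<bar> \<le> 2"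
proof -
  have f: "\<Phi> t (\<lambda>x. x) \<in> degree_one"
    by (rule closed[OF t degree_one_id])
  have id: "(\<lambda>x. x + a) \<in> degree_one" for a
    using degree_one_translate[OF degree_one_id] .
  have img: "\<Phi> t (\<lambda>x. x + a) x = \<Phi> t (\<lambda>x. x) (x + a)" for a
    using shift[OF t degree_one_id] by simp
  have "\<bar>h y - h 0 - (y - 0)\<bar> \<le> 1" for y
    by (rule degree_one_osc[OF h])
  then have "(\<lambda>x. x + (h 0 - 1)) \<le> h" "h \<le> (\<lambda>x. x + (h 0 + 1))"
    by (simp_all add: le_fun_def abs_le_iff algebra_simps)
  then have "\<Phi> t (\<lambda>x. x + (h 0 - 1)) x \<le> \<Phi> t h x" "\<Phi> t h x \<le> \<Phi> t (\<lambda>x. x + (h 0 + 1)) x"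
    using order[OF t] id h by (auto simp: le_fun_def)
  moreover have "\<bar>\<Phi> t (\<lambda>x. x) y - \<Phi> t (\<lambda>x. x) 0 - (y - 0)\<bar> \<le> 1" for y
    by (rule degree_one_osc[OF f])
  then have "\<bar>\<Phi> t (\<lambda>x. x) y - displacement t - y\<bar> \<le> 1" for y
    by (simp add: displacement_def)
  note this[of "x + (h 0 - 1)"] this[of "x + (h 0 + 1)"]
  ultimately show ?thesis
    unfolding img by linarith
qed

text \<open>Applying \<open>image_bounds\<close> to the image of the identity at time
  \<open>s\<close> shows that \<open>displacement\<close> is additive up to 2. Natural times thus
  have a slope; the fractional part of \<open>t\<close> costs only the bound on displacements up to
  time 1.\<close>

lemma ex_velocity: "\<exists>c C. \<forall>t\<in>S. \<bar>displacement t - c * t\<bar> \<le> C"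
proof -
  have quasi: "\<bar>displacement (t + s) - displacement t - displacement s\<bar> \<le> 2" if "s \<in> S" "t \<in> S" for s t
    using image_bounds[OF that(2) closed[OF that(1) degree_one_id], of 0] add[OF that degree_one_id]
    by (simp add: displacement_def algebra_simps)
  have "\<bar>displacement (real (m + n)) - displacement (real m) - displacement (real n)\<bar> \<le> 2" for m n
    using quasi[OF S_nat S_nat] by simp
  then obtain c where c: "\<And>n. \<bar>displacement (real n) - c * real n\<bar> \<le> 2"
    using quasi_additive_slope[of "\<lambda>n. displacement (real n)" 2] by blast
  obtain C where C: "\<And>t. t \<in> S \<Longrightarrow> t \<le> 1 \<Longrightarrow> \<bar>displacement t\<bar> \<le> C"
    using locally_bounded by (auto simp: displacement_def)
  have "\<bar>displacement t - c * t\<bar> \<le> 4 + C + \<bar>c\<bar>" if t: "t \<in> S" for t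
  proof -
    define n where "n = nat \<lfloor>t\<rfloor>"
    define s where "s = t - real n"
    have s: "0 \<le> s" "s \<le> 1" "s \<in> S"
    proof -
      have "real n \<le> t" "t \<le> real n + 1"
        using S_nonneg[OF t] unfolding n_def by linarith+
      then show "0 \<le> s" "s \<le> 1" "s \<in> S"
        using S_diff[OF S_nat t] by (auto simp: s_def)
    qed
    have "\<bar>displacement t - displacement (real n) - displacement s\<bar> \<le> 2"
      using quasi[OF s(3) S_nat, of n] by (simp add: s_def)
    moreover have "\<bar>c * s\<bar> \<le> \<bar>c\<bar> * 1"
      unfolding abs_mult using s by (intro mult_left_mono) auto
    moreover have "c * t = c * real n + c * s"
      by (simp add: s_def algebra_simps)
    ultimately show ?thesis
      using c[of n] C[OF s(3,2)] by linarith
  qed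
  then show ?thesis by blast
qed

text \<open>In a frame moving with the mean velocity \<open>c\<close> all orbits are bounded. The upper limit \<open>g\<close>
  of an orbit is then moved upwards by the semigroup, so its own orbit increases to a fixed point.\<close>

theorem ex_travelling_wave:
  "\<exists>h\<in>degree_one. \<exists>c. \<forall>t\<in>S. \<Phi> t h = (\<lambda>x. h (x + c * t))"
proof -
  obtain c C where C: "\<And>t. t \<in> S \<Longrightarrow> \<bar>displacement t - c * t\<bar> \<le> C"
    using ex_velocity by blast
  define \<Psi> where "\<Psi> = (\<lambda>t h x. \<Phi> t h (x - c * t))"
  have \<Psi>_closed: "\<Psi> t h \<in> degree_one" if "t \<in> S" "h \<in> degree_one" for t h
    using degree_one_translate[OF closed[OF that], of "- (c * t)"] by (simp add: \<Psi>_def)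
  have \<Psi>_order: "\<Psi> t h x \<le> \<Psi> t k x"
    if "t \<in> S" "h \<in> degree_one" "k \<in> degree_one" "\<And>x. h x \<le> k x" for t h k x
    using order[OF that(1-3)] that(4) by (simp add: \<Psi>_def le_fun_def)
  \<comment> \<open>Passing to the moving frame preserves the semigroup law because the evolution
    commutes with translations.\<close>
  have \<Psi>_add: "\<Psi> (t + s) h = \<Psi> t (\<Psi> s h)" if "s \<in> S" "t \<in> S" "h \<in> degree_one" for s t h
    using shift[OF that(2) closed[OF that(1,3)], of "- (c * s)"] add[OF that]
    by (simp add: \<Psi>_def fun_eq_iff algebra_simps)
  have \<Psi>_cont: "(\<lambda>k. \<Psi> t (H k) x) \<longlonglongrightarrow> \<Psi> t h x"
    if "t \<in> S" "\<And>k. H k \<in> degree_one" "h \<in> degree_one" "\<And>x. (\<lambda>k. H k x) \<longlonglongrightarrow> h x" for t H h x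
    unfolding \<Psi>_def by (rule cont[OF that])
  have \<Psi>_bound: "\<bar>\<Psi> t h x - (x + h 0)\<bar> \<le> C + 2" if "t \<in> S" "h \<in> degree_one" for t h x
    using image_bounds[OF that, of "x - c * t"] C[OF that(1)] unfolding \<Psi>_def by linarith

  \<comment> \<open>The tail supremum of the orbit of the identity; the tails shrink as
    \<open>n\<close> grows, so their limit \<open>g\<close> is the pointwise limsup.\<close>
  define s where "s = (\<lambda>(n::nat) x. SUP t\<in>S \<inter> {real n..}. \<Psi> t (\<lambda>x. x) x)"
  have ne: "S \<inter> {real n..} \<noteq> {}" for n
    using S_nat[of n] by auto
  have bdd: "bdd_above ((\<lambda>t. \<Psi> t (\<lambda>x. x) x) ` (S \<inter> {real n..}))" for n x
    using \<Psi>_bound[OF _ degree_one_id, where x = x]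
    by (intro bdd_aboveI2[of _ _ "x + (C + 2)"]) (auto simp: abs_le_iff algebra_simps)
  have s_closed: "s n \<in> degree_one" for n
    unfolding s_def by (rule degree_one_SUP[OF ne]) (auto intro: \<Psi>_closed degree_one_id bdd)
  have s_upper: "\<Psi> t (\<lambda>x. x) x \<le> s n x" if "t \<in> S" "real n \<le> t" for t n x
    unfolding s_def using that by (intro cSUP_upper bdd) auto
  have s_lower: "x - (C + 2) \<le> s n x" for n x
    using s_upper[of "real n" n x, OF S_nat order_refl] \<Psi>_bound[OF S_nat[of n] degree_one_id, where x = x]
    by (simp add: abs_le_iff)
  \<comment> \<open>By monotonicity the image of a supremum dominates the supremum of the images.
    Only this inequality is available, so \<open>g\<close> is pushed upwards but need not be
    fixed.\<close>
  have s_push: "s m x \<le> \<Psi> r (s n) x" if "r \<in> S" "real n + r \<le> real m" for r m n x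
  proof -
    have "(SUP t\<in>S \<inter> {real m..}. \<Psi> t (\<lambda>x. x) x) \<le> \<Psi> r (s n) x"
    proof (rule cSUP_least[OF ne])
      fix t assume "t \<in> S \<inter> {real m..}"
      then have t: "t \<in> S" "real m \<le> t" by auto
      have tr: "t - r \<in> S"
        using S_diff[OF that(1) t(1)] that(2) t(2) by simp
      have "\<Psi> t (\<lambda>x. x) x = \<Psi> r (\<Psi> (t - r) (\<lambda>x. x)) x"
        using \<Psi>_add[OF tr that(1) degree_one_id] by simp
      also have "\<dots> \<le> \<Psi> r (s n) x"
        using that t tr by (intro \<Psi>_order \<Psi>_closed degree_one_id s_closed s_upper) auto
      finally show "\<Psi> t (\<lambda>x. x) x \<le> \<Psi> r (s n) x" .
    qed
    then show ?thesis
      by (simp add: s_def)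
  qed
  define g where "g = (\<lambda>x. INF n. s n x)"
  have s_bdd: "bdd_below (range (\<lambda>n. s n x))" for x
    using s_lower by (intro bdd_belowI2)
  have s_lim: "(\<lambda>n. s n x) \<longlonglongrightarrow> g x" for x
    unfolding g_def
  proof (rule LIMSEQ_decseq_INF[OF s_bdd])
    show "decseq (\<lambda>n. s n x)"
      unfolding s_def decseq_def by (auto intro!: cSUP_subset_mono bdd ne)
  qed
  have g: "g \<in> degree_one"
    by (rule degree_one_limit[OF s_closed s_lim])
  have g_push: "g x \<le> \<Psi> r g x" if "r \<in> S" for r x
  proof (rule LIMSEQ_le_const[OF \<Psi>_cont[OF that s_closed g s_lim]], intro exI allI impI)
    fix n
    have "g x \<le> s (n + nat \<lceil>r\<rceil>) x"
      unfolding g_def by (rule cINF_lower[OF s_bdd]) simp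
    also have "\<dots> \<le> \<Psi> r (s n) x"
      by (rule s_push[OF that]) linarith
    finally show "g x \<le> \<Psi> r (s n) x" .
  qed

  \<comment> \<open>The orbit of \<open>g\<close> is nondecreasing and bounded, so it converges, and
    continuity makes its limit a fixed point.\<close>
  define h where "h = (\<lambda>x. SUP n. \<Psi> (real n) g x)"
  have inc: "\<Psi> t g x \<le> \<Psi> (t + r) g x" if "t \<in> S" "r \<in> S" for t r x
    using \<Psi>_add[OF that(2,1) g] g_push[OF that(2)] \<Psi>_order[OF that(1) g \<Psi>_closed[OF that(2) g]] by simp
  have h_lim: "(\<lambda>n. \<Psi> (real n) g x) \<longlonglongrightarrow> h x" for x
    unfolding h_def
  proof (rule LIMSEQ_incseq_SUP)
    show "bdd_above (range (\<lambda>n. \<Psi> (real n) g x))"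
      using \<Psi>_bound[OF S_nat g, where x = x]
      by (intro bdd_aboveI2[of _ _ "x + g 0 + (C + 2)"]) (simp add: abs_le_iff algebra_simps)
    show "incseq (\<lambda>n. \<Psi> (real n) g x)"
      using inc[OF S_nat S_nat[of 1]] by (intro incseq_SucI) (simp add: add.commute)
  qed
  have h: "h \<in> degree_one"
    by (rule degree_one_limit[OF \<Psi>_closed[OF S_nat g] h_lim])
  have fixed: "\<Psi> r h x = h x" if r: "r \<in> S" for r x
  proof -
    define m where "m = nat \<lceil>r\<rceil>"
    have mr: "real m - r \<in> S"
      using S_diff[OF r S_nat[of m]] by (simp add: m_def real_nat_ceiling_ge)
    \<comment> \<open>The limit was taken along natural times; monotonicity in time squeezes the
      times \<open>n + r\<close> between \<open>n\<close> and \<open>n + m\<close>.\<close>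
    have "(\<lambda>n. \<Psi> (real n + r) g x) \<longlonglongrightarrow> h x"
    proof (rule tendsto_sandwich[OF _ _ h_lim LIMSEQ_ignore_initial_segment[OF h_lim]])
      show "\<forall>\<^sub>F n in sequentially. \<Psi> (real n) g x \<le> \<Psi> (real n + r) g x"
        using inc[OF S_nat r] by simp
      show "\<forall>\<^sub>F n in sequentially. \<Psi> (real n + r) g x \<le> \<Psi> (real (n + m)) g x"
        using inc[OF S_add[OF S_nat r] mr] by simp
    qed
    then have "(\<lambda>n. \<Psi> r (\<Psi> (real n) g) x) \<longlonglongrightarrow> h x"
      using \<Psi>_add[OF S_nat r g] by (simp add: add.commute)
    moreover have "(\<lambda>n. \<Psi> r (\<Psi> (real n) g) x) \<longlonglongrightarrow> \<Psi> r h x"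
      by (rule \<Psi>_cont[OF r \<Psi>_closed[OF S_nat g] h h_lim])
    ultimately show ?thesis
      using LIMSEQ_unique by blast
  qed
  have "\<Phi> t h = (\<lambda>x. h (x + c * t))" if "t \<in> S" for t
  proof
    fix x
    show "\<Phi> t h x = h (x + c * t)"
      using fixed[OF that, of "x + c * t"] by (simp add: \<Psi>_def)
  qed
  then show ?thesis
    using h by blast
qed

end

section \<open>Ergodic measures for circle rotations\<close>

text \<open>Cauchy's functional equation for a monotone function: \<open>m * l\<close> is trapped
  between consecutive integers, and the error \<open>\<kappa> 1 / m\<close> tends to zero.\<close>

lemma nonneg_additive_linear:
  fixes \<kappa> :: "real \<Rightarrow> real"
  assumes add: "\<And>x y. 0 \<le> x \<Longrightarrow> 0 \<le> y \<Longrightarrow> \<kappa> (x + y) = \<kappa> x + \<kappa> y"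
    and nonneg: "\<And>x. 0 \<le> x \<Longrightarrow> 0 \<le> \<kappa> x" and "0 \<le> l"
  shows "\<kappa> l = l * \<kappa> 1"
proof -
  have mono: "\<kappa> x \<le> \<kappa> y" if "0 \<le> x" "x \<le> y" for x y
    using add[of x "y - x"] nonneg[of "y - x"] that by simp
  have mult: "\<kappa> (real n * x) = real n * \<kappa> x" if "0 \<le> x" for n x
  proof (induction n)
    case 0
    show ?case
      using add[of 0 0] by simp
  next
    case (Suc n)
    then show ?case
      using add[of x "real n * x"] that by (simp add: algebra_simps)
  qed
  have bound: "\<bar>\<kappa> l - l * \<kappa> 1\<bar> \<le> \<kappa> 1 * inverse (real (Suc n))" for n
  proof -
    define m where "m = real (Suc n)"
    define k where "k = nat \<lfloor>m * l\<rfloor>"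
    have "0 \<le> m * l"
      using \<open>0 \<le> l\<close> by (simp add: m_def)
    then have k: "real k \<le> m * l" "m * l \<le> real (Suc k)"
      unfolding k_def by linarith+
    have "\<kappa> (real k * 1) \<le> \<kappa> (m * l)" "\<kappa> (m * l) \<le> \<kappa> (real (Suc k) * 1)"
      using k \<open>0 \<le> m * l\<close> by (auto intro: mono)
    then have 1: "real k * \<kappa> 1 \<le> m * \<kappa> l" "m * \<kappa> l \<le> real (Suc k) * \<kappa> 1"
      using mult[of 1 k] mult[of 1 "Suc k"] mult[OF \<open>0 \<le> l\<close>, of "Suc n"] by (simp_all add: m_def)
    have 2: "real k * \<kappa> 1 \<le> (m * l) * \<kappa> 1" "(m * l) * \<kappa> 1 \<le> real (Suc k) * \<kappa> 1"
      using k nonneg[of 1] by (auto intro!: mult_right_mono)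
    have "real (Suc k) * \<kappa> 1 = real k * \<kappa> 1 + \<kappa> 1"
      by (simp add: algebra_simps)
    then have "\<bar>m * \<kappa> l - (m * l) * \<kappa> 1\<bar> \<le> \<kappa> 1"
      using 1 2 by linarith
    also have "m * \<kappa> l - (m * l) * \<kappa> 1 = m * (\<kappa> l - l * \<kappa> 1)"
      by (simp add: algebra_simps)
    finally have "m * \<bar>\<kappa> l - l * \<kappa> 1\<bar> \<le> \<kappa> 1"
      by (simp add: abs_mult m_def)
    then show ?thesis
      by (simp add: m_def field_simps)
  qed
  have "(\<lambda>n. \<kappa> 1 * inverse (real (Suc n))) \<longlonglongrightarrow> 0"
    by (intro tendsto_mult_right_zero LIMSEQ_inverse_real_of_nat)
  then have "\<bar>\<kappa> l - l * \<kappa> 1\<bar> \<le> 0"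
    by (rule LIMSEQ_le_const) (use bound in blast)
  then show ?thesis by simp
qed

lemma emeasure_lborel_translate:
  fixes A :: "real set"
  assumes "A \<in> sets borel"
  shows "emeasure lborel {x. x + \<theta> \<in> A} = emeasure lborel A"
proof -
  have "emeasure lborel A = emeasure (distr lborel borel ((+) \<theta>)) A"
    by (simp add: lborel_distr_plus)
  also have "\<dots> = emeasure lborel ((+) \<theta> -` A \<inter> space lborel)"
    using assms by (intro emeasure_distr) auto
  also have "(+) \<theta> -` A \<inter> space lborel = {x. x + \<theta> \<in> A}"
    by (auto simp: add.commute)
  finally show ?thesis by simp
qed

text \<open>A Borel subset of the circle, encoded by its lift to the line; this avoids a separate
  circle type.\<close>

locale periodic_borel_set =
  fixes B :: "real set"
  assumes borel [measurable]: "B \<in> sets borel"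
    and periodic_1: "x + 1 \<in> B \<longleftrightarrow> x \<in> B"
begin

lemma periodic_int: "x + of_int k \<in> B \<longleftrightarrow> x \<in> B"
  using periodic_of_int[of "\<lambda>u v. if u \<in> B then 1 else 0" x k 0] periodic_1
  by (simp split: if_splits)

definition mass :: "real \<Rightarrow> real \<Rightarrow> real" where
  "mass a b = measure lborel (B \<inter> {a..<b})"

lemma emeasure_part: "emeasure lborel (B \<inter> {a..<b}) = ennreal (mass a b)"
proof -
  have "emeasure lborel (B \<inter> {a..<b}) \<le> emeasure lborel {a..<b}"
    by (intro emeasure_mono) auto
  also have "\<dots> < \<infinity>"
    by (cases "a \<le> b") auto
  finally show ?thesis
    unfolding mass_def by (intro emeasure_eq_ennreal_measure) auto
qed

lemma mass_nonneg: "0 \<le> mass a b"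
  by (simp add: mass_def)

lemma mass_le: "a \<le> b \<Longrightarrow> mass a b \<le> b - a"
proof -
  assume "a \<le> b"
  have "emeasure lborel (B \<inter> {a..<b}) \<le> emeasure lborel {a..<b}"
    by (intro emeasure_mono) auto
  then show ?thesis
    using \<open>a \<le> b\<close> by (simp add: emeasure_part)
qed

lemma mass_add: "a \<le> b \<Longrightarrow> b \<le> c \<Longrightarrow> mass a c = mass a b + mass b c"
proof -
  assume "a \<le> b" "b \<le> c"
  then have "B \<inter> {a..<c} = B \<inter> {a..<b} \<union> B \<inter> {b..<c}"
    by auto
  then have "emeasure lborel (B \<inter> {a..<c}) = emeasure lborel (B \<inter> {a..<b}) + emeasure lborel (B \<inter> {b..<c})"
    by (simp only:) (intro plus_emeasure[symmetric]; auto)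
  then have "ennreal (mass a c) = ennreal (mass a b + mass b c)"
    by (simp add: emeasure_part mass_nonneg)
  then show ?thesis
    by (subst (asm) ennreal_inj) (auto simp: mass_nonneg)
qed

lemma mass_translate: "ennreal (mass (a + \<theta>) (b + \<theta>)) = emeasure lborel {x \<in> {a..<b}. x + \<theta> \<in> B}"
proof -
  have "emeasure lborel {x. x + \<theta> \<in> B \<inter> {a + \<theta>..<b + \<theta>}} = emeasure lborel (B \<inter> {a + \<theta>..<b + \<theta>})"
    by (rule emeasure_lborel_translate) simp
  moreover have "{x. x + \<theta> \<in> B \<inter> {a + \<theta>..<b + \<theta>}} = {x \<in> {a..<b}. x + \<theta> \<in> B}"
    by auto
  ultimately show ?thesis
    by (simp add: emeasure_part)
qed

lemma mass_periodic: "mass (a + of_int k) (b + of_int k) = mass a b"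
proof -
  have "{x \<in> {a..<b}. x + of_int k \<in> B} = B \<inter> {a..<b}"
    by (auto simp: periodic_int)
  then have "ennreal (mass (a + of_int k) (b + of_int k)) = ennreal (mass a b)"
    by (simp only: mass_translate emeasure_part)
  then show ?thesis
    by (subst (asm) ennreal_inj) (auto simp: mass_nonneg)
qed

lemma mass_unit: "mass \<theta> (\<theta> + 1) = mass 0 1"
proof -
  define k where "k = \<lfloor>\<theta>\<rfloor>"
  define r where "r = \<theta> - of_int k"
  have r: "0 \<le> r" "r \<le> 1"
    unfolding r_def k_def by linarith+
  have "mass \<theta> (\<theta> + 1) = mass r (r + 1)"
    using mass_periodic[of r k "r + 1"] by (simp add: r_def algebra_simps)
  also have "\<dots> = mass r 1 + mass 1 (r + 1)"
    using r by (intro mass_add) auto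
  also have "mass 1 (r + 1) = mass 0 r"
    using mass_periodic[of 0 1 r] by simp
  also have "mass r 1 + mass 0 r = mass 0 1"
    using r mass_add[of 0 r 1] by simp
  finally show ?thesis .
qed

lemma translate_invariant: "emeasure lborel {x \<in> {0..<1}. x + \<theta> \<in> B} = emeasure lborel (B \<inter> {0..<1})"
  using mass_translate[of 0 \<theta> 1] mass_unit[of \<theta>] by (simp add: emeasure_part add.commute)

text \<open>Forward invariance yields only that translating a window by \<open>\<theta>\<close>
  cannot decrease its mass. Since the forward orbit of \<open>\<theta>\<close> is dense modulo 1 and
  the mass varies continuously with the window, one window has at most the mass of any other;
  exchanging them gives equality.\<close>

lemma mass_translation_invariant:
  assumes "\<theta> \<notin> \<rat>" and inv: "\<And>x. x \<in> B \<Longrightarrow> x + \<theta> \<in> B" and "0 \<le> l"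
  shows "mass y (y + l) = mass z (z + l)"
proof -
  have step: "mass a b \<le> mass (a + \<theta>) (b + \<theta>)" for a b
  proof -
    have "emeasure lborel (B \<inter> {a..<b}) \<le> emeasure lborel {x \<in> {a..<b}. x + \<theta> \<in> B}"
      by (intro emeasure_mono) (auto intro: inv)
    then show ?thesis
      by (simp only: mass_translate[symmetric] emeasure_part ennreal_le_iff[OF mass_nonneg])
  qed
  have iter: "mass a b \<le> mass (a + real k * \<theta>) (b + real k * \<theta>)" for a b k
  proof (induction k)
    case (Suc k)
    then show ?case
      using step[of "a + real k * \<theta>" "b + real k * \<theta>"] by (simp add: algebra_simps)
  qed simp
  have close: "mass a (a + l) \<le> mass b (b + l) + \<bar>a - b\<bar>" for a b
  proof (cases "a \<le> b")
    case True
    have "mass a (b + l) = mass a (a + l) + mass (a + l) (b + l)" "mass a (b + l) = mass a b + mass b (b + l)"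
      using True \<open>0 \<le> l\<close> by (intro mass_add; simp)+
    then show ?thesis
      using True mass_nonneg[of "a + l" "b + l"] mass_le[of a b] by simp
  next
    case False
    have "mass b (a + l) = mass b a + mass a (a + l)" "mass b (a + l) = mass b (b + l) + mass (b + l) (a + l)"
      using False \<open>0 \<le> l\<close> by (intro mass_add; simp)+
    then show ?thesis
      using False mass_nonneg[of b a] mass_le[of "b + l" "a + l"] by simp
  qed
  have le: "mass y (y + l) \<le> mass z (z + l)" for y z
  proof (rule field_le_epsilon)
    fix \<epsilon> :: real assume "0 < \<epsilon>"
    \<comment> \<open>The density theorem is used with positive multiples, as only forward iterates
      are controlled.\<close>
    obtain h k where "k > 0" and hk: "\<bar>of_int k * \<theta> - of_int h - (z - y)\<bar> < \<epsilon>"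
      using sequence_of_fractional_parts_is_dense[OF \<open>\<theta> \<notin> \<rat>\<close> \<open>0 < \<epsilon>\<close>] by blast
    define w where "w = y + of_int k * \<theta>"
    have "mass y (y + l) \<le> mass w (w + l)"
      using iter[of y "y + l" "nat k"] \<open>k > 0\<close> by (simp add: w_def algebra_simps)
    also have "mass w (w + l) = mass (w - of_int h) (w - of_int h + l)"
      using mass_periodic[of "w - of_int h" h "w - of_int h + l"] by (simp add: algebra_simps)
    also have "\<dots> \<le> mass z (z + l) + \<bar>w - of_int h - z\<bar>"
      by (rule close)
    also have "\<bar>w - of_int h - z\<bar> < \<epsilon>"
      using hk by (simp add: w_def algebra_simps)
    finally show "mass y (y + l) \<le> mass z (z + l) + \<epsilon>"
      by simp
  qed
  show ?thesis
    by (rule antisym) (rule le)+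
qed

text \<open>The mass of a window is proportional to its length with factor \<open>\<beta>\<close>.
  So Lebesgue measure restricted to \<open>B\<close> and divided by \<open>\<beta>\<close> agrees
  with Lebesgue measure on intervals, hence everywhere, and the complement of \<open>B\<close> is
  null.\<close>

lemma irrational_ergodic:
  assumes "\<theta> \<notin> \<rat>" and inv: "\<And>x. x \<in> B \<Longrightarrow> x + \<theta> \<in> B"
  shows "mass 0 1 \<in> {0, 1}"
proof (cases "mass 0 1 = 0")
  case False
  define \<beta> where "\<beta> = mass 0 1"
  have \<beta>: "0 < \<beta>"
    using False mass_nonneg[of 0 1] by (simp add: \<beta>_def)
  have tr: "mass y (y + l) = mass 0 l" if "0 \<le> l" for y l
    using mass_translation_invariant[OF assms that, of y 0] by simp
  have linear: "mass 0 l = l * \<beta>" if "0 \<le> l" for l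
    unfolding \<beta>_def
  proof (rule nonneg_additive_linear[OF _ _ that])
    fix x y :: real assume "0 \<le> x" "0 \<le> y"
    then show "mass 0 (x + y) = mass 0 x + mass 0 y"
      using mass_add[of 0 x "x + y"] tr[of y x] by simp
  qed (rule mass_nonneg)
  have "lborel = density lborel (\<lambda>x. ennreal (1 / \<beta>) * indicator B x)"
  proof (rule lborel_eqI)
    fix l u :: real assume "\<And>b. b \<in> Basis \<Longrightarrow> l \<bullet> b \<le> u \<bullet> b"
    then have "l \<le> u" by simp
    have "emeasure (density lborel (\<lambda>x. ennreal (1 / \<beta>) * indicator B x)) (box l u)
        = (\<integral>\<^sup>+x. ennreal (1 / \<beta>) * indicator B x * indicator (box l u) x \<partial>lborel)"
      by (rule emeasure_density) auto
    also have "\<dots> = (\<integral>\<^sup>+x. ennreal (1 / \<beta>) * indicator (B \<inter> {l..<u}) x \<partial>lborel)"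
    proof (rule nn_integral_cong_AE)
      \<comment> \<open>Boxes are open while \<open>mass\<close> uses half-open intervals; they
        differ only in the left endpoint.\<close>
      show "AE x in lborel. ennreal (1 / \<beta>) * indicator B x * indicator (box l u) x
          = ennreal (1 / \<beta>) * indicator (B \<inter> {l..<u}) x"
        using AE_lborel_singleton[of l]
        by eventually_elim (auto simp: indicator_def box_real)
    qed
    also have "\<dots> = ennreal (1 / \<beta>) * emeasure lborel (B \<inter> {l..<u})"
      by (subst nn_integral_cmult_indicator) auto
    also have "\<dots> = ennreal (1 / \<beta> * mass l u)"
      using \<beta> by (simp add: emeasure_part ennreal_mult'' mass_nonneg flip: ennreal_mult')
    also have "mass l u = (u - l) * \<beta>"
      using tr[of "u - l" l] linear[of "u - l"] \<open>l \<le> u\<close> by simp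
    finally show "emeasure (density lborel (\<lambda>x. ennreal (1 / \<beta>) * indicator B x)) (box l u)
        = (\<Prod>b\<in>Basis. (u - l) \<bullet> b)"
      using \<beta> by simp
  qed simp
  then have "emeasure lborel ({0..<1} - B)
      = emeasure (density lborel (\<lambda>x. ennreal (1 / \<beta>) * indicator B x)) ({0..<1} - B)"
    by simp
  also have "\<dots> = (\<integral>\<^sup>+x. ennreal (1 / \<beta>) * indicator B x * indicator ({0..<1} - B) x \<partial>lborel)"
    by (rule emeasure_density) auto
  also have "\<dots> = (\<integral>\<^sup>+x. 0 \<partial>(lborel :: real measure))"
    by (intro nn_integral_cong) (auto simp: indicator_def)
  finally have null: "emeasure lborel ({0..<1::real} - B) = 0"
    by simp
  have "emeasure lborel {0..<1::real} = emeasure lborel (B \<inter> {0..<1}) + emeasure lborel ({0..<1} - B)"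
  proof (subst plus_emeasure)
    show "emeasure lborel {0..<1::real} = emeasure lborel (B \<inter> {0..<1} \<union> ({0..<1} - B))"
      by (rule arg_cong[where f = "emeasure lborel"]) auto
  qed auto
  then have "ennreal \<beta> = 1"
    using null by (simp add: emeasure_part \<beta>_def)
  then show ?thesis
    using \<beta> by (simp add: \<beta>_def)
qed simp

end

section \<open>Measures ergodic under a set of rotations\<close>

text \<open>A measure on the line stands for one on the circle, so it is tested on periodic sets
  alone. The zero-one law is demanded for forward invariant sets, to match the inclusion required of
  the flow.\<close>

definition rotation_ergodic :: "real set \<Rightarrow> real measure \<Rightarrow> bool" where
  "rotation_ergodic U \<nu> \<longleftrightarrow> prob_space \<nu> \<and> sets \<nu> = sets borel \<and>
     (\<forall>B. periodic_borel_set B \<longrightarrow>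
        (\<forall>\<theta>\<in>U. emeasure \<nu> {x. x + \<theta> \<in> B} = emeasure \<nu> B) \<and>
        ((\<forall>\<theta>\<in>U. \<forall>x\<in>B. x + \<theta> \<in> B) \<longrightarrow> measure \<nu> B \<in> {0, 1}))"

text \<open>A single irrational angle forces the zero-one law, and Lebesgue measure modulo 1 is
  invariant under all the other angles as well.\<close>

lemma rotation_ergodic_irrational:
  assumes "\<theta> \<in> U" "\<theta> \<notin> \<rat>"
  shows "rotation_ergodic U (uniform_measure lborel {0..<1})"
  unfolding rotation_ergodic_def
proof (intro conjI allI impI ballI)
  show "prob_space (uniform_measure lborel {0..<1::real})"
    by (rule prob_space_uniform_measure) auto
  show "sets (uniform_measure lborel {0..<1::real}) = sets borel"
    by simp
next
  fix B \<phi> assume "periodic_borel_set B" "\<phi> \<in> U"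
  then interpret periodic_borel_set B by simp
  have "{x. x + \<phi> \<in> B} \<in> sets borel"
    by measurable
  moreover have "{0..<1} \<inter> {x. x + \<phi> \<in> B} = {x \<in> {0..<1}. x + \<phi> \<in> B}"
    by auto
  ultimately show "emeasure (uniform_measure lborel {0..<1}) {x. x + \<phi> \<in> B}
      = emeasure (uniform_measure lborel {0..<1}) B"
    using translate_invariant[of \<phi>] by (simp add: Int_commute)
next
  fix B assume "periodic_borel_set B" and inv: "\<forall>\<theta>\<in>U. \<forall>x\<in>B. x + \<theta> \<in> B"
  then interpret periodic_borel_set B by simp
  have "emeasure (uniform_measure lborel {0..<1}) B = ennreal (mass 0 1)"
    by (simp add: Int_commute emeasure_part divide_ennreal mass_nonneg flip: ennreal_1)
  then have "measure (uniform_measure lborel {0..<1}) B = mass 0 1"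
    by (simp add: measure_def mass_nonneg)
  then show "measure (uniform_measure lborel {0..<1}) B \<in> {0, 1}"
    using irrational_ergodic[OF assms(2)] inv assms(1) by simp
qed

text \<open>For the least common denominator \<open>N\<close>, the angles generate modulo 1 the
  whole group of multiples of \<open>1 / N\<close>. It acts transitively on the points
  \<open>k / N\<close>, so an invariant set contains all or none of them.\<close>

lemma rotation_ergodic_rational:
  assumes "\<exists>N>0. \<forall>\<theta>\<in>U. real N * \<theta> \<in> \<int>"
  shows "\<exists>\<nu>. rotation_ergodic U \<nu>"
proof -
  define N where "N = (LEAST N. N > 0 \<and> (\<forall>\<theta>\<in>U. real N * \<theta> \<in> \<int>))"
  have N: "N > 0" "\<And>\<theta>. \<theta> \<in> U \<Longrightarrow> real N * \<theta> \<in> \<int>"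
    using LeastI_ex[OF assms] by (auto simp: N_def)
  have N_min: "N \<le> M" if "M > 0" "\<And>\<theta>. \<theta> \<in> U \<Longrightarrow> real M * \<theta> \<in> \<int>" for M
    unfolding N_def using that by (intro Least_le) auto
  define pt where "pt = (\<lambda>k::nat. real k / real N)"
  define \<nu> where "\<nu> = distr (measure_pmf (pmf_of_set {..<N})) borel pt"
  have ne: "{..<N} \<noteq> {}"
    using N by auto
  have [measurable]: "pt \<in> measure_pmf (pmf_of_set {..<N}) \<rightarrow>\<^sub>M borel"
    by simp
  have em: "emeasure \<nu> A = ennreal (card ({..<N} \<inter> {k. pt k \<in> A}) / real N)" if "A \<in> sets borel" for A
    unfolding \<nu>_def using that ne
    by (subst emeasure_distr) (auto simp: emeasure_pmf_of_set vimage_def)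
  have "rotation_ergodic U \<nu>"
    unfolding rotation_ergodic_def
  proof (intro conjI allI impI ballI)
    show "prob_space \<nu>"
      unfolding \<nu>_def by (intro prob_space.prob_space_distr measure_pmf.prob_space_axioms) simp
    show "sets \<nu> = sets borel"
      by (simp add: \<nu>_def)
  next
    fix B \<theta> assume "periodic_borel_set B" and \<theta>: "\<theta> \<in> U"
    then interpret periodic_borel_set B by simp
    obtain p where p: "real N * \<theta> = of_int p"
      using N(2)[OF \<theta>] by (auto elim: Ints_cases)
    \<comment> \<open>The permutation of the indices induced by the rotation by
      \<open>\<theta> = p / N\<close>.\<close>
    define f where "f = (\<lambda>k::nat. nat ((int k + p) mod int N))"
    have f_less: "f k < N" for k
      using N(1) by (simp add: f_def nat_less_iff)
    have f_pt: "pt (f k) \<in> B \<longleftrightarrow> pt k + \<theta> \<in> B" for k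
    proof -
      define q where "q = (int k + p) div int N"
      have "int (f k) = int k + p - int N * q"
        using N(1) by (simp add: f_def q_def minus_mult_div_eq_mod)
      then have "real (f k) = real k + of_int p - real N * of_int q"
        by (metis (mono_tags, lifting) of_int_add of_int_diff of_int_mult of_int_of_nat_eq)
      then have "pt (f k) + of_int q = pt k + \<theta>"
        using N(1) p unfolding pt_def by (simp add: field_simps)
      then show ?thesis
        using periodic_int[of "pt (f k)" q] by simp
    qed
    have inj: "inj_on f {..<N}"
    proof (rule inj_onI)
      fix k l assume kl: "k \<in> {..<N}" "l \<in> {..<N}" "f k = f l"
      then have "(int k + p) mod int N = (int l + p) mod int N"
        using N(1) by (simp add: f_def nat_eq_iff2)
      then have "int k mod int N = int l mod int N"
        by (metis add_diff_cancel_right' mod_diff_left_eq)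
      then show "k = l"
        using kl by simp
    qed
    have img: "f ` {..<N} = {..<N}"
      by (rule endo_inj_surj) (use f_less inj in auto)
    have "bij_betw f ({..<N} \<inter> {k. pt k \<in> {x. x + \<theta> \<in> B}}) ({..<N} \<inter> {k. pt k \<in> B})"
      unfolding bij_betw_def
    proof
      show "inj_on f ({..<N} \<inter> {k. pt k \<in> {x. x + \<theta> \<in> B}})"
        using inj by (rule inj_on_subset) auto
      show "f ` ({..<N} \<inter> {k. pt k \<in> {x. x + \<theta> \<in> B}}) = {..<N} \<inter> {k. pt k \<in> B}"
      proof
        show "f ` ({..<N} \<inter> {k. pt k \<in> {x. x + \<theta> \<in> B}}) \<subseteq> {..<N} \<inter> {k. pt k \<in> B}"
          using f_less f_pt by auto
        show "{..<N} \<inter> {k. pt k \<in> B} \<subseteq> f ` ({..<N} \<inter> {k. pt k \<in> {x. x + \<theta> \<in> B}})"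
        proof
          fix l assume l: "l \<in> {..<N} \<inter> {k. pt k \<in> B}"
          then obtain k where "k < N" "l = f k"
            using img by blast
          then show "l \<in> f ` ({..<N} \<inter> {k. pt k \<in> {x. x + \<theta> \<in> B}})"
            using l f_pt by auto
        qed
      qed
    qed
    then have "card ({..<N} \<inter> {k. pt k \<in> {x. x + \<theta> \<in> B}}) = card ({..<N} \<inter> {k. pt k \<in> B})"
      by (rule bij_betw_same_card)
    moreover have "{x. x + \<theta> \<in> B} \<in> sets borel"
      by measurable
    ultimately show "emeasure \<nu> {x. x + \<theta> \<in> B} = emeasure \<nu> B"
      by (simp only: em borel)
  next
    fix B assume "periodic_borel_set B" and inv: "\<forall>\<theta>\<in>U. \<forall>x\<in>B. x + \<theta> \<in> B"
    then interpret periodic_borel_set B by simp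
    \<comment> \<open>The rotations by multiples of \<open>1 / N\<close> that map \<open>B\<close>
      into itself. The goal is that \<open>J\<close> is all of the integers.\<close>
    define J where "J = {j::int. \<forall>x\<in>B. x + of_int j / real N \<in> B}"
    have J_add: "i + j \<in> J" if "i \<in> J" "j \<in> J" for i j
      using that unfolding J_def by (simp add: add_divide_distrib) (metis add.assoc)
    have J_N: "int N * i \<in> J" for i
      using N(1) periodic_int by (simp add: J_def)
    have J_mult: "int k * j \<in> J" if "j \<in> J" for k j
    proof (induction k)
      case 0
      then show ?case
        using J_N[of 0] by simp
    next
      case (Suc k)
      then show ?case
        using J_add[OF that] by (simp add: distrib_right)
    qed
    have J_uminus: "- j \<in> J" if "j \<in> J" for j
    proof -
      \<comment> \<open>Rotating \<open>N - 1\<close> more times undoes a rotation by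
        \<open>j / N\<close>, up to an integer. This turns forward invariance into invariance under
        a group.\<close>
      have "int (N - 1) * j + int N * (- j) \<in> J"
        by (intro J_add J_mult J_N that)
      moreover have "int (N - 1) * j + int N * (- j) = - j"
        using N(1) by (simp add: of_nat_diff algebra_simps)
      ultimately show ?thesis by simp
    qed
    have J_imult: "k * j \<in> J" if "j \<in> J" for k j
      using J_mult[OF that] J_mult[OF J_uminus[OF that]] by (cases k rule: int_cases2) force+
    have J_U: "\<exists>j\<in>J. real N * \<theta> = of_int j" if "\<theta> \<in> U" for \<theta>
    proof -
      obtain p where p: "real N * \<theta> = of_int p"
        using N(2)[OF \<open>\<theta> \<in> U\<close>] by (auto elim: Ints_cases)
      then have "of_int p / real N = \<theta>"
        using N(1) by (simp add: field_simps)
      then have "p \<in> J"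
        using inv that by (simp add: J_def)
      then show ?thesis
        using p by blast
    qed
    define d where "d = (LEAST d. d > 0 \<and> int d \<in> J)"
    have d: "d > 0" "int d \<in> J"
      using LeastI[of "\<lambda>d. d > 0 \<and> int d \<in> J" N] N(1) J_N[of 1] by (auto simp: d_def)
    have d_least: "d \<le> e" if "e > 0" "int e \<in> J" for e
      unfolding d_def using that by (intro Least_le) simp
    have d_dvd: "int d dvd j" if "j \<in> J" for j
    proof (rule ccontr)
      assume "\<not> int d dvd j"
      then have r: "0 < j mod int d" "j mod int d < int d"
        using d(1) pos_mod_sign[of "int d" j] pos_mod_bound[of "int d" j]
        unfolding dvd_eq_mod_eq_0 by linarith+
      have "j + - (j div int d) * int d \<in> J"
        by (intro J_add J_imult that d)
      then have "j mod int d \<in> J"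
        by (simp add: minus_div_mult_eq_mod)
      then have "int (nat (j mod int d)) \<in> J"
        using r by simp
      then have "d \<le> nat (j mod int d)"
        using r by (intro d_least) auto
      then show False
        using r by linarith
    qed
    have "d dvd N"
      using d_dvd[OF J_N[of 1]] by simp
    then obtain M where M: "N = d * M"
      by (rule dvdE)
    \<comment> \<open>All elements of \<open>J\<close> are multiples of \<open>d\<close>, so
      \<open>M = N / d\<close> is already a common denominator of the angles; minimality of
      \<open>N\<close> forces \<open>d = 1\<close>.\<close>
    have "N \<le> M"
    proof (rule N_min)
      show "M > 0"
        using N(1) M by (cases M) auto
      fix \<theta> assume "\<theta> \<in> U"
      then obtain j where j: "j \<in> J" "real N * \<theta> = of_int j"
        using J_U by blast
      then obtain i where "j = int d * i"
        using d_dvd by (auto simp: dvd_def)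
      then have "real M * \<theta> = of_int i"
        using j(2) M d(1) by simp
      then show "real M * \<theta> \<in> \<int>"
        by simp
    qed
    then have "d = 1"
      using M N(1) d(1) by (cases d) auto
    then have J1: "j \<in> J" for j
      using J_imult[OF d(2), of j] by simp
    have all: "pt l \<in> B" if "pt k \<in> B" for k l
    proof -
      have "pt k + of_int (int l - int k) / real N \<in> B"
        using J1[of "int l - int k"] that by (simp add: J_def)
      then show ?thesis
        by (simp add: pt_def add_divide_distrib[symmetric])
    qed
    show "measure \<nu> B \<in> {0, 1}"
    proof (cases "\<exists>k. pt k \<in> B")
      case True
      then have "{..<N} \<inter> {k. pt k \<in> B} = {..<N}"
        using all by auto
      then show ?thesis
        using em[OF borel] N(1) by (simp add: measure_def)
    next
      case False
      then have "{..<N} \<inter> {k. pt k \<in> B} = {}"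
        by auto
      then show ?thesis
        using em[OF borel] by (simp add: measure_def)
    qed
  qed
  then show ?thesis by blast
qed

section \<open>The measure on the quotient\<close>

lemma R_class_eq: "u \<in> X_conf \<Longrightarrow> R_class u = range (\<lambda>k. T_trans 0 k u)"
proof -
  assume u: "u \<in> X_conf"
  have "(\<forall>i. v i = u i + of_int k) \<longleftrightarrow> v = T_trans 0 k u" for v k
    by (auto simp: T_trans_def)
  then show ?thesis
    using u T_trans_X_conf[OF u] by (auto simp: R_class_def R_rel_def)
qed

lemma self_in_R_class: "u \<in> X_conf \<Longrightarrow> u \<in> R_class u"
  using R_class_eq[of u] by (auto intro!: range_eqI[of _ _ 0])

lemma R_class_in_X_quot: "u \<in> X_conf \<Longrightarrow> R_class u \<in> X_quot"
  by (auto simp: R_class_def X_quot_def intro: quotientI)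

lemma R_class_T_trans: "u \<in> X_conf \<Longrightarrow> R_class (T_trans 0 k u) = R_class u"
proof -
  assume u: "u \<in> X_conf"
  have "\<forall>i. T_trans 0 k u i = u i + of_int k"
    by (simp add: T_trans_def)
  then have "(u, T_trans 0 k u) \<in> R_rel"
    using u T_trans_X_conf[OF u] unfolding R_rel_def by blast
  then show ?thesis
    unfolding R_class_def by (rule equiv_class_eq[OF equiv_R_rel, symmetric])
qed

lemma X_quotE:
  assumes "c \<in> X_quot" obtains u where "u \<in> X_conf" "c = R_class u"
  using assms by (auto simp: X_quot_def R_class_def quotient_def)

lemma quot_map_R_class:
  assumes "\<And>u. u \<in> X_conf \<Longrightarrow> f u \<in> X_conf"
    and "\<And>u k. u \<in> X_conf \<Longrightarrow> f (T_trans 0 k u) = T_trans 0 k (f u)"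
    and u: "u \<in> X_conf"
  shows "quot_map f (R_class u) = R_class (f u)"
  using assms by (simp add: quot_map_def R_class_eq[OF u] R_class_T_trans)

lemma space_X_quot_borel: "space X_quot_borel = X_quot"
  unfolding X_quot_borel_def by (rule space_measure_of) (auto simp: openin_X_quot_topology)

lemma openin_in_X_quot_borel: "openin X_quot_topology U \<Longrightarrow> U \<in> sets X_quot_borel"
  by (auto simp: X_quot_borel_def openin_X_quot_topology intro!: sigma_sets.Basic)

lemma measurable_into_X_quot_borel:
  assumes "\<And>x. x \<in> space M \<Longrightarrow> f x \<in> X_quot"
    and "\<And>U. openin X_quot_topology U \<Longrightarrow> f -` U \<inter> space M \<in> sets M"
  shows "f \<in> M \<rightarrow>\<^sub>M X_quot_borel"
  unfolding X_quot_borel_def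
  by (rule measurable_measure_of) (use assms in \<open>auto simp: openin_X_quot_topology\<close>)

lemma openin_X_quot_topologyE:
  assumes "openin X_quot_topology U"
  obtains W where "open W" "\<And>u. u \<in> X_conf \<Longrightarrow> R_class u \<in> U \<longleftrightarrow> u \<in> W"
proof -
  obtain W where "open W" "{u \<in> X_conf. R_class u \<in> U} = X_conf \<inter> W"
    using assms by (auto simp: openin_X_quot_topology openin_open)
  then show thesis
    by (intro that[of W]) blast+
qed

text \<open>Inclusion of whole classes avoids a choice of representatives; for saturated
  \<open>A\<close> it amounts to one representative lying in \<open>A\<close>.\<close>

definition classes_in :: "config set \<Rightarrow> config set set" where
  "classes_in A = {c \<in> X_quot. c \<subseteq> A}"

definition R_saturated :: "config set \<Rightarrow> bool" where
  "R_saturated A \<longleftrightarrow> (\<forall>u k. T_trans 0 k u \<in> A \<longleftrightarrow> u \<in> A)"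

lemma R_saturatedI:
  assumes "\<And>u k. u \<in> A \<Longrightarrow> T_trans 0 k u \<in> A" shows "R_saturated A"
  unfolding R_saturated_def
proof (intro allI iffI)
  fix u k assume "T_trans 0 k u \<in> A"
  from assms[OF this, of "- k"] show "u \<in> A"
    by (simp add: T_trans_T_trans)
qed (rule assms)

lemma R_class_in_classes_in:
  "R_saturated A \<Longrightarrow> u \<in> X_conf \<Longrightarrow> R_class u \<in> classes_in A \<longleftrightarrow> u \<in> A"
  using R_class_in_X_quot[of u] self_in_R_class[of u]
  by (auto simp: classes_in_def R_class_eq R_saturated_def)

lemma classes_in_open:
  assumes "open W" "R_saturated W" shows "classes_in W \<in> sets X_quot_borel"
proof (rule openin_in_X_quot_borel)
  have "{u \<in> X_conf. R_class u \<in> classes_in W} = X_conf \<inter> W"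
    using R_class_in_classes_in[OF assms(2)] by blast
  then show "openin X_quot_topology (classes_in W)"
    using assms(1) by (auto simp: openin_X_quot_topology classes_in_def openin_open)
qed

lemma classes_in_closed:
  assumes "closed C" "R_saturated C" shows "classes_in C \<in> sets X_quot_borel"
proof -
  have sat: "R_saturated (- C)"
    using assms(2) by (simp add: R_saturated_def)
  have "classes_in C = X_quot - classes_in (- C)"
  proof (intro set_eqI)
    fix c
    show "c \<in> classes_in C \<longleftrightarrow> c \<in> X_quot - classes_in (- C)"
    proof (cases "c \<in> X_quot")
      case True
      then obtain u where "u \<in> X_conf" "c = R_class u"
        by (rule X_quotE)
      then show ?thesis
        using R_class_in_classes_in[OF sat] R_class_in_classes_in[OF assms(2)] True by simp
    qed (simp add: classes_in_def)
  qed
  moreover have "classes_in (- C) \<in> sets X_quot_borel"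
    using assms(1) by (intro classes_in_open sat) auto
  ultimately show ?thesis
    using sets.compl_sets[of "classes_in (- C)" X_quot_borel] by (simp add: space_X_quot_borel)
qed

lemma continuous_on_config_coordinate: "continuous_on A (\<lambda>u :: config. u i)"
  by (rule continuous_on_subset[OF continuous_on_product_coordinates]) simp

lemma closed_K_conf: "closed (K_conf n)"
  unfolding K_conf_def
  by (intro closed_Collect_all closed_Collect_le continuous_intros continuous_on_config_coordinate)

lemma R_saturated_K_conf: "R_saturated (K_conf n)"
  by (rule R_saturatedI) (rule T_trans_K_conf)

lemma continuous_on_T_trans: "continuous_on A (T_trans p q)"
  unfolding T_trans_def[abs_def]
  by (intro continuous_on_coordinatewise_then_product continuous_intros continuous_on_config_coordinate)

text \<open>The time-\<open>t\<close> map is only known to be continuous on each \<open>K_conf n\<close>; these are closed and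
  exhaust \<open>X_conf\<close>, which suffices for measurability.\<close>

lemma measurable_quot_map:
  assumes fX: "\<And>u. u \<in> X_conf \<Longrightarrow> f u \<in> X_conf"
    and fT: "\<And>u k. u \<in> X_conf \<Longrightarrow> f (T_trans 0 k u) = T_trans 0 k (f u)"
    and cont: "\<And>n. continuous_on (K_conf n) f"
  shows "quot_map f \<in> X_quot_borel \<rightarrow>\<^sub>M X_quot_borel"
proof (rule measurable_into_X_quot_borel)
  fix c assume "c \<in> space X_quot_borel"
  then obtain u where "u \<in> X_conf" "c = R_class u"
    by (auto simp: space_X_quot_borel elim: X_quotE)
  then show "quot_map f c \<in> X_quot"
    using quot_map_R_class[OF fX fT] R_class_in_X_quot fX by simp
next
  fix U assume "openin X_quot_topology U"
  then obtain O' where O': "open O'" "\<And>u. u \<in> X_conf \<Longrightarrow> R_class u \<in> U \<longleftrightarrow> u \<in> O'"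
    by (rule openin_X_quot_topologyE) blast
  have "\<exists>W. open W \<and> W \<inter> K_conf n = f -` O' \<inter> K_conf n" for n
    using cont[of n] O'(1) unfolding continuous_on_open_invariant by blast
  then obtain W where W: "\<And>n. open (W n)" "\<And>n. W n \<inter> K_conf n = f -` O' \<inter> K_conf n"
    by metis
  \<comment> \<open>\<open>W n\<close> is tied to \<open>f\<close> only on \<open>K_conf n\<close>
    and need not be saturated elsewhere. The union of its preimages under the integer translations
    is open and saturated and has the same trace on \<open>K_conf n\<close>, since \<open>f\<close>
    commutes with these translations.\<close>
  define W' where "W' = (\<lambda>n. \<Union>k. T_trans 0 k -` W n)"
  have "open (W' n)" for n
    unfolding W'_def using W(1) continuous_on_T_trans[of UNIV]
    by (auto simp: continuous_on_open_vimage)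
  moreover have "R_saturated (W' n)" for n
  proof (rule R_saturatedI)
    fix u k assume "u \<in> W' n"
    then obtain l where "T_trans 0 l u \<in> W n"
      by (auto simp: W'_def)
    then have "T_trans 0 (l - k) (T_trans 0 k u) \<in> W n"
      by (simp add: T_trans_T_trans)
    then show "T_trans 0 k u \<in> W' n"
      by (auto simp: W'_def)
  qed
  ultimately have W': "classes_in (W' n) \<in> sets X_quot_borel" "R_saturated (W' n)" for n
    by (auto intro: classes_in_open)
  have f_W': "u \<in> W' n \<longleftrightarrow> R_class (f u) \<in> U" if u: "u \<in> K_conf n" for u n
  proof -
    have uX: "u \<in> X_conf"
      using u K_conf_subset_X_conf by blast
    have "T_trans 0 k u \<in> W n \<longleftrightarrow> R_class (f u) \<in> U" for k
    proof -
      have "T_trans 0 k u \<in> W n \<longleftrightarrow> f (T_trans 0 k u) \<in> O'"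
        using W(2)[of n] T_trans_K_conf[OF u, of 0 k] by blast
      also have "\<dots> \<longleftrightarrow> T_trans 0 k (f u) \<in> O'"
        by (simp add: fT[OF uX])
      also have "\<dots> \<longleftrightarrow> R_class (f u) \<in> U"
        using O'(2)[of "T_trans 0 k (f u)"] T_trans_X_conf fX[OF uX] R_class_T_trans by simp
      finally show ?thesis .
    qed
    then show ?thesis
      by (auto simp: W'_def)
  qed
  have "quot_map f -` U \<inter> space X_quot_borel = (\<Union>n. classes_in (K_conf n) \<inter> classes_in (W' n))"
  proof (intro set_eqI)
    fix c
    show "c \<in> quot_map f -` U \<inter> space X_quot_borel \<longleftrightarrow> c \<in> (\<Union>n. classes_in (K_conf n) \<inter> classes_in (W' n))"
    proof (cases "c \<in> X_quot")
      case True
      then obtain u where u: "u \<in> X_conf" "c = R_class u"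
        by (rule X_quotE)
      then obtain m where "u \<in> K_conf m"
        by (meson X_confE)
      have "c \<in> quot_map f -` U \<inter> space X_quot_borel \<longleftrightarrow> R_class (f u) \<in> U"
        using True u quot_map_R_class[OF fX fT u(1)] by (simp add: space_X_quot_borel)
      also have "\<dots> \<longleftrightarrow> (\<exists>n. u \<in> K_conf n \<and> u \<in> W' n)"
        using f_W' \<open>u \<in> K_conf m\<close> by blast
      finally show ?thesis
        using R_class_in_classes_in[OF R_saturated_K_conf u(1)] R_class_in_classes_in[OF W'(2) u(1)] u(2)
        by simp
    qed (auto simp: classes_in_def space_X_quot_borel)
  qed
  also have "\<dots> \<in> sets X_quot_borel"
    using W'(1) classes_in_closed[OF closed_K_conf R_saturated_K_conf] by auto
  finally show "quot_map f -` U \<inter> space X_quot_borel \<in> sets X_quot_borel" .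
qed

section \<open>Configurations generated by a hull function\<close>

definition hull_conf :: "(real \<Rightarrow> real) \<Rightarrow> real \<Rightarrow> real \<Rightarrow> config" where
  "hull_conf h \<rho> x = (\<lambda>j. h (\<rho> * of_int j + x))"

lemma T_trans_hull_conf:
  "h \<in> degree_one \<Longrightarrow> T_trans p q (hull_conf h \<rho> x) = hull_conf h \<rho> (x + \<rho> * of_int p + of_int q)"
proof
  fix i assume h: "h \<in> degree_one"
  have "\<rho> * of_int i + (x + \<rho> * of_int p + of_int q) = \<rho> * of_int (i + p) + x + of_int q"
    by (simp add: algebra_simps)
  then show "T_trans p q (hull_conf h \<rho> x) i = hull_conf h \<rho> (x + \<rho> * of_int p + of_int q) i"
    unfolding T_trans_def hull_conf_def by (simp only: degree_one_of_int[OF h])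
qed

text \<open>The width depends on \<open>\<rho>\<close> only, not on \<open>h\<close> or
  \<open>x\<close>; so continuity and speed bounds for one fixed \<open>K_conf n\<close> apply to
  all profiles at once.\<close>

lemma hull_conf_K_conf:
  assumes "h \<in> degree_one"
  shows "hull_conf h \<rho> x \<in> K_conf (nat \<lceil>\<bar>\<rho>\<bar> + 1\<rceil>)"
proof -
  have "\<bar>hull_conf h \<rho> x (i + 1) - hull_conf h \<rho> x i\<bar> \<le> \<bar>\<rho>\<bar> + 1" for i
    using degree_one_osc[OF assms, of "\<rho> * of_int (i + 1) + x" "\<rho> * of_int i + x"]
    by (simp add: hull_conf_def algebra_simps abs_le_iff) linarith
  then show ?thesis
    unfolding K_conf_def using order_trans[OF _ real_nat_ceiling_ge[of "\<bar>\<rho>\<bar> + 1"]] by blast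
qed

lemma hull_conf_X_conf: "h \<in> degree_one \<Longrightarrow> hull_conf h \<rho> x \<in> X_conf"
  using hull_conf_K_conf K_conf_subset_X_conf by blast

text \<open>Where \<open>h\<close> jumps the map is not continuous in \<open>x\<close>, but a
  monotone \<open>h\<close> is Borel, and measurability into the countable product is checked site
  by site.\<close>

lemma measurable_R_class_hull_conf:
  assumes h: "h \<in> degree_one"
  shows "(\<lambda>x. R_class (hull_conf h \<rho> x)) \<in> borel \<rightarrow>\<^sub>M X_quot_borel"
proof (rule measurable_into_X_quot_borel)
  have [measurable]: "h \<in> borel_measurable borel"
    using h by (intro borel_measurable_mono) (simp add: degree_one_def)
  have meas: "hull_conf h \<rho> \<in> borel_measurable borel"
    by (rule measurable_coordinatewise_then_product) (simp add: hull_conf_def)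
  fix U assume "openin X_quot_topology U"
  then obtain W where W: "open W" "\<And>u. u \<in> X_conf \<Longrightarrow> R_class u \<in> U \<longleftrightarrow> u \<in> W"
    by (rule openin_X_quot_topologyE) blast
  have "(\<lambda>x. R_class (hull_conf h \<rho> x)) -` U \<inter> space borel = hull_conf h \<rho> -` W \<inter> space borel"
    using W(2) hull_conf_X_conf[OF h] by auto
  then show "(\<lambda>x. R_class (hull_conf h \<rho> x)) -` U \<inter> space borel \<in> sets borel"
    using measurable_sets[OF meas, of W] W(1) by simp
qed (use hull_conf_X_conf[OF h] R_class_in_X_quot in blast)

text \<open>The uniform deviation bound implies rotation number \<open>\<rho>\<close> and, unlike
  the existence of a limit, is a closed condition; this makes the supporting set Borel.\<close>

definition ordered_confs :: "real \<Rightarrow> config set" where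
  "ordered_confs \<rho> = {u. rotationally_ordered u \<and> (\<forall>i j. \<bar>u j - u i - \<rho> * of_int (j - i)\<bar> \<le> 1)}"

lemma closed_ordered_confs: "closed (ordered_confs \<rho>)"
  unfolding ordered_confs_def rotationally_ordered_def le_fun_def T_trans_def
  by (intro closed_Collect_conj closed_Collect_all closed_Collect_disj closed_Collect_le
      continuous_intros continuous_on_config_coordinate)

lemma R_saturated_ordered_confs: "R_saturated (ordered_confs \<rho>)"
  by (rule R_saturatedI) (auto simp: ordered_confs_def rotationally_ordered_def le_fun_def T_trans_def)

lemma hull_conf_ordered:
  assumes h: "h \<in> degree_one"
  shows "hull_conf h \<rho> x \<in> ordered_confs \<rho>"
proof -
  have mono: "hull_conf h \<rho> x \<le> hull_conf h \<rho> y" if "x \<le> y" for x y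
    using that by (auto simp: hull_conf_def le_fun_def intro: degree_one_mono[OF h])
  have "rotationally_ordered (hull_conf h \<rho> x)"
    unfolding rotationally_ordered_def T_trans_hull_conf[OF h]
  proof (intro allI)
    fix p q
    show "hull_conf h \<rho> (x + \<rho> * of_int p + of_int q) \<le> hull_conf h \<rho> x
        \<or> hull_conf h \<rho> x \<le> hull_conf h \<rho> (x + \<rho> * of_int p + of_int q)"
      by (cases "x + \<rho> * of_int p + of_int q \<le> x") (simp_all add: mono)
  qed
  moreover have "\<bar>hull_conf h \<rho> x j - hull_conf h \<rho> x i - \<rho> * of_int (j - i)\<bar> \<le> 1" for i j
    using degree_one_osc[OF h, of "\<rho> * of_int j + x" "\<rho> * of_int i + x"]
    by (simp add: hull_conf_def algebra_simps)
  ultimately show ?thesis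
    by (simp add: ordered_confs_def)
qed

lemma has_rotation_number_ordered_confs:
  assumes "u \<in> ordered_confs \<rho>"
  shows "has_rotation_number u \<rho>"
  unfolding has_rotation_number_def
proof (rule tendstoI)
  fix e :: real assume "0 < e"
  define N where "N = max 1 (\<lceil>1 / e\<rceil> + 1)"
  have "dist ((u j - u i) / of_int (j - i)) \<rho> < e" if "N \<le> \<bar>j - i\<bar>" for i j
  proof -
    define n where "n = j - i"
    have n: "n \<noteq> 0" "1 / e < of_int \<bar>n\<bar>"
      using that unfolding n_def N_def by linarith+
    have "(u j - u i) / of_int n - \<rho> = (u j - u i - \<rho> * of_int n) / of_int n"
      using n by (simp add: field_simps)
    moreover have "\<bar>u j - u i - \<rho> * of_int n\<bar> \<le> 1"
      using assms by (simp add: ordered_confs_def n_def)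
    ultimately have "\<bar>(u j - u i) / of_int n - \<rho>\<bar> \<le> 1 / of_int \<bar>n\<bar>"
      by (simp add: divide_right_mono)
    also have "\<dots> < e"
      using n \<open>0 < e\<close> by (simp add: field_simps)
    finally show ?thesis
      by (simp add: dist_real_def n_def)
  qed
  moreover have "\<forall>\<^sub>F n in at_top. N \<le> n"
    by (rule eventually_ge_at_top)
  ultimately show "\<forall>\<^sub>F p in filtercomap (\<lambda>(i, j). \<bar>j - i\<bar>) at_top.
      dist (case p of (i, j) \<Rightarrow> (u j - u i) / of_int (j - i)) \<rho> < e"
    unfolding eventually_filtercomap by (intro exI[of _ "\<lambda>n. N \<le> n"]) auto
qed

lemma flow_times_nonneg: "t \<in> flow_times d \<Longrightarrow> 0 \<le> t"
  by (cases d) auto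

section \<open>Evolution of hull functions and transfer of the ergodic measure\<close>

context twist_chain
begin

lemma continuous_on_flow: "0 \<le> t \<Longrightarrow> continuous_on (K_conf n) (flow V F t)"
proof (intro continuous_on_coordinatewise_then_product continuous_on_sequentiallyI)
  fix U u j assume t: "0 \<le> t" and U: "\<forall>k. U k \<in> K_conf n" and u: "u \<in> K_conf n" and lim: "U \<longlonglongrightarrow> u"
  have "(\<lambda>k. U k i) \<longlonglongrightarrow> u i" for i
    using continuous_on_tendsto_compose[OF continuous_on_product_coordinates lim] by simp
  then show "(\<lambda>k. flow V F t (U k) j) \<longlonglongrightarrow> flow V F t u j"
    using U u t by (intro flow_continuous) auto
qed

lemma measurable_quot_flow: "0 \<le> t \<Longrightarrow> quot_map (flow V F t) \<in> X_quot_borel \<rightarrow>\<^sub>M X_quot_borel"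
  by (rule measurable_quot_map) (auto intro: flow_X_conf flow_T_trans continuous_on_flow)

lemma quot_flow_R_class:
  "0 \<le> t \<Longrightarrow> u \<in> X_conf \<Longrightarrow> quot_map (flow V F t) (R_class u) = R_class (flow V F t u)"
  by (rule quot_map_R_class) (auto intro: flow_X_conf flow_T_trans)

definition hull_map :: "real \<Rightarrow> real \<Rightarrow> (real \<Rightarrow> real) \<Rightarrow> real \<Rightarrow> real" where
  "hull_map \<rho> t h x = flow V F t (hull_conf h \<rho> x) 0"

text \<open>Site \<open>j\<close> at phase \<open>x\<close> is site 0 at phase
  \<open>x + \<rho> * j\<close>, and the flow commutes with the shift. Hence observing site 0 for
  all phases determines the image.\<close>

lemma flow_hull_conf:
  assumes h: "h \<in> degree_one" and t: "0 \<le> t"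
  shows "flow V F t (hull_conf h \<rho> x) = hull_conf (hull_map \<rho> t h) \<rho> x"
proof
  fix j
  have "flow V F t (hull_conf h \<rho> x) j = T_trans j 0 (flow V F t (hull_conf h \<rho> x)) 0"
    by (simp add: T_trans_def)
  also have "\<dots> = flow V F t (T_trans j 0 (hull_conf h \<rho> x)) 0"
    by (simp add: flow_T_trans hull_conf_X_conf h t)
  also have "\<dots> = hull_conf (hull_map \<rho> t h) \<rho> x j"
    by (simp add: T_trans_hull_conf[OF h]) (simp add: hull_conf_def hull_map_def add.commute)
  finally show "flow V F t (hull_conf h \<rho> x) j = hull_conf (hull_map \<rho> t h) \<rho> x j" .
qed

text \<open>Order and degree are inherited from the flow, and composition holds because
  \<open>S\<close> consists of periods of \<open>F\<close>. Translating the phase merely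
  reparametrizes the family, and pointwise convergence of profiles is sitewise convergence within
  one \<open>K_conf n\<close>.\<close>

lemma degree_one_semigroup_hull_map:
  assumes S: "\<And>n. real n \<in> S" "\<And>t. t \<in> S \<Longrightarrow> 0 \<le> t" "\<And>s t. s \<in> S \<Longrightarrow> t \<in> S \<Longrightarrow> s + t \<in> S"
      "\<And>s t. s \<in> S \<Longrightarrow> t \<in> S \<Longrightarrow> s \<le> t \<Longrightarrow> t - s \<in> S"
    and F: "\<And>s t. s \<in> S \<Longrightarrow> F (t + s) = F t"
  shows "degree_one_semigroup S (hull_map \<rho>)"
proof
  show "real n \<in> S" for n
    by (rule S)
  show "0 \<le> t" if "t \<in> S" for t
    using that by (rule S)
  show "s + t \<in> S" if "s \<in> S" "t \<in> S" for s t
    using that by (rule S)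
  show "t - s \<in> S" if "s \<in> S" "t \<in> S" "s \<le> t" for s t
    using that by (rule S)
  show order: "hull_map \<rho> t h \<le> hull_map \<rho> t k"
    if "t \<in> S" "h \<in> degree_one" "k \<in> degree_one" "h \<le> k" for t h k
  proof (rule le_funI)
    fix x
    have "hull_conf h \<rho> x \<le> hull_conf k \<rho> x"
      using that(4) by (simp add: hull_conf_def le_fun_def)
    then show "hull_map \<rho> t h x \<le> hull_map \<rho> t k x"
      using flow_mono[OF hull_conf_X_conf hull_conf_X_conf _ S(2)] that
      by (simp add: hull_map_def le_fun_def)
  qed
  show shift: "hull_map \<rho> t (\<lambda>x. h (x + a)) = (\<lambda>x. hull_map \<rho> t h (x + a))" for t h a
  proof -
    have "hull_conf (\<lambda>x. h (x + a)) \<rho> x = hull_conf h \<rho> (x + a)" for x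
      by (simp add: hull_conf_def add.assoc)
    then show ?thesis
      unfolding hull_map_def by simp
  qed
  show "hull_map \<rho> t h \<in> degree_one" if t: "t \<in> S" and h: "h \<in> degree_one" for t h
  proof (rule degree_oneI)
    fix x y :: real assume "x \<le> y"
    then have "hull_conf h \<rho> x \<le> hull_conf h \<rho> y"
      by (auto simp: hull_conf_def le_fun_def intro: degree_one_mono[OF h])
    then show "hull_map \<rho> t h x \<le> hull_map \<rho> t h y"
      using flow_mono[OF hull_conf_X_conf hull_conf_X_conf _ S(2)] h t
      by (simp add: hull_map_def le_fun_def)
  next
    fix x
    have "hull_conf h \<rho> (x + 1) = T_trans 0 1 (hull_conf h \<rho> x)"
      by (simp add: T_trans_hull_conf[OF h])
    then have "flow V F t (hull_conf h \<rho> (x + 1)) = T_trans 0 1 (flow V F t (hull_conf h \<rho> x))"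
      using flow_T_trans[OF hull_conf_X_conf[OF h] S(2)[OF t]] by simp
    then show "hull_map \<rho> t h (x + 1) = hull_map \<rho> t h x + 1"
      by (simp add: hull_map_def T_trans_def)
  qed
  show "hull_map \<rho> (t + s) h = hull_map \<rho> t (hull_map \<rho> s h)"
    if "s \<in> S" "t \<in> S" "h \<in> degree_one" for s t h
    using that flow_add[OF hull_conf_X_conf[OF that(3)] S(2) S(2)] F flow_hull_conf[OF that(3) S(2)]
    by (simp add: hull_map_def fun_eq_iff)
  show "(\<lambda>k. hull_map \<rho> t (H k) x) \<longlonglongrightarrow> hull_map \<rho> t h x"
    if "t \<in> S" "\<And>k. H k \<in> degree_one" "h \<in> degree_one" "\<And>x. (\<lambda>k. H k x) \<longlonglongrightarrow> h x" for t H h x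
    unfolding hull_map_def
    by (rule flow_continuous[OF hull_conf_K_conf hull_conf_K_conf _ S(2)])
       (use that in \<open>auto simp: hull_conf_def\<close>)
  obtain M where M: "\<And>u t j. u \<in> K_conf (nat \<lceil>\<bar>\<rho>\<bar> + 1\<rceil>) \<Longrightarrow> 0 \<le> t \<Longrightarrow> \<bar>flow V F t u j - u j\<bar> \<le> M * t"
    using flow_speed by metis
  show "\<exists>C. \<forall>t\<in>S. t \<le> 1 \<longrightarrow> \<bar>hull_map \<rho> t (\<lambda>x. x) 0\<bar> \<le> C"
  proof (intro exI ballI impI)
    fix t assume t: "t \<in> S" "t \<le> 1"
    have "\<bar>hull_map \<rho> t (\<lambda>x. x) 0\<bar> \<le> M * t"
      using M[OF hull_conf_K_conf[OF degree_one_id] S(2)[OF t(1)], of 0 0]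
      by (simp add: hull_map_def) (simp add: hull_conf_def)
    also have "\<dots> \<le> \<bar>M\<bar> * 1"
      using t S(2) by (intro mult_mono) auto
    finally show "\<bar>hull_map \<rho> t (\<lambda>x. x) 0\<bar> \<le> \<bar>M\<bar> * 1" .
  qed
qed

text \<open>The map \<open>q\<close> intertwines phase translations with shift and flow, and
  preimages under \<open>q\<close> are periodic because adding 1 to the phase stays in the same
  class. Invariance and the zero-one law concern preimages only, so they pass to the image measure
  whether or not \<open>q\<close> is injective. The angle is \<open>- \<rho>\<close> since
  \<open>T_shift\<close> lowers the index.\<close>

lemma flow_shift_ergodic_hull:
  assumes h: "h \<in> degree_one"
    and wave: "\<And>t x. t \<in> flow_times d \<Longrightarrow> flow V F t (hull_conf h \<rho> x) = hull_conf h \<rho> (x + c * t)"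
    and \<nu>: "rotation_ergodic (insert (- \<rho>) ((*) c ` flow_times d)) \<nu>"
  defines "\<mu> \<equiv> distr \<nu> X_quot_borel (\<lambda>x. R_class (hull_conf h \<rho> x))"
  shows "flow_shift_ergodic d V F \<mu>"
    and "measure \<mu> (classes_in (ordered_confs \<rho>)) = 1"
proof -
  define q where "q = (\<lambda>x. R_class (hull_conf h \<rho> x))"
  interpret \<nu>: prob_space \<nu>
    using \<nu> by (simp add: rotation_ergodic_def)
  have sets_\<nu>: "sets \<nu> = sets borel"
    using \<nu> by (simp add: rotation_ergodic_def)
  have space_\<nu>: "space \<nu> = UNIV"
    using sets_eq_imp_space_eq[OF sets_\<nu>] by simp
  have qb: "q \<in> borel \<rightarrow>\<^sub>M X_quot_borel"
    unfolding q_def by (rule measurable_R_class_hull_conf[OF h])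
  then have q: "q \<in> \<nu> \<rightarrow>\<^sub>M X_quot_borel"
    by (simp add: measurable_cong_sets[OF sets_\<nu> refl])
  have \<mu>: "\<mu> = distr \<nu> X_quot_borel q"
    by (simp add: \<mu>_def q_def)
  have sets_\<mu>: "sets \<mu> = sets X_quot_borel"
    by (simp add: \<mu>)
  have em: "emeasure \<mu> A = emeasure \<nu> {x. q x \<in> A}" if "A \<in> sets X_quot_borel" for A
    using that by (simp add: \<mu> emeasure_distr[OF q] space_\<nu> vimage_def)
  have q1: "q (x + 1) = q x" for x
    unfolding q_def
    using R_class_T_trans[OF hull_conf_X_conf[OF h], of 1 \<rho> x] by (simp add: T_trans_hull_conf[OF h])
  have per: "periodic_borel_set {x. q x \<in> A}" if A: "A \<in> sets X_quot_borel" for A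
  proof
    have "q -` A \<inter> space borel \<in> sets borel"
      by (rule measurable_sets[OF qb A])
    then show "{x. q x \<in> A} \<in> sets borel"
      by (simp add: vimage_def)
  qed (simp add: q1)
  let ?U = "insert (- \<rho>) ((*) c ` flow_times d)"
  have invariant: "measure_invariant \<mu> f"
    if f: "f \<in> X_quot_borel \<rightarrow>\<^sub>M X_quot_borel" and \<theta>: "\<theta> \<in> ?U" and fq: "\<And>x. f (q x) = q (x + \<theta>)" for f \<theta>
    unfolding measure_invariant_def
  proof
    show f': "f \<in> \<mu> \<rightarrow>\<^sub>M \<mu>"
      using f by (simp add: measurable_cong_sets[OF sets_\<mu> sets_\<mu>])
    show "distr \<mu> \<mu> f = \<mu>"
    proof (rule measure_eqI)
      fix A assume "A \<in> sets (distr \<mu> \<mu> f)"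
      then have A: "A \<in> sets X_quot_borel"
        by (simp add: sets_\<mu>)
      have fA: "f -` A \<inter> space \<mu> \<in> sets X_quot_borel"
        using measurable_sets[OF f'] A sets_\<mu> by auto
      have "q x \<in> space \<mu>" for x
        using measurable_space[OF q] by (simp add: space_\<nu> \<mu>)
      then have "{x. q x \<in> f -` A \<inter> space \<mu>} = {x. x + \<theta> \<in> {x. q x \<in> A}}"
        using fq by auto
      moreover have "emeasure \<nu> {x. x + \<theta> \<in> {x. q x \<in> A}} = emeasure \<nu> {x. q x \<in> A}"
        using \<nu> per[OF A] \<theta> unfolding rotation_ergodic_def by blast
      ultimately have "emeasure \<mu> (f -` A \<inter> space \<mu>) = emeasure \<mu> A"
        by (simp only: em[OF fA] em[OF A])
      then show "emeasure (distr \<mu> \<mu> f) A = emeasure \<mu> A"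
        using A by (simp add: emeasure_distr[OF f'] sets_\<mu>)
    qed simp
  qed
  have Tq: "quot_map T_shift (q x) = q (x + - \<rho>)" for x
  proof -
    have "quot_map T_shift (q x) = R_class (T_shift (hull_conf h \<rho> x))"
      unfolding q_def T_shift_eq_T_trans
      by (rule quot_map_R_class) (auto simp: T_trans_T_trans T_trans_X_conf hull_conf_X_conf h)
    then show ?thesis
      by (simp add: q_def T_shift_eq_T_trans T_trans_hull_conf[OF h])
  qed
  have Fq: "quot_map (flow V F t) (q x) = q (x + c * t)" if "t \<in> flow_times d" for t x
    using quot_flow_R_class[OF flow_times_nonneg[OF that] hull_conf_X_conf[OF h], of \<rho> x] wave[OF that]
    by (simp add: q_def)
  have inv_T: "measure_invariant \<mu> (quot_map T_shift)"
  proof (rule invariant[OF _ _ Tq])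
    show "quot_map T_shift \<in> X_quot_borel \<rightarrow>\<^sub>M X_quot_borel"
      unfolding T_shift_eq_T_trans
      by (rule measurable_quot_map) (auto simp: T_trans_T_trans T_trans_X_conf continuous_on_T_trans)
  qed simp
  have inv_F: "measure_invariant \<mu> (quot_map (flow V F t))" if "t \<in> flow_times d" for t
    by (rule invariant[OF measurable_quot_flow[OF flow_times_nonneg[OF that]] _ Fq[OF that]])
       (use that in auto)
  have ergodic: "measure \<mu> A \<in> {0, 1}"
    if A: "A \<in> sets \<mu>" and inv: "flow_shift_invariant_set d V F A" for A
  proof -
    have A': "A \<in> sets X_quot_borel"
      using A by (simp add: sets_\<mu>)
    have "\<forall>\<theta>\<in>?U. \<forall>x\<in>{x. q x \<in> A}. x + \<theta> \<in> {x. q x \<in> A}"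
    proof (intro ballI)
      fix \<theta> x assume \<theta>: "\<theta> \<in> ?U" and x: "x \<in> {x. q x \<in> A}"
      have "quot_map T_shift (q x) \<in> A"
        using inv x unfolding flow_shift_invariant_set_def by blast
      moreover have "quot_map (flow V F t) (q x) \<in> A" if "t \<in> flow_times d" for t
        using inv x that unfolding flow_shift_invariant_set_def phase_maps_def by blast
      ultimately show "x + \<theta> \<in> {x. q x \<in> A}"
        using \<theta> Tq Fq by auto
    qed
    then have "measure \<nu> {x. q x \<in> A} \<in> {0, 1}"
      using \<nu> per[OF A'] unfolding rotation_ergodic_def by blast
    then show ?thesis
      by (simp add: measure_def em[OF A'])
  qed
  show "flow_shift_ergodic d V F \<mu>"
    unfolding flow_shift_ergodic_def flow_shift_invariant_measure_def phase_maps_def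
    using sets_\<mu> inv_T inv_F ergodic \<nu>.prob_space_distr[OF q] by (auto simp: \<mu>)
  have "q x \<in> classes_in (ordered_confs \<rho>)" for x
    unfolding q_def
    by (simp add: R_class_in_classes_in R_saturated_ordered_confs hull_conf_X_conf[OF h] hull_conf_ordered[OF h])
  then have "emeasure \<mu> (classes_in (ordered_confs \<rho>)) = emeasure \<nu> (space \<nu>)"
    by (simp add: em classes_in_closed closed_ordered_confs R_saturated_ordered_confs space_\<nu>)
  then show "measure \<mu> (classes_in (ordered_confs \<rho>)) = 1"
    by (simp add: measure_def \<nu>.emeasure_space_1)
qed

end

section \<open>The two kinds of drive\<close>

lemma real_analytic_continuous:
  assumes "real_analytic f" shows "continuous_on UNIV f"
proof -
  have "isCont f t0" for t0
  proof -
    obtain r a where "0 < r" and sums: "\<And>t. \<bar>t - t0\<bar> < r \<Longrightarrow> (\<lambda>n. a n * (t - t0) ^ n) sums f t"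
      using assms unfolding real_analytic_def by metis
    define g where "g = (\<lambda>x. \<Sum>n. a n * x ^ n)"
    have "isCont g 0"
      unfolding g_def
    proof (rule isCont_powser)
      show "summable (\<lambda>n. a n * (r / 2) ^ n)"
        using sums[of "t0 + r / 2"] \<open>0 < r\<close> by (auto intro: sums_summable)
    qed (use \<open>0 < r\<close> in simp)
    then have "isCont (\<lambda>t. g (t - t0)) t0"
      by (intro isCont_o2[where f = "\<lambda>t. t - t0" and g = g]) auto
    moreover have "\<forall>\<^sub>F t in nhds t0. f t = g (t - t0)"
    proof -
      have "\<forall>\<^sub>F t in nhds t0. dist t t0 < r"
        using eventually_nhds_metric \<open>0 < r\<close> by blast
      then show ?thesis
        by eventually_elim (simp add: g_def dist_real_def sums_unique[OF sums])
    qed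
    ultimately show ?thesis
      by (simp cong: isCont_cong)
  qed
  then show ?thesis
    by (simp add: continuous_at_imp_continuous_on)
qed

lemma periodic_bounded:
  fixes F :: "real \<Rightarrow> real"
  assumes "continuous_on UNIV F" "\<And>t. F (t + 1) = F t"
  shows "bounded (range F)"
proof -
  have "F t \<in> F ` {0..1}" for t
  proof -
    have "F t = F (t - of_int \<lfloor>t\<rfloor>)"
      using periodic_of_int[of "\<lambda>u v. F u" "t - of_int \<lfloor>t\<rfloor>" "\<lfloor>t\<rfloor>" 0] assms(2) by simp
    moreover have "t - of_int \<lfloor>t\<rfloor> \<in> {0..1}"
      by (auto; linarith)
    ultimately show ?thesis by blast
  qed
  then have "range F \<subseteq> F ` {0..1}"
    by blast
  moreover have "compact (F ` {0..1})"
    using assms(1) by (intro compact_continuous_image) (auto intro: continuous_on_subset)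
  ultimately show ?thesis
    using bounded_subset compact_imp_bounded by blast
qed

text \<open>If all angles are rational, then in the DC case \<open>c\<close> must vanish, since
  otherwise the products \<open>c t\<close> fill a half line. In both cases at most one angle
  besides \<open>\<sigma>\<close> remains, and the product of two denominators serves for
  both.\<close>

lemma ex_rotation_ergodic:
  "\<exists>\<nu>. rotation_ergodic (insert \<sigma> ((*) c ` flow_times d)) \<nu>"
proof (cases "\<exists>\<theta>\<in>insert \<sigma> ((*) c ` flow_times d). \<theta> \<notin> \<rat>")
  case True
  then obtain \<theta> where "\<theta> \<in> insert \<sigma> ((*) c ` flow_times d)" "\<theta> \<notin> \<rat>"
    by (rule bexE)
  then have "rotation_ergodic (insert \<sigma> ((*) c ` flow_times d)) (uniform_measure lborel {0..<1})"
    by (rule rotation_ergodic_irrational)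
  then show ?thesis
    by (rule exI)
next
  case False
  then have rat: "\<sigma> \<in> \<rat>" "\<And>t. t \<in> flow_times d \<Longrightarrow> c * t \<in> \<rat>"
    by auto
  have "\<exists>c'\<in>\<rat>. (*) c ` flow_times d \<subseteq> {c'}"
  proof (cases d)
    case DC
    have "c = 0"
    proof (rule ccontr)
      assume "c \<noteq> 0"
      have "(\<rat> :: real set) \<noteq> UNIV"
        using uncountable_UNIV_real countable_rat by metis
      then obtain x :: real where "x \<notin> \<rat>"
        by blast
      then have "\<bar>x\<bar> \<notin> \<rat>"
        by (simp add: abs_if)
      \<comment> \<open>The time \<open>\<bar>x\<bar> / \<bar>c\<bar>\<close> is nonnegative and
        makes the angle equal to plus or minus the irrational number
        \<open>\<bar>x\<bar>\<close>.\<close>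
      moreover have "c * (\<bar>x\<bar> / \<bar>c\<bar>) \<in> \<rat>"
        using DC by (intro rat) simp
      moreover have "c * (\<bar>x\<bar> / \<bar>c\<bar>) = sgn c * \<bar>x\<bar>"
        using \<open>c \<noteq> 0\<close> by (simp add: sgn_if)
      ultimately show False
        using \<open>c \<noteq> 0\<close> by (simp add: sgn_if split: if_splits)
    qed
    then show ?thesis by auto
  next
    case AC
    then show ?thesis
      using rat(2) by auto
  qed
  then obtain c' where c': "c' \<in> \<rat>" "(*) c ` flow_times d \<subseteq> {c'}"
    by blast
  obtain a b where a: "\<sigma> = of_int a / of_int b" "b > 0"
    using rat(1) by (meson Rats_cases')
  obtain a' b' where a': "c' = of_int a' / of_int b'" "b' > 0"
    using c'(1) by (meson Rats_cases')
  have N: "real (nat (b * b')) = of_int b * of_int b'"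
    using a(2) a'(2) by simp
  have "\<exists>N>0. \<forall>\<theta>\<in>insert \<sigma> ((*) c ` flow_times d). real N * \<theta> \<in> \<int>"
  proof (intro exI[of _ "nat (b * b')"] conjI ballI)
    show "nat (b * b') > 0"
      using a(2) a'(2) by simp
    fix \<theta> assume "\<theta> \<in> insert \<sigma> ((*) c ` flow_times d)"
    then have "\<theta> = \<sigma> \<or> \<theta> = c'"
      using c'(2) by auto
    then have "real (nat (b * b')) * \<theta> = of_int (a * b') \<or> real (nat (b * b')) * \<theta> = of_int (a' * b)"
      unfolding N using a a' by auto
    then show "real (nat (b * b')) * \<theta> \<in> \<int>"
      by (metis Ints_of_int)
  qed
  then show ?thesis
    by (rule rotation_ergodic_rational)
qed

theorem theorem3:
  fixes V :: "real \<Rightarrow> real \<Rightarrow> real" and F :: "real \<Rightarrow> real"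
    and \<delta> \<rho> :: real and d :: drive
  assumes smooth: "C2_plane V"
    and periodic: "\<And>u v. V (u + 1) (v + 1) = V u v"
    and delta: "\<delta> > 0"
    and twist: "\<And>u v. partial2 (partial1 V) u v \<le> - \<delta>"
    and drive: "admissible_drive d V F"
  shows "\<exists>\<mu>. flow_shift_ergodic d V F \<mu> \<and>
    (\<exists>S\<in>sets \<mu>. measure \<mu> S = 1 \<and>
      (\<forall>c\<in>S. \<forall>u\<in>c. rotationally_ordered u \<and> has_rotation_number u \<rho>))"
proof -
  \<comment> \<open>In the AC case \<open>flow_times\<close> is just \<open>{1}\<close>, whereas the
    travelling wave argument needs a semigroup of times; hence all natural numbers.\<close>
  define S where "S = (case d of DC \<Rightarrow> {0..} | AC \<Rightarrow> range real)"
  have S_nat: "real n \<in> S" for n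
    by (cases d) (auto simp: S_def)
  have S_diff: "t - s \<in> S" if "s \<in> S" "t \<in> S" "s \<le> t" for s t
  proof (cases d)
    case AC
    then obtain m n where "s = real m" "t = real n"
      using \<open>s \<in> S\<close> \<open>t \<in> S\<close> by (auto simp: S_def)
    then have "t - s = real (n - m)"
      using \<open>s \<le> t\<close> by simp
    then show ?thesis
      using S_nat by simp
  qed (use that in \<open>simp add: S_def\<close>)
  have S_add: "s + t \<in> S" if "s \<in> S" "t \<in> S" for s t
  proof (cases d)
    case AC
    then obtain m n where "s = real m" "t = real n"
      using \<open>s \<in> S\<close> \<open>t \<in> S\<close> by (auto simp: S_def)
    then show ?thesis
      using S_nat[of "m + n"] by simp
  qed (use that in \<open>simp add: S_def\<close>)
  have S_nonneg: "0 \<le> t" if "t \<in> S" for t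
    using that by (cases d) (auto simp: S_def)
  have flow_times_S: "flow_times d \<subseteq> S"
    using S_nat[of 1] by (cases d) (auto simp: S_def)
  have F_1: "F (t + 1) = F t" for t
    using drive by (cases d) auto
  have F_S: "F (t + s) = F t" if "s \<in> S" for s t
  proof (cases d)
    case AC
    then obtain n where "s = real n"
      using \<open>s \<in> S\<close> by (auto simp: S_def)
    then show ?thesis
      using periodic_of_int[of "\<lambda>u v. F u" t "int n" 0] F_1 by simp
  qed (use drive in auto)
  have F_cont: "continuous_on UNIV F"
  proof (cases d)
    case DC
    then obtain c where "F = (\<lambda>t. c)"
      using drive by auto
    then show ?thesis by simp
  qed (use drive real_analytic_continuous in auto)
  interpret twist_chain V F
  proof
    show "partial2 (partial1 V) u v \<le> 0" for u v
      using twist[of u v] delta by simp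
  qed (fact smooth periodic F_cont periodic_bounded[OF F_cont F_1])+
  interpret degree_one_semigroup S "hull_map \<rho>"
    by (rule degree_one_semigroup_hull_map) (fact S_nat S_nonneg S_add S_diff F_S)+
  obtain h c where h: "h \<in> degree_one" and wave: "\<And>t. t \<in> S \<Longrightarrow> hull_map \<rho> t h = (\<lambda>x. h (x + c * t))"
    using ex_travelling_wave by blast
  obtain \<nu> where \<nu>: "rotation_ergodic (insert (- \<rho>) ((*) c ` flow_times d)) \<nu>"
    using ex_rotation_ergodic by blast
  define \<mu> where "\<mu> = distr \<nu> X_quot_borel (\<lambda>x. R_class (hull_conf h \<rho> x))"
  have "flow V F t (hull_conf h \<rho> x) = hull_conf h \<rho> (x + c * t)" if "t \<in> flow_times d" for t x
  proof -
    have "t \<in> S"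
      using that flow_times_S by blast
    then show ?thesis
      using flow_hull_conf[OF h S_nonneg] wave by (simp add: hull_conf_def add_ac)
  qed
  note erg = flow_shift_ergodic_hull[OF h this \<nu>, folded \<mu>_def]
  show ?thesis
  proof (intro exI[of _ \<mu>] conjI bexI[of _ "classes_in (ordered_confs \<rho>)"] ballI)
    show "flow_shift_ergodic d V F \<mu>" "measure \<mu> (classes_in (ordered_confs \<rho>)) = 1"
      using erg by auto
    show "classes_in (ordered_confs \<rho>) \<in> sets \<mu>"
      by (simp add: \<mu>_def classes_in_closed closed_ordered_confs R_saturated_ordered_confs)
    fix u C assume "C \<in> classes_in (ordered_confs \<rho>)" "u \<in> C"
    then have "u \<in> ordered_confs \<rho>"
      by (auto simp: classes_in_def)
    then show "rotationally_ordered u" "has_rotation_number u \<rho>"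
      by (auto simp: ordered_confs_def intro: has_rotation_number_ordered_confs[unfolded ordered_confs_def])
  qed
qed

end
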